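(* Let $X_1,X_2,\ldots$ be i.i.d. random variables with mean $0$, variance $1$ and common distribution function $F$, and let $\bm X_n=(X_1,\ldots,X_n)^\top$, $\bm X_\infty=(X_1,X_2,\ldots)^\top$. Let $\{G_n\}_{n\ge1}$ be a sequence of graphs with $G_n\in\mathscr G_n$ and $|E(G_n)|\to\infty$. Suppose there exist an infinite matrix $\Sigma=((\sigma_{st}))_{s,t\ge1}$ and a real sequence $\bm\rho=(\rho_1,\rho_2,\ldots)$ such that $\{G_n\}$ satisfies the $\Sigma$-co-degree condition and the $\bm\rho$-spectral condition. Then $$S_{G_n}(\bm X_n)\xrightarrow{D} Q:=Q_1+Q_2+Q_3,$$ where $Q_1,Q_2,Q_3$ are independent random variables with $Q_1\sim N(0,\bm X_\infty^\top\Sigma\bm X_\infty)$; $Q_2\sim N(0,\rho^2)$ where $\rho^2:=1-\sum_{s=1}^\infty\big(\sigma_{ss}+\tfrac12\rho_s^2\big)$; $Q_3\sim\tfrac12\sum_{s=1}^\infty\rho_sY_s$, where $\{Y_s\}_{s\ge1}$ are i.i.d. with the law of $\chi^2_1-1$.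
   Context: $\mathscr G_n$ denotes the set of simple undirected graphs on vertex set $\{1,\ldots,n\}$ whose vertices are labeled so that the degrees satisfy $d_1\ge d_2\ge\cdots\ge d_n$ ($d_v$ = degree of vertex $v$). For $G_n\in\mathscr G_n$, $A(G_n)=((a_{u,v}))_{1\le u,v\le n}$ is its adjacency matrix (symmetric, $\{0,1\}$-valued, zero diagonal) and $E(G_n)$ its edge set. For $\bm x\in\mathbb R^n$, $S_{G_n}(\bm x):=\frac{1}{\sqrt{|E(G_n)|}}\sum_{1\le u<v\le n}a_{u,v}x_ux_v=\frac{1}{2\sqrt{|E(G_n)|}}\bm x^\top A(G_n)\bm x$. $\Sigma$-co-degree condition: for each fixed $s,t\ge1$, $\lim_{n\to\infty}\frac{1}{|E(G_n)|}\sum_{v=1}^n a_{s,v}a_{v,t}=\sigma_{st}$. $\bm\rho$-spectral condition: for $K\ge0$ let $G_{n,K}$ be the subgraph of $G_n$ induced by the vertices $\{K+1,\ldots,n\}$, with adjacency matrix $A_{n,K}$ and eigenvalues $\lambda^{(1)}_{n,K},\ldots,\lambda^{(n-K)}_{n,K}$ ordered so that $|\lambda^{(1)}_{n,K}|\ge|\lambda^{(2)}_{n,K}|\ge\cdots$; the condition is that for every fixed $s\ge1$, $\lim_{K\to\infty}\lim_{n\to\infty}\frac{1}{\sqrt{|E(G_n)|}}\lambda^{(s)}_{n,K}=\rho_s$. For a nonnegative random variable $A$, $N(0,A)$ denotes the normal variance mixture: the law of $\sqrt{A}\,W$ with $W\sim N(0,1)$ independent of $A$ (characteristic function $t\mapsto\mathbb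 E[e^{-At^2/2}]$). The random variable $\bm X_\infty^\top\Sigma\bm X_\infty=\sum_{s,t\ge1}\sigma_{st}X_sX_t$ is defined as the $L^1$-limit, as $K\to\infty$, of $\sum_{1\le s,t\le K}\sigma_{st}X_sX_t$ (this limit exists and is nonnegative under the co-degree condition). *)

theory Defs
  imports "HOL-Probability.Probability" "Jordan_Normal_Form.Char_Poly"
begin

definition simple_graph_on :: "nat \<Rightarrow> (nat \<Rightarrow> nat \<Rightarrow> bool) \<Rightarrow> bool" where
  "simple_graph_on n E \<longleftrightarrow>
     (\<forall>u v. E u v \<longrightarrow> u \<in> {1..n} \<and> v \<in> {1..n}) \<and>
     (\<forall>u v. E u v = E v u) \<and> (\<forall>u. \<not> E u u)"

definition gdegree :: "nat \<Rightarrow> (nat \<Rightarrow> nat \<Rightarrow> bool) \<Rightarrow> nat \<Rightarrow> nat" where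
  "gdegree n E v = card {w \<in> {1..n}. E v w}"

definition in_graph_class :: "nat \<Rightarrow> (nat \<Rightarrow> nat \<Rightarrow> bool) \<Rightarrow> bool" where
  "in_graph_class n E \<longleftrightarrow> simple_graph_on n E \<and>
     (\<forall>u v. 1 \<le> u \<longrightarrow> u \<le> v \<longrightarrow> v \<le> n \<longrightarrow> gdegree n E v \<le> gdegree n E u)"

definition num_edges :: "nat \<Rightarrow> (nat \<Rightarrow> nat \<Rightarrow> bool) \<Rightarrow> nat" where
  "num_edges n E = card {(u, v). 1 \<le> u \<and> u < v \<and> v \<le> n \<and> E u v}"

definition adj :: "(nat \<Rightarrow> nat \<Rightarrow> bool) \<Rightarrow> nat \<Rightarrow> nat \<Rightarrow> real" where
  "adj E u v = (if E u v then 1 else 0)"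

definition S_G :: "nat \<Rightarrow> (nat \<Rightarrow> nat \<Rightarrow> bool) \<Rightarrow> (nat \<Rightarrow> real) \<Rightarrow> real" where
  "S_G n E x = (1 / sqrt (real (num_edges n E))) *
     (\<Sum>u\<in>{1..n}. \<Sum>v\<in>{u<..n}. adj E u v * x u * x v)"

text \<open>Adjacency matrix A_{n,K} of the subgraph induced by {K+1..n}
  (row/column index i corresponds to vertex i+K+1).\<close>
definition adj_mat_K :: "nat \<Rightarrow> nat \<Rightarrow> (nat \<Rightarrow> nat \<Rightarrow> bool) \<Rightarrow> real mat" where
  "adj_mat_K n K E = mat (n - K) (n - K) (\<lambda>(i, j). adj E (i + K + 1) (j + K + 1))"

text \<open>Eigenvalues (with algebraic multiplicity) listed in order of decreasing absolute value;
  ties |lambda| = |mu| are broken by putting the larger (positive) value first.\<close>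
definition eig_list :: "real mat \<Rightarrow> real list" where
  "eig_list A = sort_key (\<lambda>x. - \<bar>x\<bar>) (rev (sorted_list_of_multiset (proots (char_poly A))))"

definition eigval_nK :: "nat \<Rightarrow> nat \<Rightarrow> (nat \<Rightarrow> nat \<Rightarrow> bool) \<Rightarrow> nat \<Rightarrow> real" where
  "eigval_nK n K E s = (let l = eig_list (adj_mat_K n K E) in
      if 1 \<le> s \<and> s \<le> length l then l ! (s - 1) else 0)"

end

theory Submission
  imports Defs "HOL-Real_Asymp.Real_Asymp"
begin

unbundle no vec_syntax
unbundle no inner_syntax

text \<open>
  Fix \<open>K0 \<le> K\<close> and discard every edge except those between \<open>{1..K0}\<close> and \<open>{K+1..n}\<close> and those
  inside \<open>{K+1..n}\<close>; replace the \<open>X i\<close> by standardised truncations. Both changes are small in \<open>L\<^sup>2\<close>,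
  because distinct products \<open>X u * X v\<close> are orthogonal. What remains is \<open>q = c \<bullet> y + y \<bullet> B y / 2\<close>, where
  \<open>B\<close> is the scaled adjacency matrix of the tail and \<open>c\<close> is linear in the first \<open>K0\<close> variables.
  Along \<open>h s = E[exp (i s q - (1 - s\<^sup>2) |c|\<^sup>2 / 2)]\<close>, Stein's integration by parts combined with the
  resolvent \<open>(I - i s B)\<^sup>-\<^sup>1\<close> gives a closed linear differential equation up to a small error: all rows of
  \<open>B\<close> are short since tail degrees are at most \<open>2 m / K\<close>, and \<open>B c\<close> is short since tail codegrees are.
  Integrating from \<open>0\<close> to \<open>1\<close> yields \<open>E[exp (i q)] \<approx> E[exp (- |c|\<^sup>2 / 2)] * det\<^sub>2 (I - i B)\<^sup>-\<^sup>1\<^sup>/\<^sup>2\<close> with the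
  regularised determinant, without passing through Gaussian variables. Letting \<open>n\<close>, \<open>K\<close>, the truncation
  level and \<open>K0\<close> tend to infinity in this order, the first factor produces \<open>Q1\<close>, and the determinant
  splits into the limiting eigenvalues (\<open>Q3\<close>) and the mass of the vanishing ones (\<open>Q2\<close>).
\<close>

section \<open>Orthogonal diagonalisation of real symmetric matrices\<close>

text \<open>The order of the limits is forced by the error terms. The differential equation costs
  order \<open>T ^ 5 / sqrt K\<close> and the coupling of head and tail order
  \<open>sqrt (K0 / K)\<close>, so \<open>K\<close> has to grow while the truncation level and
  \<open>K0\<close> stay fixed. This is why there are two cut-offs: the deleted edges that leave
  \<open>{K0<..K}\<close> have asymptotic weight equal to a block of the series of
  \<open>\<sigma> s s\<close>, which becomes small only with \<open>K0\<close>, whereas at most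
  \<open>K\<^sup>2\<close> edges lie inside \<open>{1..K}\<close> and they vanish against the edge
  count. Summation over all tail vertices is harmless because the Stein error at one vertex is its
  squared row norm times the maximal row norm, and the squared row norms add up to at most
  \<open>2 * t\<^sup>2\<close>. Convergence of every single eigenvalue does not determine the limit
  of the sum of their squares. That sum is twice the number of tail edges, so the codegree condition
  supplies its limit; the excess over the squares of the limiting eigenvalues is what becomes the
  variance of \<open>Q2\<close>.\<close>

lemma symmetric_mat_real_eigenvector:
  fixes A :: "real mat"
  assumes A: "A \<in> carrier_mat (Suc n) (Suc n)" and sym: "A\<^sup>T = A"
  obtains v e where "v \<in> carrier_vec (Suc n)" "v \<noteq> 0\<^sub>v (Suc n)" "A *\<^sub>v v = e \<cdot>\<^sub>v v"
proof -
  let ?C = "map_mat complex_of_real A"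
  let ?m = "Suc n"
  have C: "?C \<in> carrier_mat ?m ?m" using A by simp
  have "degree (char_poly ?C) = ?m" using degree_monic_char_poly[OF C] by simp
  then have "\<not> constant (poly (char_poly ?C))"
    by (simp add: constant_degree)
  then obtain z where z: "poly (char_poly ?C) z = 0"
    using fundamental_theorem_of_algebra by blast
  then have "eigenvalue ?C z" using eigenvalue_root_char_poly[OF C] by simp
  then obtain v where v: "v \<in> carrier_vec ?m" "v \<noteq> 0\<^sub>v ?m" and ev: "?C *\<^sub>v v = z \<cdot>\<^sub>v v"
    using C unfolding eigenvalue_def eigenvector_def by auto
  have symA: "A $$ (i, j) = A $$ (j, i)" if "i < ?m" "j < ?m" for i j
    using arg_cong[OF sym, of "\<lambda>M. M $$ (i, j)"] that A by auto
  have row: "(\<Sum>j<?m. complex_of_real (A $$ (i, j)) * v $ j) = z * v $ i" if "i < ?m" for i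
  proof -
    have "(?C *\<^sub>v v) $ i = (z \<cdot>\<^sub>v v) $ i" using ev by simp
    then show ?thesis using that A v(1) by (simp add: scalar_prod_def atLeast0LessThan)
  qed
  \<comment> \<open>\<open>Q\<close> is the Hermitian form of \<open>A\<close> at \<open>v\<close>.
    Symmetry makes it real, \<open>N\<close> is real and nonzero, and \<open>Q = z * N\<close>, so
    \<open>z\<close> is real.\<close>
  define N where "N = (\<Sum>i<?m. cnj (v $ i) * v $ i)"
  define Q where "Q = (\<Sum>i<?m. \<Sum>j<?m. cnj (v $ i) * complex_of_real (A $$ (i, j)) * v $ j)"
  have Q1: "Q = z * N"
    unfolding Q_def N_def sum_distrib_left
    using row by (intro sum.cong refl) (simp add: sum_distrib_left[symmetric] mult.assoc mult.left_commute)
  have "cnj Q = (\<Sum>i<?m. \<Sum>j<?m. cnj (v $ j) * complex_of_real (A $$ (i, j)) * v $ i)"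
    unfolding Q_def by (simp add: cnj_sum mult_ac)
  also have "\<dots> = (\<Sum>j<?m. \<Sum>i<?m. cnj (v $ j) * complex_of_real (A $$ (i, j)) * v $ i)"
    by (rule sum.swap)
  also have "\<dots> = Q"
    unfolding Q_def using symA by (intro sum.cong refl) auto
  finally have Q2: "cnj Q = Q" .
  have N1: "N = complex_of_real (\<Sum>i<?m. (cmod (v $ i))\<^sup>2)"
    unfolding N_def of_real_sum
    by (intro sum.cong refl) (metis complex_norm_square mult.commute)
  have "\<exists>i<?m. v $ i \<noteq> 0"
    using v by (metis carrier_vecD eq_vecI index_zero_vec(1,2))
  then obtain i where i: "i < ?m" "v $ i \<noteq> 0" by blast
  have "(cmod (v $ i))\<^sup>2 \<le> (\<Sum>i<?m. (cmod (v $ i))\<^sup>2)"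
    using i(1) by (intro member_le_sum) auto
  then have "N \<noteq> 0" unfolding N1 using i(2) by (metis norm_eq_zero of_real_eq_0_iff power2_less_eq_zero_iff)
  moreover have "cnj N = N" unfolding N1 by simp
  ultimately have "cnj z = z" using Q1 Q2 by (metis complex_cnj_mult mult_right_cancel)
  then have zr: "z = complex_of_real (Re z)"
    by (metis Reals_cnj_iff complex_is_Real_iff of_real_Re)
  \<comment> \<open>A real root of the real characteristic polynomial yields a real eigenvector, so
    none has to be extracted from the complex \<open>v\<close>.\<close>
  have "poly (char_poly A) (Re z) = 0"
    using z unfolding of_real_hom.char_poly_hom[OF A]
    by (metis zr of_real_hom.poly_map_poly of_real_eq_0_iff)
  then have "eigenvalue A (Re z)" using eigenvalue_root_char_poly[OF A] by simp
  then show thesis using that A unfolding eigenvalue_def eigenvector_def by auto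
qed

text \<open>For \<open>w = 0\<close> the division by zero yields the identity, so symmetry and
  involutivity hold without a case distinction in their statements.\<close>

definition householder :: "nat \<Rightarrow> real vec \<Rightarrow> real mat" where
  "householder n w = mat n n (\<lambda>(i, j). (if i = j then 1 else 0) - 2 * w $ i * w $ j / (w \<bullet> w))"

lemma householder_carrier [simp]: "householder n w \<in> carrier_mat n n"
  by (simp add: householder_def)

lemma householder_mult_vec:
  assumes "w \<in> carrier_vec n" "x \<in> carrier_vec n"
  shows "householder n w *\<^sub>v x = x - (2 * (w \<bullet> x) / (w \<bullet> w)) \<cdot>\<^sub>v w"
proof (rule eq_vecI)
  fix i assume "i < dim_vec (x - (2 * (w \<bullet> x) / (w \<bullet> w)) \<cdot>\<^sub>v w)"
  then have i: "i < n" using assms by simp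
  have "(householder n w *\<^sub>v x) $ i
      = (\<Sum>j = 0..<n. ((if i = j then 1 else 0) - 2 * w $ i * w $ j / (w \<bullet> w)) * x $ j)"
    using i assms by (simp add: householder_def scalar_prod_def)
  also have "\<dots> = (\<Sum>j = 0..<n. (if i = j then x $ j else 0))
      - 2 * (\<Sum>j = 0..<n. w $ j * x $ j) / (w \<bullet> w) * w $ i"
    unfolding sum_distrib_left sum_distrib_right sum_divide_distrib sum_subtractf[symmetric]
    by (intro sum.cong refl) (simp add: field_simps)
  finally show "(householder n w *\<^sub>v x) $ i = (x - (2 * (w \<bullet> x) / (w \<bullet> w)) \<cdot>\<^sub>v w) $ i"
    using i assms by (simp add: scalar_prod_def)
qed (use assms in \<open>simp add: householder_def\<close>)

lemma householder_transpose: "(householder n w)\<^sup>T = householder n w"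
  by (rule eq_matI) (auto simp: householder_def)

lemma householder_involution:
  assumes w: "w \<in> carrier_vec n"
  shows "householder n w * householder n w = 1\<^sub>m n"
proof (rule mat_col_eqI)
  fix j assume "j < dim_col (1\<^sub>m n :: real mat)"
  then have j: "j < n" by simp
  have cj: "col (householder n w) j = householder n w *\<^sub>v unit_vec n j"
    using j by (intro eq_vecI) (simp_all add: householder_def)
  have *: "householder n w *\<^sub>v (householder n w *\<^sub>v x) = x" if x: "x \<in> carrier_vec n" for x
  proof -
    define c where "c = 2 * (w \<bullet> x) / (w \<bullet> w)"
    have wy: "w \<bullet> (x - c \<cdot>\<^sub>v w) = w \<bullet> x - c * (w \<bullet> w)"
      using w x by (simp add: scalar_prod_minus_distrib[OF w x] scalar_prod_smult_right)
    have "w \<bullet> x - c * (w \<bullet> w) = - (w \<bullet> x)" if "w \<bullet> w \<noteq> 0"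
      unfolding c_def using that by (simp add: field_simps)
    then have "w \<bullet> (x - c \<cdot>\<^sub>v w) = - (w \<bullet> x)" if "w \<bullet> w \<noteq> 0"
      unfolding wy using that by blast
    then have c2: "2 * (w \<bullet> (x - c \<cdot>\<^sub>v w)) / (w \<bullet> w) = - c"
      unfolding c_def by (cases "w \<bullet> w = 0") auto
    show ?thesis
      unfolding householder_mult_vec[OF w x] c_def[symmetric]
      apply (subst householder_mult_vec[OF w])
      using x w apply simp
      unfolding c2 using x w by (intro eq_vecI) auto
  qed
  have "col (householder n w * householder n w) j = householder n w *\<^sub>v col (householder n w) j"
    using j by (simp add: col_mult2[of _ n n _ n])
  also have "\<dots> = unit_vec n j" unfolding cj by (rule *) simp
  finally show "col (householder n w * householder n w) j = col (1\<^sub>m n) j" using j by simp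
qed (auto simp: householder_def)

text \<open>Reflect along \<open>w\<close>, the difference of the two unit vectors: equal lengths
  give \<open>2 * (w \<bullet> e) = w \<bullet> w\<close>, so exactly one copy of \<open>w\<close>
  is subtracted from \<open>e\<close>. If the vectors coincide, the identity serves.\<close>

lemma exists_reflection_to:
  fixes u :: "real vec"
  assumes u: "u \<in> carrier_vec (Suc n)" "u \<bullet> u = 1"
  obtains H where "H \<in> carrier_mat (Suc n) (Suc n)" "H\<^sup>T = H" "H * H = 1\<^sub>m (Suc n)"
    "H *\<^sub>v unit_vec (Suc n) 0 = u"
proof -
  let ?e = "unit_vec (Suc n) 0 :: real vec"
  let ?w = "?e - u"
  have w: "?w \<in> carrier_vec (Suc n)" using u by simp
  have e: "?e \<in> carrier_vec (Suc n)" by simp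
  have we: "?w \<bullet> ?e = 1 - u \<bullet> ?e"
    using u by (simp add: minus_scalar_prod_distrib[OF e u(1) e])
  have wu: "?w \<bullet> u = u \<bullet> ?e - 1"
    using u by (simp add: minus_scalar_prod_distrib[OF e u(1) u(1)] comm_scalar_prod[OF e u(1)])
  have ww: "?w \<bullet> ?w = 2 * (1 - u \<bullet> ?e)"
    using we wu by (simp add: scalar_prod_minus_distrib[OF w e u(1)])
  show thesis
  proof (cases "?w \<bullet> ?w = 0")
    case True
    then have "(\<Sum>i = 0..<Suc n. ?w $ i * ?w $ i) = 0"
      using w u by (simp add: scalar_prod_def del: sum.op_ivl_Suc)
    then have "\<forall>i<Suc n. ?w $ i = 0"
      by (subst (asm) sum_nonneg_eq_0_iff) auto
    then have "u = ?e"
      using u by (intro eq_vecI) (auto simp del: index_unit_vec(1))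
    then show thesis by (intro that[of "1\<^sub>m (Suc n)"]) auto
  next
    case False
    have "2 * (?w \<bullet> ?e) / (?w \<bullet> ?w) = 1"
      using False unfolding ww we by simp
    then have "householder (Suc n) ?w *\<^sub>v ?e = u"
      unfolding householder_mult_vec[OF w e] using u by (intro eq_vecI) auto
    then show thesis
      using householder_transpose householder_involution[OF w] by (intro that[of "householder (Suc n) ?w"]) auto
  qed
qed

text \<open>Deflation: a reflection \<open>H\<close> carries the first basis vector to a unit
  eigenvector, so the first column of \<open>H * A * H\<close> is a multiple of that basis vector.
  Symmetry clears the first row as well, and the induction hypothesis diagonalises the remaining
  block.\<close>

lemma spectral_theorem_symmetric:
  fixes A :: "real mat"
  assumes "A \<in> carrier_mat n n" "A\<^sup>T = A"
  shows "\<exists>U D. U \<in> carrier_mat n n \<and> D \<in> carrier_mat n n \<and> diagonal_mat D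
    \<and> U\<^sup>T * U = 1\<^sub>m n \<and> U * U\<^sup>T = 1\<^sub>m n \<and> A = U * D * U\<^sup>T"
  using assms
proof (induction n arbitrary: A)
  case 0
  then show ?case by (intro exI[of _ A] exI[of _ A]) (auto simp: diagonal_mat_def)
next
  case (Suc n)
  let ?m = "Suc n"
  note A = Suc.prems(1)
  obtain v e where v: "v \<in> carrier_vec ?m" "v \<noteq> 0\<^sub>v ?m" "A *\<^sub>v v = e \<cdot>\<^sub>v v"
    using symmetric_mat_real_eigenvector[OF Suc.prems] .
  have vv: "v \<bullet> v > 0"
  proof -
    have "v \<bullet> v = (\<Sum>i = 0..<?m. v $ i * v $ i)"
      using v(1) by (simp add: scalar_prod_def del: sum.op_ivl_Suc)
    moreover have "(\<Sum>i = 0..<?m. v $ i * v $ i) \<noteq> 0"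
    proof
      assume "(\<Sum>i = 0..<?m. v $ i * v $ i) = 0"
      then have "\<forall>i<?m. v $ i = 0"
        by (subst (asm) sum_nonneg_eq_0_iff) auto
      then show False using v(1,2) by (auto intro!: eq_vecI)
    qed
    moreover have "(\<Sum>i = 0..<?m. v $ i * v $ i) \<ge> 0" by (intro sum_nonneg) auto
    ultimately show ?thesis by linarith
  qed
  define u where "u = (1 / sqrt (v \<bullet> v)) \<cdot>\<^sub>v v"
  have u: "u \<in> carrier_vec ?m" using v by (simp add: u_def)
  have uu: "u \<bullet> u = 1"
    unfolding u_def using v(1) vv
    by (simp add: scalar_prod_smult_right smult_scalar_prod_distrib[of _ ?m] real_sqrt_mult_self power2_eq_square[symmetric])
  have Au: "A *\<^sub>v u = e \<cdot>\<^sub>v u"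
    unfolding u_def mult_mat_vec[OF A v(1)] v(3) by (simp add: smult_smult_assoc mult.commute)
  obtain H where H: "H \<in> carrier_mat ?m ?m" "H\<^sup>T = H" "H * H = 1\<^sub>m ?m"
    and Hu: "H *\<^sub>v unit_vec ?m 0 = u"
    using exists_reflection_to[OF u uu] .
  define B where "B = H * A * H"
  have B: "B \<in> carrier_mat ?m ?m" using A H unfolding B_def by simp
  have BT: "B\<^sup>T = B"
    unfolding B_def using H A Suc.prems(2)
    by (simp add: transpose_mult[of _ ?m ?m _ ?m] assoc_mult_mat[of _ ?m ?m _ ?m _ ?m])
  have Heu: "H *\<^sub>v u = unit_vec ?m 0"
    unfolding Hu[symmetric] using H
    by (metis assoc_mult_mat_vec one_mult_mat_vec unit_vec_carrier)
  have "B *\<^sub>v unit_vec ?m 0 = H *\<^sub>v (A *\<^sub>v (H *\<^sub>v unit_vec ?m 0))"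
    unfolding B_def using H A
    by (simp add: assoc_mult_mat_vec[of _ ?m ?m _ ?m])
  also have "\<dots> = e \<cdot>\<^sub>v unit_vec ?m 0"
    unfolding Hu Au using H u by (simp add: mult_mat_vec[of _ ?m ?m] Heu)
  finally have Be: "B *\<^sub>v unit_vec ?m 0 = e \<cdot>\<^sub>v unit_vec ?m 0" .
  have Bi0: "B $$ (i, 0) = (if i = 0 then e else 0)" if "i < ?m" for i
    using arg_cong[OF Be, of "\<lambda>x. x $ i"] that B by simp
  have B0i: "B $$ (0, i) = (if i = 0 then e else 0)" if "i < ?m" for i
    using Bi0[OF that] arg_cong[OF BT, of "\<lambda>M. M $$ (i, 0)"] that B by simp
  define A3 where "A3 = mat n n (\<lambda>(i, j). B $$ (Suc i, Suc j))"
  have A3: "A3 \<in> carrier_mat n n" by (simp add: A3_def)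
  have A3T: "A3\<^sup>T = A3"
  proof (rule eq_matI)
    fix i j assume "i < dim_row A3" "j < dim_col A3"
    then show "A3\<^sup>T $$ (i, j) = A3 $$ (i, j)"
      using arg_cong[OF BT, of "\<lambda>M. M $$ (Suc i, Suc j)"] B by (simp add: A3_def)
  qed (simp_all add: A3_def)
  let ?E = "mat 1 1 (\<lambda>_. e)"
  have Bb: "B = four_block_mat ?E (0\<^sub>m 1 n) (0\<^sub>m n 1) A3"
    using B Bi0 B0i by (intro eq_matI) (auto simp: A3_def)
  obtain U3 D3 where U3: "U3 \<in> carrier_mat n n" and D3: "D3 \<in> carrier_mat n n" "diagonal_mat D3"
    and UU3: "U3\<^sup>T * U3 = 1\<^sub>m n" "U3 * U3\<^sup>T = 1\<^sub>m n" and A3e: "A3 = U3 * D3 * U3\<^sup>T"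
    using Suc.IH[OF A3 A3T] by blast
  define V where "V = four_block_mat (1\<^sub>m 1) (0\<^sub>m 1 n) (0\<^sub>m n 1) U3"
  define D where "D = four_block_mat ?E (0\<^sub>m 1 n) (0\<^sub>m n 1) D3"
  have V: "V \<in> carrier_mat ?m ?m" unfolding V_def using U3 by (metis four_block_carrier_mat one_carrier_mat plus_1_eq_Suc)
  have D: "D \<in> carrier_mat ?m ?m" unfolding D_def using D3 by (metis four_block_carrier_mat mat_carrier plus_1_eq_Suc)
  have VT: "V\<^sup>T = four_block_mat (1\<^sub>m 1) (0\<^sub>m 1 n) (0\<^sub>m n 1) (U3\<^sup>T)"
    unfolding V_def using U3 by (simp add: transpose_four_block_mat[of _ 1 1 _ n _ n])
  have dD: "diagonal_mat D"
    unfolding diagonal_mat_def D_def using D3 by (auto simp: diagonal_mat_def)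
  have VV: "V\<^sup>T * V = 1\<^sub>m ?m" "V * V\<^sup>T = 1\<^sub>m ?m"
    unfolding VT unfolding V_def using U3 UU3
    by (simp_all add: mult_four_block_mat[of _ 1 1 _ n _ n _ _ 1 _ n])
  have BD: "B = V * D * V\<^sup>T"
    unfolding VT unfolding Bb A3e V_def D_def using U3 D3
    by (simp add: mult_four_block_mat[of _ 1 1 _ n _ n _ _ 1 _ n])
  have "A = H * B * H"
  proof -
    have "H * (H * A) = A"
      using H A by (simp add: assoc_mult_mat[of H ?m ?m H ?m A ?m, symmetric])
    then show ?thesis
      unfolding B_def using H A by (simp add: assoc_mult_mat[of _ ?m ?m _ ?m _ ?m])
  qed
  also have "\<dots> = (H * V) * D * (H * V)\<^sup>T"
    unfolding BD using H V D
    by (simp add: transpose_mult[of _ ?m ?m _ ?m] assoc_mult_mat[of _ ?m ?m _ ?m _ ?m])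
  finally have e1: "A = (H * V) * D * (H * V)\<^sup>T" .
  have e2: "(H * V)\<^sup>T * (H * V) = 1\<^sub>m ?m"
  proof -
    have "H * (H * V) = V"
      using H V by (simp add: assoc_mult_mat[of H ?m ?m H ?m V ?m, symmetric])
    then have "(H * V)\<^sup>T * (H * V) = V\<^sup>T * V"
      using H V by (simp add: transpose_mult[of _ ?m ?m _ ?m] assoc_mult_mat[of _ ?m ?m _ ?m _ ?m])
    then show ?thesis using VV by simp
  qed
  have e3: "(H * V) * (H * V)\<^sup>T = 1\<^sub>m ?m"
  proof -
    have "V * (V\<^sup>T * H) = H"
      using H V VV by (simp add: assoc_mult_mat[of V ?m ?m "V\<^sup>T" ?m H ?m, symmetric])
    then show ?thesis
      using H V by (simp add: transpose_mult[of _ ?m ?m _ ?m] assoc_mult_mat[of _ ?m ?m _ ?m _ ?m])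
  qed
  show ?case
    using e1 e2 e3 H V D dD by (intro exI[of _ "H * V"] exI[of _ D]) simp
qed

lemma proots_prod_linear: "proots (\<Prod>a\<leftarrow>es. [:- a, 1:]) = mset (es :: real list)"
proof (induction es)
  case (Cons a es)
  have "(\<Prod>a\<leftarrow>es. [:- a, 1:]) \<noteq> (0 :: real poly)"
    by (auto simp: prod_list_zero_iff)
  then show ?case using Cons by (simp add: proots_mult del: mult_pCons_left)
qed simp

text \<open>The order of \<open>es\<close> is whatever the diagonalisation produces; only the
  multiset is tied to the characteristic polynomial. This suffices because the eigenvalues are later
  used only through symmetric sums.\<close>

lemma symmetric_mat_eigenbasis:
  fixes A :: "real mat"
  assumes A: "A \<in> carrier_mat n n" "A\<^sup>T = A"
  obtains u es where "length es = n" "proots (char_poly A) = mset es"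
    "\<And>v w. v < n \<Longrightarrow> w < n \<Longrightarrow> A $$ (v, w) = (\<Sum>i<n. u v i * u w i * es ! i)"
    "\<And>i j. i < n \<Longrightarrow> j < n \<Longrightarrow> (\<Sum>v<n. u v i * u v j) = (if i = j then 1 else 0)"
proof -
  obtain U D where U: "U \<in> carrier_mat n n" and D: "D \<in> carrier_mat n n" "diagonal_mat D"
    and UU: "U\<^sup>T * U = 1\<^sub>m n" "U * U\<^sup>T = 1\<^sub>m n" and AU: "A = U * D * U\<^sup>T"
    using spectral_theorem_symmetric[OF A] by blast
  have "similar_mat_wit A D U (U\<^sup>T)"
    using U D A UU AU by (intro similar_mat_witI) auto
  then have "char_poly A = char_poly D"
    by (intro char_poly_similar) (auto simp: similar_mat_def)
  also have "\<dots> = (\<Prod>a\<leftarrow>diag_mat D. [:- a, 1:])"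
    using D by (intro char_poly_upper_triangular[of _ n]) (auto simp: diagonal_mat_def)
  finally have cp: "proots (char_poly A) = mset (diag_mat D)"
    by (simp add: proots_prod_linear)
  have len: "length (diag_mat D) = n" using D by (simp add: diag_mat_def)
  have nth: "diag_mat D ! i = D $$ (i, i)" if "i < n" for i
    using that D by (simp add: diag_mat_def)
  have UD: "(U * D) $$ (v, i) = U $$ (v, i) * D $$ (i, i)" if "v < n" "i < n" for v i
  proof -
    have "(U * D) $$ (v, i) = (\<Sum>j = 0..<n. U $$ (v, j) * D $$ (j, i))"
      using that U D by (simp add: scalar_prod_def)
    also have "\<dots> = (\<Sum>j = 0..<n. if j = i then U $$ (v, i) * D $$ (i, i) else 0)"
      using that D by (intro sum.cong) (auto simp: diagonal_mat_def)
    finally show ?thesis using that by simp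
  qed
  show thesis
  proof (rule that[OF len cp, of "\<lambda>v i. U $$ (v, i)"])
    fix v w assume vw: "v < n" "w < n"
    have "(M * U\<^sup>T) $$ (v, w) = (\<Sum>i = 0..<n. M $$ (v, i) * U $$ (w, i))"
      if "M \<in> carrier_mat n n" for M
      using that vw U by (simp add: scalar_prod_def)
    from this[of "U * D"] have "A $$ (v, w) = (\<Sum>i = 0..<n. (U * D) $$ (v, i) * U $$ (w, i))"
      unfolding AU using U D by simp
    then show "A $$ (v, w) = (\<Sum>i<n. U $$ (v, i) * U $$ (w, i) * diag_mat D ! i)"
      using UD vw nth by (simp add: atLeast0LessThan mult_ac)
  next
    fix i j assume "i < n" "j < n"
    then show "(\<Sum>v<n. U $$ (v, i) * U $$ (v, j)) = (if i = j then 1 else 0)"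
      using arg_cong[OF UU(1), of "\<lambda>M. M $$ (i, j)"] U by (simp add: scalar_prod_def atLeast0LessThan)
  qed
qed

section \<open>Polynomials in bounded independent variables\<close>

lemma norm_diff_le_of_vector_derivative:
  fixes f :: "real \<Rightarrow> 'a::real_normed_vector"
  assumes "convex S" "\<And>t. t \<in> S \<Longrightarrow> (f has_vector_derivative f' t) (at t within S)"
    and "\<And>t. t \<in> S \<Longrightarrow> norm (f' t) \<le> K" "x \<in> S" "y \<in> S"
  shows "norm (f x - f y) \<le> K * \<bar>x - y\<bar>"
  unfolding real_norm_def[symmetric]
proof (rule differentiable_bound[OF assms(1) _ _ assms(4,5)])
  fix t assume t: "t \<in> S"
  show "(f has_derivative (\<lambda>h. h *\<^sub>R f' t)) (at t within S)"
    using assms(2)[OF t] by (simp add: has_vector_derivative_def)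
  show "onorm (\<lambda>h. h *\<^sub>R f' t) \<le> K"
    using assms(3)[OF t]
    by (intro onorm_bound) (auto intro: mult_left_mono order_trans[OF norm_ge_zero] simp: mult.commute[of K])
qed

text \<open>The mean value inequality on the convex set \<open>S\<close> makes \<open>f t x\<close>
  Lipschitz in \<open>t\<close> with constant \<open>K x\<close>, so \<open>2 * K x\<close>
  dominates the remainder quotients along every sequence. Derivatives within \<open>S\<close>
  include the one-sided ones at the ends of \<open>{0..1}\<close>.\<close>

lemma has_vector_derivative_integral_dominated:
  fixes f :: "real \<Rightarrow> 'a \<Rightarrow> complex"
  assumes der: "\<And>t x. t \<in> S \<Longrightarrow> ((\<lambda>t. f t x) has_vector_derivative f' t x) (at t within S)"
    and int: "\<And>t. t \<in> S \<Longrightarrow> integrable M (f t)"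
    and meas: "\<And>t. t \<in> S \<Longrightarrow> f' t \<in> borel_measurable M"
    and bound: "\<And>t x. t \<in> S \<Longrightarrow> norm (f' t x) \<le> K x" and K: "integrable M K"
    and S: "convex S" "s \<in> S"
  shows "((\<lambda>t. \<integral>x. f t x \<partial>M) has_vector_derivative (\<integral>x. f' s x \<partial>M)) (at s within S)"
proof -
  have int': "integrable M (f' s)"
    using meas[OF S(2)] bound[OF S(2)] by (intro Bochner_Integration.integrable_bound[OF K]) (auto intro: order_trans[OF _ abs_ge_self])
  have lip: "norm (f t x - f s x) \<le> K x * norm (t - s)" if "t \<in> S" for t x
    using norm_diff_le_of_vector_derivative[OF S(1) der bound that S(2)] by simp
  have "((\<lambda>t. ((\<integral>x. f t x \<partial>M) - (\<integral>x. f s x \<partial>M) - (t - s) *\<^sub>R (\<integral>x. f' s x \<partial>M)) /\<^sub>R norm (t - s))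
      \<longlongrightarrow> 0) (at s within S)"
    unfolding tendsto_at_iff_sequentially comp_def
  proof (intro allI impI)
    fix X :: "nat \<Rightarrow> real" assume X: "\<forall>i. X i \<in> S - {s}" "X \<longlonglongrightarrow> s"
    let ?d = "\<lambda>i x. (f (X i) x - f s x - (X i - s) *\<^sub>R f' s x) /\<^sub>R norm (X i - s)"
    have XS: "X i \<in> S" for i using X(1) by blast
    have lim: "(\<lambda>i. \<integral>x. ?d i x \<partial>M) \<longlonglongrightarrow> (\<integral>x. 0 \<partial>M)"
    proof (rule integral_dominated_convergence[where w = "\<lambda>x. 2 * K x"])
      show "AE x in M. (\<lambda>i. ?d i x) \<longlonglongrightarrow> 0"
      proof (rule AE_I2)
        fix x
        have "((\<lambda>t. (f t x - f s x - (t - s) *\<^sub>R f' s x) /\<^sub>R norm (t - s)) \<longlongrightarrow> 0) (at s within S)"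
          using der[OF S(2), of x] unfolding has_vector_derivative_def has_derivative_at_within
          by (rule conjunct2)
        then show "(\<lambda>i. ?d i x) \<longlonglongrightarrow> 0"
          using X unfolding tendsto_at_iff_sequentially comp_def by blast
      qed
      show "AE x in M. norm (?d i x) \<le> 2 * K x" for i
      proof (rule AE_I2)
        fix x
        have pos: "norm (X i - s) > 0" using X(1) by auto
        have "norm (f (X i) x - f s x - (X i - s) *\<^sub>R f' s x)
            \<le> norm (f (X i) x - f s x) + norm ((X i - s) *\<^sub>R f' s x)"
          by (rule norm_triangle_ineq4)
        also have "\<dots> \<le> K x * norm (X i - s) + norm (X i - s) * K x"
          using lip[OF XS] bound[OF S(2)] by (intro add_mono) (auto intro: mult_left_mono)
        finally show "norm (?d i x) \<le> 2 * K x"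
          using pos by (simp add: divide_simps mult_ac)
      qed
    qed (use int[OF XS] int[OF S(2)] int' K in auto)
    have eq: "(\<integral>x. ?d i x \<partial>M) = ((\<integral>x. f (X i) x \<partial>M) - (\<integral>x. f s x \<partial>M)
        - (X i - s) *\<^sub>R (\<integral>x. f' s x \<partial>M)) /\<^sub>R norm (X i - s)" for i
      using int[OF XS] int[OF S(2)] int' by simp
    show "(\<lambda>i. ((\<integral>x. f (X i) x \<partial>M) - (\<integral>x. f s x \<partial>M)
        - (X i - s) *\<^sub>R (\<integral>x. f' s x \<partial>M)) /\<^sub>R norm (X i - s)) \<longlonglongrightarrow> 0"
      using lim unfolding eq by simp
  qed
  then show ?thesis
    unfolding has_vector_derivative_def has_derivative_at_within
    by (simp add: bounded_linear_scaleR_left)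
qed

text \<open>The coordinates keep the original law \<open>\<mu>\<close>, and the truncation
  \<open>\<xi>\<close> is a function applied to them. Original and truncated variables thus live on
  one product space and can be compared in \<open>L\<^sup>2\<close>.\<close>

locale bounded_iid =
  fixes \<mu> :: "real measure" and \<xi> :: "real \<Rightarrow> real" and T :: real and I :: "'i set"
  assumes prob: "prob_space \<mu>" and sets_mu [measurable_cong]: "sets \<mu> = sets borel"
    and xi_meas [measurable]: "\<xi> \<in> borel_measurable borel"
    and xi_bound: "\<bar>\<xi> x\<bar> \<le> T" and T_ge_1: "1 \<le> T"
    and xi_mean: "(\<integral>x. \<xi> x \<partial>\<mu>) = 0" and xi_var: "(\<integral>x. (\<xi> x)\<^sup>2 \<partial>\<mu>) = 1"
    and fin: "finite I"
begin

sublocale mu: prob_space \<mu> by (rule prob)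
sublocale prod: product_prob_space "\<lambda>_::'i. \<mu>" I by unfold_locales

abbreviation "P \<equiv> Pi\<^sub>M I (\<lambda>_::'i. \<mu>)"

definition y :: "'i \<Rightarrow> ('i \<Rightarrow> real) \<Rightarrow> real" where "y i x = \<xi> (x i)"

text \<open>Boundedness is required everywhere and not just almost everywhere, so that \<^term>\<open>bm\<close> is closed
  under the algebraic operations by plain introduction rules and implies integrability.\<close>

definition bm :: "(('i \<Rightarrow> real) \<Rightarrow> 'b::{real_normed_field, banach, second_countable_topology}) \<Rightarrow> bool" where
  "bm f \<longleftrightarrow> f \<in> borel_measurable P \<and> (\<exists>b. \<forall>x. norm (f x) \<le> b)"

lemma bmI: "f \<in> borel_measurable P \<Longrightarrow> (\<And>x. norm (f x) \<le> b) \<Longrightarrow> bm f"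
  by (auto simp: bm_def)

lemma bm_measurable: "bm f \<Longrightarrow> f \<in> borel_measurable P" by (simp add: bm_def)

lemma bm_integrable: "bm f \<Longrightarrow> integrable P f"
  unfolding bm_def by (auto intro: prod.integrable_const_bound)

lemma bm_const [simp]: "bm (\<lambda>_. c)" by (auto simp: bm_def)

lemma bm_add: "bm f \<Longrightarrow> bm g \<Longrightarrow> bm (\<lambda>x. f x + g x)"
proof -
  assume "bm f" "bm g"
  then obtain b c where "f \<in> borel_measurable P" "g \<in> borel_measurable P"
    "\<And>x. norm (f x) \<le> b" "\<And>x. norm (g x) \<le> c"
    unfolding bm_def by blast
  then show ?thesis by (intro bmI[of _ "b + c"]) (auto intro!: norm_add_rule_thm)
qed

lemma bm_minus: "bm f \<Longrightarrow> bm (\<lambda>x. - f x)"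
  unfolding bm_def by auto

lemma bm_diff: "bm f \<Longrightarrow> bm g \<Longrightarrow> bm (\<lambda>x. f x - g x)"
  using bm_add[of f "\<lambda>x. - g x"] bm_minus[of g] by simp

lemma bm_mult: "bm f \<Longrightarrow> bm g \<Longrightarrow> bm (\<lambda>x. f x * g x)"
proof -
  assume "bm f" "bm g"
  then obtain b c where "f \<in> borel_measurable P" "g \<in> borel_measurable P"
    "\<And>x. norm (f x) \<le> b" "\<And>x. norm (g x) \<le> c"
    unfolding bm_def by blast
  then show ?thesis by (intro bmI[of _ "b * c"]) (auto simp: norm_mult intro!: mult_mono')
qed

lemma bm_power: "bm f \<Longrightarrow> bm (\<lambda>x. f x ^ n)"
  by (induction n) (auto intro: bm_const bm_mult)

lemma bm_sum: "(\<And>i. i \<in> S \<Longrightarrow> bm (f i)) \<Longrightarrow> bm (\<lambda>x. \<Sum>i\<in>S. f i x)"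
  by (induction S rule: infinite_finite_induct) (auto intro: bm_const bm_add)

lemma bm_of_real: "bm f \<Longrightarrow> bm (\<lambda>x. of_real (f x))"
  unfolding bm_def by auto

lemma bm_divide: "bm f \<Longrightarrow> bm (\<lambda>x. f x / c)"
  using bm_mult[of f "\<lambda>_. inverse c"] by (simp add: divide_inverse)

lemma bm_norm: "bm f \<Longrightarrow> bm (\<lambda>x. norm (f x))"
  unfolding bm_def by auto

lemma bm_abs: "bm f \<Longrightarrow> bm (\<lambda>x. \<bar>f x :: real\<bar>)"
  unfolding bm_def by auto

lemma bm_y: "i \<in> I \<Longrightarrow> bm (y i)"
  unfolding bm_def y_def using xi_bound by auto

lemmas bm_intros = bm_const bm_add bm_minus bm_diff bm_mult bm_power bm_sum bm_of_real bm_divide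
  bm_norm bm_abs bm_y

lemma y_upd: "y i (x(v := z)) = (if i = v then \<xi> z else y i x)"
  by (simp add: y_def)

lemma xi_abs_power: "\<bar>\<xi> x\<bar> ^ n \<le> T ^ n"
  using xi_bound by (intro power_mono) auto

text \<open>Fubini in the coordinate \<open>v\<close>. Independence of \<open>H\<close> from that
  coordinate is expressed as invariance under updates, which can be checked by rewriting;
  integrating \<open>H\<close> over \<open>I\<close> or over \<open>I - {v}\<close> agrees since
  \<open>\<mu>\<close> has mass one.\<close>

lemma integral_factor:
  fixes H :: "('i \<Rightarrow> real) \<Rightarrow> 'b::{real_normed_field, banach, second_countable_topology}"
  assumes v: "v \<in> I" and phi [measurable]: "\<phi> \<in> borel_measurable borel" and b: "\<And>z. \<bar>\<phi> z\<bar> \<le> b"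
    and H: "bm H" and inv: "\<And>x z. H (x(v := z)) = H x"
  shows "(\<integral>x. of_real (\<phi> (x v)) * H x \<partial>P) = of_real (\<integral>z. \<phi> z \<partial>\<mu>) * (\<integral>x. H x \<partial>P)"
proof -
  have I: "I = insert v (I - {v})" using v by auto
  have phi_int: "integrable \<mu> \<phi>"
    using b by (intro mu.integrable_const_bound[of _ b]) auto
  have "bm (\<lambda>x. of_real (\<phi> (x v)) :: 'b)"
    using v b by (intro bmI[of _ b]) auto
  then have i1: "integrable P (\<lambda>x. of_real (\<phi> (x v)) * H x)" using H by (intro bm_integrable bm_mult)
  note fold = prod.product_integral_insert[of "I - {v}" v, folded I]
  have "(\<integral>x. of_real (\<phi> (x v)) * H x \<partial>P)
      = (\<integral>x. (\<integral>z. \<phi> z *\<^sub>R H x \<partial>\<mu>) \<partial>Pi\<^sub>M (I - {v}) (\<lambda>_. \<mu>))"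
    using fold[OF _ _ i1] fin by (simp add: inv scaleR_conv_of_real)
  also have "\<dots> = (\<integral>x. of_real (\<integral>z. \<phi> z \<partial>\<mu>) * H x \<partial>Pi\<^sub>M (I - {v}) (\<lambda>_. \<mu>))"
    using phi_int by (simp add: scaleR_conv_of_real)
  also have "\<dots> = of_real (\<integral>z. \<phi> z \<partial>\<mu>) * (\<integral>x. H x \<partial>Pi\<^sub>M (I - {v}) (\<lambda>_. \<mu>))"
    by simp
  also have "(\<integral>x. H x \<partial>Pi\<^sub>M (I - {v}) (\<lambda>_. \<mu>)) = (\<integral>x. H x \<partial>P)"
    using fold[OF _ _ bm_integrable[OF H]] fin by (simp add: inv mu.prob_space)
  finally show ?thesis .
qed

lemma integral_y_times:
  fixes H :: "('i \<Rightarrow> real) \<Rightarrow> 'b::{real_normed_field, banach, second_countable_topology}"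
  assumes "v \<in> I" "bm H" "\<And>x z. H (x(v := z)) = H x"
  shows "(\<integral>x. of_real (y v x) * H x \<partial>P) = 0"
  using integral_factor[OF assms(1) xi_meas xi_bound assms(2,3)] by (simp add: y_def xi_mean)

lemma integral_y2_times:
  fixes H :: "('i \<Rightarrow> real) \<Rightarrow> 'b::{real_normed_field, banach, second_countable_topology}"
  assumes "v \<in> I" "bm H" "\<And>x z. H (x(v := z)) = H x"
  shows "(\<integral>x. of_real ((y v x)\<^sup>2) * H x \<partial>P) = (\<integral>x. H x \<partial>P)"
proof -
  have "\<bar>(\<xi> z)\<^sup>2\<bar> \<le> T\<^sup>2" for z using xi_abs_power[of z 2] by simp
  from integral_factor[where \<phi> = "\<lambda>z. (\<xi> z)\<^sup>2", OF assms(1) _ this assms(2,3)] show ?thesis by (simp add: y_def xi_var)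
qed

lemma integral_y2_minus_1_times:
  fixes H :: "('i \<Rightarrow> real) \<Rightarrow> 'b::{real_normed_field, banach, second_countable_topology}"
  assumes "v \<in> I" "bm H" "\<And>x z. H (x(v := z)) = H x"
  shows "(\<integral>x. of_real ((y v x)\<^sup>2 - 1) * H x \<partial>P) = 0"
proof -
  have "(\<integral>x. of_real ((y v x)\<^sup>2 - 1) * H x \<partial>P)
      = (\<integral>x. of_real ((y v x)\<^sup>2) * H x - H x \<partial>P)"
    by (simp add: algebra_simps)
  also have "\<dots> = (\<integral>x. of_real ((y v x)\<^sup>2) * H x \<partial>P) - (\<integral>x. H x \<partial>P)"
    using assms(1,2) by (intro Bochner_Integration.integral_diff bm_integrable bm_intros)
  finally show ?thesis using integral_y2_times[OF assms] by simp
qed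

section \<open>Orthonormal families and moments of linear forms\<close>

lemma integral_sum_sq_orthonormal:
  assumes "finite S" and Z: "\<And>e. e \<in> S \<Longrightarrow> bm (Z e)"
    and orth: "\<And>e e'. e \<in> S \<Longrightarrow> e' \<in> S \<Longrightarrow> (\<integral>x. Z e x * Z e' x \<partial>P) = (if e = e' then 1 else 0)"
  shows "(\<integral>x. (\<Sum>e\<in>S. a e * Z e x :: real)\<^sup>2 \<partial>P) = (\<Sum>e\<in>S. (a e)\<^sup>2)"
proof -
  have "(\<integral>x. (\<Sum>e\<in>S. a e * Z e x)\<^sup>2 \<partial>P) = (\<integral>x. (\<Sum>e\<in>S. \<Sum>e'\<in>S. a e * a e' * (Z e x * Z e' x)) \<partial>P)"
    by (simp add: power2_eq_square sum_product mult_ac)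
  also have "\<dots> = (\<Sum>e\<in>S. \<Sum>e'\<in>S. \<integral>x. a e * a e' * (Z e x * Z e' x) \<partial>P)"
  proof -
    have i: "integrable P (\<lambda>x. a e * a e' * (Z e x * Z e' x))" if "e \<in> S" "e' \<in> S" for e e'
      using Z that by (intro bm_integrable bm_intros)
    show ?thesis using i by (simp add: Bochner_Integration.integral_sum)
  qed
  also have "\<dots> = (\<Sum>e\<in>S. \<Sum>e'\<in>S. if e = e' then (a e)\<^sup>2 else 0)"
    using orth by (intro sum.cong refl) (simp add: power2_eq_square)
  finally show ?thesis using assms(1) by simp
qed

lemma integral_cmod_sum_sq_orthonormal:
  assumes "finite S" and Z: "\<And>e. e \<in> S \<Longrightarrow> bm (Z e)"
    and orth: "\<And>e e'. e \<in> S \<Longrightarrow> e' \<in> S \<Longrightarrow> (\<integral>x. Z e x * Z e' x \<partial>P) = (if e = e' then 1 else 0)"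
  shows "(\<integral>x. (cmod (\<Sum>e\<in>S. g e * of_real (Z e x)))\<^sup>2 \<partial>P) = (\<Sum>e\<in>S. (cmod (g e))\<^sup>2)"
proof -
  have "(\<integral>x. (cmod (\<Sum>e\<in>S. g e * of_real (Z e x)))\<^sup>2 \<partial>P)
     = (\<integral>x. (\<Sum>e\<in>S. Re (g e) * Z e x)\<^sup>2 + (\<Sum>e\<in>S. Im (g e) * Z e x)\<^sup>2 \<partial>P)"
    by (simp add: cmod_power2)
  also have "\<dots> = (\<integral>x. (\<Sum>e\<in>S. Re (g e) * Z e x)\<^sup>2 \<partial>P) + (\<integral>x. (\<Sum>e\<in>S. Im (g e) * Z e x)\<^sup>2 \<partial>P)"
    using Z by (intro Bochner_Integration.integral_add bm_integrable bm_intros)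
  also have "\<dots> = (\<Sum>e\<in>S. (Re (g e))\<^sup>2) + (\<Sum>e\<in>S. (Im (g e))\<^sup>2)"
    using integral_sum_sq_orthonormal[of S Z "\<lambda>e. Re (g e)"]
      integral_sum_sq_orthonormal[of S Z "\<lambda>e. Im (g e)"] assms by simp
  finally show ?thesis
    by (simp add: cmod_power2 sum.distrib)
qed

lemma integral_y_y:
  assumes "u \<in> I" "v \<in> I"
  shows "(\<integral>x. y u x * y v x \<partial>P) = (if u = v then 1 else 0)"
proof (cases "u = v")
  case True
  then show ?thesis using integral_y2_times[of v "\<lambda>_. 1 :: real"] assms by (simp add: power2_eq_square prod.P.prob_space)
next
  case False
  then show ?thesis using integral_y_times[of u "y v"] assms by (auto simp: y_upd bm_y)
qed

text \<open>The distinctness hypotheses fit pairs from two disjoint index sets. For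
  \<open>s \<noteq> s'\<close> the variable \<open>y s\<close> then occurs exactly once and
  integrates to zero.\<close>

lemma integral_yy_yy:
  assumes I: "s \<in> I" "s' \<in> I" "w \<in> I" "w' \<in> I" and d: "s \<noteq> w" "s \<noteq> w'"
  shows "(\<integral>x. (y s x * y w x) * (y s' x * y w' x) \<partial>P) = (if s = s' \<and> w = w' then 1 else 0)"
proof (cases "s = s'")
  case True
  have "(\<integral>x. of_real ((y s x)\<^sup>2) * (y w x * y w' x) \<partial>P) = (\<integral>x. y w x * y w' x \<partial>P)"
    using I d by (intro integral_y2_times) (auto simp: y_upd intro!: bm_intros)
  then show ?thesis using True integral_y_y[OF I(3,4)] by (simp add: power2_eq_square mult_ac)
next
  case False
  have "(\<integral>x. of_real (y s x) * (y w x * (y s' x * y w' x)) \<partial>P) = 0"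
    using I d False by (intro integral_y_times) (auto simp: y_upd intro!: bm_intros)
  then show ?thesis using False by (simp add: mult_ac)
qed

lemma integral_linear_sq:
  assumes "S \<subseteq> I"
  shows "(\<integral>x. (\<Sum>i\<in>S. a i * y i x)\<^sup>2 \<partial>P) = (\<Sum>i\<in>S. (a i)\<^sup>2)"
  using assms finite_subset[OF assms fin] integral_y_y
  by (intro integral_sum_sq_orthonormal) (auto simp: subset_iff bm_y)

lemma integral_linear_cmod_sq:
  assumes "S \<subseteq> I"
  shows "(\<integral>x. (cmod (\<Sum>i\<in>S. g i * of_real (y i x)))\<^sup>2 \<partial>P) = (\<Sum>i\<in>S. (cmod (g i))\<^sup>2)"
  using assms finite_subset[OF assms fin] integral_y_y
  by (intro integral_cmod_sum_sq_orthonormal) (auto simp: subset_iff bm_y)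

text \<open>Induction over the variables. Of the binomial terms, \<open>y v\<close> times a cube
  vanishes because \<open>y v\<close> is centred, and the cube of \<open>y v\<close> because it
  multiplies the centred \<open>?L\<close>. The \<open>3\<close> is the Gaussian constant, and
  \<open>T\<^sup>2\<close> bounds the fourth moment of a single variable.\<close>

lemma integral_linear_fourth:
  assumes "S \<subseteq> I"
  shows "(\<integral>x. (\<Sum>i\<in>S. a i * y i x) ^ 4 \<partial>P) \<le> (3 + T\<^sup>2) * (\<Sum>i\<in>S. (a i)\<^sup>2)\<^sup>2"
  using finite_subset[OF assms fin] assms
proof (induction S)
  case empty
  then show ?case by simp
next
  case (insert v S)
  let ?L = "\<lambda>x. \<Sum>i\<in>S. a i * y i x"
  define A where "A = (\<Sum>i\<in>S. (a i)\<^sup>2)"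
  have v: "v \<in> I" "S \<subseteq> I" "v \<notin> S" using insert by auto
  have bL: "bm ?L" using v by (intro bm_intros) auto
  have inv: "?L (x(v := z)) = ?L x" for x z
    using v by (auto simp: y_upd intro!: sum.cong)
  have b: "bm (y v)" using v by (intro bm_intros)
  have L1: "(\<integral>x. ?L x \<partial>P) = 0"
  proof -
    have "(\<integral>x. y i x \<partial>P) = 0" if "i \<in> S" for i
      using integral_y_times[of i "\<lambda>_. 1 :: real"] that v by auto
    moreover have "integrable P (y i)" if "i \<in> S" for i
      using that v by (intro bm_integrable bm_y) auto
    ultimately show ?thesis by (simp add: Bochner_Integration.integral_sum)
  qed
  have t1: "(\<integral>x. y v x * ?L x ^ 3 \<partial>P) = 0"
    using integral_y_times[of v "\<lambda>x. ?L x ^ 3"] v bm_power[OF bL] inv by auto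
  have t2: "(\<integral>x. (y v x)\<^sup>2 * (?L x)\<^sup>2 \<partial>P) = A"
    using integral_y2_times[of v "\<lambda>x. (?L x)\<^sup>2"] v bm_power[OF bL] inv integral_linear_sq[OF v(2), of a] by (auto simp: A_def)
  have t3: "(\<integral>x. (y v x) ^ 3 * ?L x \<partial>P) = 0"
    using integral_factor[of v "\<lambda>z. (\<xi> z) ^ 3" "T ^ 3" ?L] v bL inv xi_abs_power[of _ 3] L1
    by (auto simp: y_def power_abs)
  have t4: "(\<integral>x. (y v x) ^ 4 \<partial>P) \<le> T\<^sup>2"
  proof -
    have "(y v x) ^ 4 \<le> T\<^sup>2 * (y v x)\<^sup>2" for x
      using mult_right_mono[OF xi_abs_power[of "x v" 2], of "(y v x)\<^sup>2"]
      by (simp add: y_def power2_eq_square power4_eq_xxxx mult_ac)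
    then have "(\<integral>x. (y v x) ^ 4 \<partial>P) \<le> (\<integral>x. T\<^sup>2 * (y v x)\<^sup>2 \<partial>P)"
      using v by (intro integral_mono bm_integrable bm_intros) auto
    also have "\<dots> = T\<^sup>2" using integral_y_y[of v v] v by (simp add: power2_eq_square)
    finally show ?thesis .
  qed
  have "(\<integral>x. (\<Sum>i\<in>insert v S. a i * y i x) ^ 4 \<partial>P)
      = (\<integral>x. ?L x ^ 4 + (4 * a v) * (y v x * ?L x ^ 3) + (6 * (a v)\<^sup>2) * ((y v x)\<^sup>2 * (?L x)\<^sup>2)
          + (4 * (a v) ^ 3) * ((y v x) ^ 3 * ?L x) + (a v) ^ 4 * (y v x) ^ 4 \<partial>P)"
    using insert by (simp add: power4_eq_xxxx power3_eq_cube power2_eq_square algebra_simps)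
  also have "\<dots> = (\<integral>x. ?L x ^ 4 \<partial>P) + (4 * a v) * (\<integral>x. y v x * ?L x ^ 3 \<partial>P)
          + (6 * (a v)\<^sup>2) * (\<integral>x. (y v x)\<^sup>2 * (?L x)\<^sup>2 \<partial>P)
          + (4 * (a v) ^ 3) * (\<integral>x. (y v x) ^ 3 * ?L x \<partial>P) + (a v) ^ 4 * (\<integral>x. (y v x) ^ 4 \<partial>P)"
  proof -
    have *: "bm (\<lambda>x. ?L x ^ 4)" "bm (\<lambda>x. y v x * ?L x ^ 3)" "bm (\<lambda>x. (y v x)\<^sup>2 * (?L x)\<^sup>2)"
      "bm (\<lambda>x. (y v x) ^ 3 * ?L x)" "bm (\<lambda>x. (y v x) ^ 4)"
      using v by (auto intro!: bm_intros)
    note i = this[THEN bm_integrable]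
    show ?thesis using i by simp
  qed
  also have "\<dots> \<le> (3 + T\<^sup>2) * A\<^sup>2 + 6 * (a v)\<^sup>2 * A + (a v) ^ 4 * T\<^sup>2"
    unfolding t1 t2 t3 using insert.IH v(2) t4 by (auto simp: A_def intro!: add_mono mult_left_mono)
  also have "\<dots> \<le> (3 + T\<^sup>2) * (A + (a v)\<^sup>2)\<^sup>2"
  proof -
    have "0 \<le> A" unfolding A_def by (intro sum_nonneg) auto
    then have "0 \<le> 2 * T\<^sup>2 * (A * (a v)\<^sup>2) + 3 * (a v)^4" by auto
    then show ?thesis by (simp add: power2_eq_square power4_eq_xxxx algebra_simps)
  qed
  finally show ?case using insert by (simp add: A_def add.commute)
qed

end

section \<open>The resolvent in an eigenbasis\<close>

locale eigen_data =
  fixes V :: "'i set" and N :: "'k set" and B :: "'i \<Rightarrow> 'i \<Rightarrow> real"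
    and u :: "'i \<Rightarrow> 'k \<Rightarrow> real" and \<beta> :: "'k \<Rightarrow> real"
  assumes finV: "finite V" and finN: "finite N"
    and B_eigen: "\<And>v w. v \<in> V \<Longrightarrow> w \<in> V \<Longrightarrow> B v w = (\<Sum>i\<in>N. u v i * u w i * \<beta> i)"
    and col_orth: "\<And>i j. i \<in> N \<Longrightarrow> j \<in> N \<Longrightarrow> (\<Sum>v\<in>V. u v i * u v j) = (if i = j then 1 else 0)"
    and B_diag: "\<And>v. v \<in> V \<Longrightarrow> B v v = 0"
begin

lemma B_sym: "v \<in> V \<Longrightarrow> w \<in> V \<Longrightarrow> B v w = B w v"
  by (simp add: B_eigen mult_ac)

definition \<kappa> :: "real \<Rightarrow> 'k \<Rightarrow> complex" where
  "\<kappa> s i = of_real (\<beta> i) / (1 - \<i> * of_real (s * \<beta> i))"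

text \<open>\<^term>\<open>Res s\<close> is the matrix \<open>B (I - i s B)\<^sup>-\<^sup>1\<close>.\<close>

definition Res :: "real \<Rightarrow> 'i \<Rightarrow> 'i \<Rightarrow> complex" where
  "Res s v w = (\<Sum>i\<in>N. of_real (u v i * u w i) * \<kappa> s i)"

lemma one_minus_i_nz [simp]: "1 - \<i> * of_real r \<noteq> 0"
proof
  assume "1 - \<i> * of_real r = 0"
  then have "Re (1 - \<i> * of_real r) = 0" by simp
  then show False by simp
qed

lemma norm_one_minus_i: "1 \<le> cmod (1 - \<i> * of_real r)"
  using abs_Re_le_cmod[of "1 - \<i> * of_real r"] by simp

lemma norm_\<kappa>: "cmod (\<kappa> s i) \<le> \<bar>\<beta> i\<bar>"
  using norm_one_minus_i[of "s * \<beta> i"] unfolding \<kappa>_def norm_divide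
  by (simp add: divide_le_eq mult_left_le_one_le mult_le_cancel_left1 order_trans)

lemma \<kappa>_eq: "\<kappa> s i - \<i> * of_real s * (\<kappa> s i * of_real (\<beta> i)) = of_real (\<beta> i)"
proof -
  have "\<kappa> s i - \<i> * of_real s * (\<kappa> s i * of_real (\<beta> i)) = \<kappa> s i * (1 - \<i> * of_real (s * \<beta> i))"
    by (simp add: algebra_simps)
  then show ?thesis using one_minus_i_nz[of "s * \<beta> i"] unfolding \<kappa>_def by simp
qed

lemma parseval:
  fixes z :: "'k \<Rightarrow> complex"
  shows "(\<Sum>w\<in>V. (cmod (\<Sum>i\<in>N. of_real (u w i) * z i))\<^sup>2) = (\<Sum>i\<in>N. (cmod (z i))\<^sup>2)"
proof -
  have "of_real (\<Sum>w\<in>V. (cmod (\<Sum>i\<in>N. of_real (u w i) * z i))\<^sup>2)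
      = (\<Sum>w\<in>V. \<Sum>i\<in>N. \<Sum>j\<in>N. of_real (u w i * u w j) * (z i * cnj (z j)))"
    unfolding of_real_sum complex_norm_square cnj_sum sum_product by (simp add: mult_ac)
  also have "\<dots> = (\<Sum>i\<in>N. \<Sum>j\<in>N. \<Sum>w\<in>V. of_real (u w i * u w j) * (z i * cnj (z j)))"
    by (subst sum.swap) (intro sum.cong refl sum.swap)
  also have "\<dots> = (\<Sum>i\<in>N. \<Sum>j\<in>N. of_real (if i = j then 1 else 0) * (z i * cnj (z j)))"
    using col_orth by (intro sum.cong refl) (simp add: sum_distrib_right[symmetric] of_real_sum[symmetric] del: of_real_sum of_real_mult)
  also have "\<dots> = (\<Sum>i\<in>N. \<Sum>j\<in>N. if i = j then z i * cnj (z i) else 0)"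
    by (intro sum.cong refl) auto
  also have "\<dots> = of_real (\<Sum>i\<in>N. (cmod (z i))\<^sup>2)"
    unfolding of_real_sum complex_norm_square using finN by simp
  finally show ?thesis using of_real_eq_iff by blast
qed

lemma parseval_real: "(\<Sum>w\<in>V. (\<Sum>i\<in>N. u w i * z i)\<^sup>2) = (\<Sum>i\<in>N. (z i)\<^sup>2)"
  using parseval[of "\<lambda>i. of_real (z i)"] by (simp add: of_real_sum[symmetric] of_real_mult[symmetric] del: of_real_sum of_real_mult)

text \<open>Orthonormality of the eigenvectors reduces this to the scalar identity
  \<open>\<kappa>_eq\<close>. In matrix form it is \<open>P - i s P B = B\<close> for the matrix
  \<open>P\<close> with entries \<open>Res s\<close>.\<close>

lemma Res_resolvent:
  assumes "a \<in> V" "w \<in> V"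
  shows "Res s w a - \<i> * of_real s * (\<Sum>v\<in>V. Res s v a * of_real (B v w)) = of_real (B a w)"
proof -
  have "(\<Sum>v\<in>V. Res s v a * of_real (B v w))
     = (\<Sum>v\<in>V. \<Sum>i\<in>N. \<Sum>j\<in>N. of_real (u v i * u v j) * (of_real (u a i) * \<kappa> s i * of_real (u w j * \<beta> j)))"
    unfolding Res_def using assms
    by (intro sum.cong refl) (simp only: B_eigen of_real_sum sum_product, simp add: mult_ac)
  also have "\<dots> = (\<Sum>i\<in>N. \<Sum>j\<in>N. \<Sum>v\<in>V. of_real (u v i * u v j) * (of_real (u a i) * \<kappa> s i * of_real (u w j * \<beta> j)))"
    by (subst sum.swap) (intro sum.cong refl sum.swap)
  also have "\<dots> = (\<Sum>i\<in>N. \<Sum>j\<in>N. of_real (if i = j then 1 else 0) * (of_real (u a i) * \<kappa> s i * of_real (u w j * \<beta> j)))"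
    using col_orth by (intro sum.cong refl) (simp add: sum_distrib_right[symmetric] of_real_sum[symmetric] del: of_real_sum of_real_mult)
  also have "\<dots> = (\<Sum>i\<in>N. \<Sum>j\<in>N. if i = j then of_real (u a i) * \<kappa> s i * of_real (u w i * \<beta> i) else 0)"
    by (intro sum.cong refl) auto
  also have "\<dots> = (\<Sum>i\<in>N. of_real (u a i * u w i) * (\<kappa> s i * of_real (\<beta> i)))"
    using finN by (simp add: mult_ac)
  finally have e: "(\<Sum>v\<in>V. Res s v a * of_real (B v w)) = (\<Sum>i\<in>N. of_real (u a i * u w i) * (\<kappa> s i * of_real (\<beta> i)))" .
  have "Res s w a - \<i> * of_real s * (\<Sum>v\<in>V. Res s v a * of_real (B v w))
     = (\<Sum>i\<in>N. of_real (u a i * u w i) * (\<kappa> s i - \<i> * of_real s * (\<kappa> s i * of_real (\<beta> i))))"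
    unfolding e unfolding Res_def sum_distrib_left sum_subtractf[symmetric]
    by (intro sum.cong refl) (simp add: algebra_simps)
  then show ?thesis unfolding \<kappa>_eq using assms by (simp add: B_eigen mult_ac)
qed

text \<open>\<open>(I - i s B)\<^sup>-\<^sup>1\<close> is a contraction, because its eigenvalues
  have modulus at most one. The row vector \<open>a\<close> will be a unit vector, to bound single
  rows, or a row of the matrix coupling head and tail.\<close>

lemma Res_row_bound:
  fixes a :: "'i \<Rightarrow> real"
  shows "(\<Sum>w\<in>V. (cmod (\<Sum>v\<in>V. of_real (a v) * Res s v w))\<^sup>2) \<le> (\<Sum>w\<in>V. (\<Sum>v\<in>V. a v * B v w)\<^sup>2)"
proof -
  define c where "c i = (\<Sum>v\<in>V. a v * u v i)" for i
  have "(\<Sum>v\<in>V. of_real (a v) * Res s v w) = (\<Sum>i\<in>N. of_real (u w i) * (of_real (c i) * \<kappa> s i))" for w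
    unfolding Res_def c_def of_real_sum sum_distrib_left sum_distrib_right
    by (subst sum.swap) (simp add: mult_ac)
  then have "(\<Sum>w\<in>V. (cmod (\<Sum>v\<in>V. of_real (a v) * Res s v w))\<^sup>2) = (\<Sum>i\<in>N. (cmod (of_real (c i) * \<kappa> s i))\<^sup>2)"
    by (simp add: parseval)
  also have "\<dots> \<le> (\<Sum>i\<in>N. (c i * \<beta> i)\<^sup>2)"
  proof (intro sum_mono)
    fix i
    have "cmod (of_real (c i) * \<kappa> s i) \<le> \<bar>c i * \<beta> i\<bar>"
      by (simp add: norm_mult abs_mult norm_\<kappa> mult_left_mono)
    then show "(cmod (of_real (c i) * \<kappa> s i))\<^sup>2 \<le> (c i * \<beta> i)\<^sup>2"
      by (metis abs_le_square_iff abs_norm_cancel)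
  qed
  also have "\<dots> = (\<Sum>w\<in>V. (\<Sum>i\<in>N. u w i * (c i * \<beta> i))\<^sup>2)" by (simp add: parseval_real)
  also have "\<dots> = (\<Sum>w\<in>V. (\<Sum>v\<in>V. a v * B v w)\<^sup>2)"
  proof (intro sum.cong refl)
    fix w assume "w \<in> V"
    then have "(\<Sum>v\<in>V. a v * B v w) = (\<Sum>v\<in>V. \<Sum>i\<in>N. a v * (u v i * u w i * \<beta> i))"
      by (simp add: B_eigen sum_distrib_left)
    also have "\<dots> = (\<Sum>i\<in>N. u w i * (c i * \<beta> i))"
      unfolding c_def sum_distrib_left sum_distrib_right by (subst sum.swap) (simp add: mult_ac)
    finally show "(\<Sum>i\<in>N. u w i * (c i * \<beta> i))\<^sup>2 = (\<Sum>v\<in>V. a v * B v w)\<^sup>2" by simp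
  qed
  finally show ?thesis .
qed

lemma Res_row_norm:
  assumes "v \<in> V"
  shows "(\<Sum>w\<in>V. (cmod (Res s v w))\<^sup>2) \<le> (\<Sum>w\<in>V. (B v w)\<^sup>2)"
  using Res_row_bound[of "\<lambda>x. if x = v then 1 else 0" s] assms finV
  by (simp add: if_distrib[of of_real] if_distrib[of "\<lambda>x. x * _"] cong: if_cong)

lemma B_row_norm:
  assumes v: "v \<in> V"
  shows "(\<Sum>w\<in>V. (B v w)\<^sup>2) = (\<Sum>i\<in>N. (u v i * \<beta> i)\<^sup>2)"
proof -
  have "(\<Sum>w\<in>V. (B v w)\<^sup>2) = (\<Sum>w\<in>V. (\<Sum>i\<in>N. u w i * (u v i * \<beta> i))\<^sup>2)"
    using v by (intro sum.cong refl) (simp add: B_eigen mult_ac)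
  then show ?thesis by (simp add: parseval_real)
qed

lemma B_norm: "(\<Sum>v\<in>V. \<Sum>w\<in>V. (B v w)\<^sup>2) = (\<Sum>i\<in>N. (\<beta> i)\<^sup>2)"
proof -
  have "(\<Sum>v\<in>V. \<Sum>w\<in>V. (B v w)\<^sup>2) = (\<Sum>v\<in>V. \<Sum>i\<in>N. (u v i * \<beta> i)\<^sup>2)"
    by (simp add: B_row_norm)
  also have "\<dots> = (\<Sum>i\<in>N. \<Sum>v\<in>V. (u v i * u v i) * (\<beta> i)\<^sup>2)"
    by (subst sum.swap) (simp add: power2_eq_square mult_ac)
  also have "\<dots> = (\<Sum>i\<in>N. (\<beta> i)\<^sup>2)"
    using col_orth by (intro sum.cong refl) (simp add: sum_distrib_right[symmetric])
  finally show ?thesis .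
qed

text \<open>The first-order part of the diagonal entry is \<open>B v v = 0\<close>, so the entry is
  of second order in \<open>B\<close>: this turns a bound by a row norm into one by its square,
  which is summable over the vertices.\<close>

lemma Res_diag:
  assumes v: "v \<in> V" and s: "\<bar>s\<bar> \<le> 1"
  shows "cmod (Res s v v) \<le> (\<Sum>w\<in>V. (B v w)\<^sup>2)"
proof -
  have "(\<Sum>i\<in>N. of_real (u v i * u v i) * of_real (\<beta> i)) = (0 :: complex)"
    using B_diag[OF v] v unfolding B_eigen[OF v v] of_real_mult[symmetric] of_real_sum[symmetric] by simp
  then have "Res s v v = (\<Sum>i\<in>N. of_real (u v i * u v i) * (\<kappa> s i - of_real (\<beta> i)))"
    unfolding Res_def by (simp add: right_diff_distrib sum_subtractf)
  also have "cmod \<dots> \<le> (\<Sum>i\<in>N. (u v i * \<beta> i)\<^sup>2)"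
  proof (rule sum_norm_le)
    fix i
    have e: "\<kappa> s i - of_real (\<beta> i) = \<i> * of_real s * (\<kappa> s i * of_real (\<beta> i))"
      using \<kappa>_eq[of s i] by (simp add: algebra_simps)
    have "cmod (\<kappa> s i - of_real (\<beta> i)) = \<bar>s\<bar> * (cmod (\<kappa> s i) * \<bar>\<beta> i\<bar>)"
      unfolding e by (simp add: norm_mult)
    also have "\<dots> \<le> 1 * (\<bar>\<beta> i\<bar> * \<bar>\<beta> i\<bar>)"
      using s norm_\<kappa>[of s i] by (intro mult_mono) auto
    finally have "cmod (\<kappa> s i - of_real (\<beta> i)) \<le> (\<beta> i)\<^sup>2" by (simp add: power2_eq_square)
    from mult_left_mono[OF this, of "(u v i)\<^sup>2"]
    show "cmod (of_real (u v i * u v i) * (\<kappa> s i - of_real (\<beta> i))) \<le> (u v i * \<beta> i)\<^sup>2"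
      unfolding norm_mult norm_of_real by (simp add: power2_eq_square mult_ac)
  qed
  finally show ?thesis using B_row_norm[OF v] by simp
qed

lemma Res_trace: "(\<Sum>v\<in>V. Res s v v) = (\<Sum>i\<in>N. \<kappa> s i)"
proof -
  have "(\<Sum>v\<in>V. Res s v v) = (\<Sum>i\<in>N. \<Sum>v\<in>V. of_real (u v i * u v i) * \<kappa> s i)"
    unfolding Res_def by (rule sum.swap)
  also have "\<dots> = (\<Sum>i\<in>N. \<kappa> s i)"
    using col_orth by (intro sum.cong refl) (simp add: sum_distrib_right[symmetric] of_real_sum[symmetric] del: of_real_sum of_real_mult)
  finally show ?thesis .
qed

lemma sum_eigenvalues: "(\<Sum>i\<in>N. \<beta> i) = 0"
proof -
  have "0 = (\<Sum>v\<in>V. \<Sum>i\<in>N. u v i * u v i * \<beta> i)"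
    using B_diag by (simp add: B_eigen)
  also have "\<dots> = (\<Sum>i\<in>N. \<Sum>v\<in>V. u v i * u v i * \<beta> i)" by (rule sum.swap)
  also have "\<dots> = (\<Sum>i\<in>N. \<beta> i)"
    using col_orth by (intro sum.cong refl) (simp add: sum_distrib_right[symmetric])
  finally show ?thesis by simp
qed

text \<open>From \<open>B = P (I - i s B)\<close> the quadratic form of \<open>B\<close> becomes the
  pairing of \<open>P Y\<close> with \<open>Y - i s B Y\<close>. The second factor is, up to the
  linear part of the form, the combination that Stein's identity annihilates.\<close>

lemma Res_form:
  fixes Y :: "'i \<Rightarrow> real" and s :: real
  defines "BY \<equiv> \<lambda>v. \<Sum>w\<in>V. B v w * Y w" and "PY \<equiv> \<lambda>v. \<Sum>w\<in>V. Res s v w * of_real (Y w)"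
  shows "of_real (\<Sum>v\<in>V. Y v * BY v) = (\<Sum>v\<in>V. PY v * (of_real (Y v) - \<i> * of_real s * of_real (BY v)))"
proof -
  have "(\<Sum>v\<in>V. PY v * of_real (BY v))
      = (\<Sum>v\<in>V. \<Sum>a\<in>V. \<Sum>w\<in>V. of_real (Y a * Y w) * (Res s v a * of_real (B v w)))"
    unfolding PY_def BY_def of_real_sum sum_product by (simp add: mult_ac)
  also have "\<dots> = (\<Sum>a\<in>V. \<Sum>w\<in>V. \<Sum>v\<in>V. of_real (Y a * Y w) * (Res s v a * of_real (B v w)))"
    by (subst sum.swap) (intro sum.cong refl sum.swap)
  also have "\<dots> = (\<Sum>a\<in>V. \<Sum>w\<in>V. of_real (Y a * Y w) * (\<Sum>v\<in>V. Res s v a * of_real (B v w)))"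
    by (simp add: sum_distrib_left)
  finally have e1: "(\<Sum>v\<in>V. PY v * of_real (BY v)) = \<dots>" .
  have e2: "(\<Sum>v\<in>V. PY v * of_real (Y v)) = (\<Sum>a\<in>V. \<Sum>w\<in>V. of_real (Y a * Y w) * Res s w a)"
    unfolding PY_def sum_distrib_right by (subst sum.swap) (simp add: mult_ac)
  have "(\<Sum>v\<in>V. PY v * (of_real (Y v) - \<i> * of_real s * of_real (BY v)))
      = (\<Sum>v\<in>V. PY v * of_real (Y v)) - \<i> * of_real s * (\<Sum>v\<in>V. PY v * of_real (BY v))"
    by (simp add: right_diff_distrib sum_subtractf sum_distrib_left mult_ac)
  also have "\<dots> = (\<Sum>a\<in>V. \<Sum>w\<in>V. of_real (Y a * Y w) *
      (Res s w a - \<i> * of_real s * (\<Sum>v\<in>V. Res s v a * of_real (B v w))))"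
    unfolding e1 e2 sum_distrib_left[of "\<i> * of_real s"] sum_subtractf[symmetric]
    by (intro sum.cong refl) (simp add: algebra_simps sum_distrib_left)
  also have "\<dots> = (\<Sum>a\<in>V. \<Sum>w\<in>V. of_real (Y a * Y w) * of_real (B a w))"
    using Res_resolvent by (intro sum.cong refl) simp
  also have "\<dots> = of_real (\<Sum>v\<in>V. Y v * BY v)"
    unfolding BY_def by (simp add: sum_distrib_left mult_ac)
  finally show ?thesis by simp
qed

end

section \<open>The characteristic function of a quadratic form\<close>

text \<open>\<open>exp (psi (i r) / 2)\<close> is the expectation of \<open>exp (i r (g\<^sup>2 - 1) / 2)\<close> for a standard normal \<open>g\<close>.\<close>

definition psi :: "complex \<Rightarrow> complex" where "psi z = - z - Ln (1 - z)"

context bounded_iid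
begin

lemma norm_exp_phase: "0 \<le> a \<Longrightarrow> cmod (exp (\<i> * of_real r - of_real a)) \<le> 1"
  by (simp add: norm_exp_eq_Re)

lemma bm_exp_phase:
  assumes "bm r" "bm a" "\<And>x. 0 \<le> a x"
  shows "bm (\<lambda>x. exp (\<i> * of_real (r x) - of_real (a x)))"
proof (rule bmI[of _ 1])
  have [measurable]: "r \<in> borel_measurable P" "a \<in> borel_measurable P"
    using assms by (auto intro: bm_measurable)
  show "(\<lambda>x. exp (\<i> * of_real (r x) - of_real (a x))) \<in> borel_measurable P" by measurable
qed (use norm_exp_phase assms in auto)

lemma norm_integral_le:
  fixes f :: "('i \<Rightarrow> real) \<Rightarrow> complex"
  assumes "bm f" "bm g" "\<And>x. cmod (f x) \<le> g x"
  shows "cmod (\<integral>x. f x \<partial>P) \<le> (\<integral>x. g x \<partial>P)"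
proof -
  have "cmod (\<integral>x. f x \<partial>P) \<le> (\<integral>x. cmod (f x) \<partial>P)"
    by (rule integral_norm_bound)
  also have "\<dots> \<le> (\<integral>x. g x \<partial>P)"
    using assms by (intro integral_mono bm_integrable bm_norm)
  finally show ?thesis .
qed

lemma norm_integral_times_le:
  fixes f E :: "('i \<Rightarrow> real) \<Rightarrow> complex"
  assumes "bm f" "bm g" "bm E" "\<And>x. cmod (f x) \<le> g x" "\<And>x. cmod (E x) \<le> 1"
  shows "cmod (\<integral>x. f x * E x \<partial>P) \<le> (\<integral>x. g x \<partial>P)"
proof (rule norm_integral_le)
  fix x show "cmod (f x * E x) \<le> g x"
    using mult_mono[OF assms(4,5) order_trans[OF norm_ge_zero assms(4)] norm_ge_zero, of x x]
    by (simp add: norm_mult)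
qed (use assms in \<open>auto intro: bm_mult\<close>)

text \<open>Cauchy--Schwarz against the constant function, in the additive form that absorbs the scale.\<close>

lemma integral_norm_le_of_square:
  fixes f :: "('i \<Rightarrow> real) \<Rightarrow> 'c::{real_normed_field, banach, second_countable_topology}"
  assumes "bm f" "(\<integral>x. (norm (f x))\<^sup>2 \<partial>P) \<le> d\<^sup>2" "0 < d"
  shows "(\<integral>x. norm (f x) \<partial>P) \<le> d"
proof -
  have "norm (f x) \<le> (d + (norm (f x))\<^sup>2 / d) / 2" for x
  proof -
    have "0 \<le> (norm (f x) - d)\<^sup>2" by simp
    then have "2 * norm (f x) * d \<le> d\<^sup>2 + (norm (f x))\<^sup>2" by (simp add: power2_diff)
    then show ?thesis using assms(3) by (simp add: field_simps power2_eq_square)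
  qed
  then have "(\<integral>x. norm (f x) \<partial>P) \<le> (\<integral>x. (d + (norm (f x))\<^sup>2 / d) / 2 \<partial>P)"
    using assms(1) by (intro integral_mono bm_integrable bm_intros)
  also have "\<dots> = (d + (\<integral>x. (norm (f x))\<^sup>2 \<partial>P) / d) / 2"
  proof -
    have "integrable P (\<lambda>x. (norm (f x))\<^sup>2)" using assms(1) by (intro bm_integrable bm_intros)
    then show ?thesis by (simp add: prod.P.prob_space)
  qed
  also have "\<dots> \<le> (d + d\<^sup>2 / d) / 2"
    using assms by (intro divide_right_mono add_left_mono) auto
  finally show ?thesis using assms(3) by (simp add: power2_eq_square)
qed

end

lemma norm_iexp_minus_1: "cmod (iexp \<theta> - 1) \<le> \<bar>\<theta>\<bar>"
  using iexp_approx1[of \<theta> 0] by simp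

lemma norm_iexp_minus_linear: "cmod (iexp \<theta> - 1 - \<i> * of_real \<theta>) \<le> \<theta>\<^sup>2 / 2"
  using iexp_approx1[of \<theta> 1] by (simp add: numeral_2_eq_2 diff_diff_eq)

lemma norm_four_terms:
  assumes "0 \<le> s" "s \<le> 1"
  shows "cmod (\<i> * a + \<i> / 2 * b + \<i> / 2 * r * c + of_real s / 2 * r * d)
    \<le> cmod a + cmod b / 2 + cmod r * cmod c / 2 + cmod r * cmod d / 2"
proof -
  have "s * (cmod r * cmod d) \<le> 1 * (cmod r * cmod d)"
    using assms by (intro mult_right_mono) auto
  then have "cmod (of_real s / 2 * r * d) \<le> cmod r * cmod d / 2"
    using assms by (simp add: norm_mult norm_divide mult_ac)
  moreover have "cmod (\<i> * a) = cmod a" "cmod (\<i> / 2 * b) = cmod b / 2"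
    "cmod (\<i> / 2 * r * c) = cmod r * cmod c / 2" by (simp_all add: norm_mult norm_divide)
  ultimately show ?thesis
    by (smt (verit) norm_triangle_ineq)
qed

text \<open>In the application \<open>J\<close> is \<open>{1..K0}\<close>, \<open>V\<close> is
  \<open>{K+1..n}\<close>, and the vertices in between remain in \<open>I\<close> without entering
  the form.\<close>

locale quad_form = bounded_iid \<mu> \<xi> T I + eigen_data V N B u \<beta>
  for \<mu> \<xi> T and I V :: "'i set" and N :: "'k set" and B u \<beta> +
  fixes J :: "'i set" and C :: "'i \<Rightarrow> 'i \<Rightarrow> real"
  assumes J_sub: "J \<subseteq> I" and V_sub: "V \<subseteq> I" and JV: "J \<inter> V = {}"
begin

definition c :: "'i \<Rightarrow> ('i \<Rightarrow> real) \<Rightarrow> real" where "c v x = (\<Sum>s\<in>J. C s v * y s x)"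
definition BY :: "'i \<Rightarrow> ('i \<Rightarrow> real) \<Rightarrow> real" where "BY v x = (\<Sum>w\<in>V. B v w * y w x)"
text \<open>The partial derivative of \<open>q\<close> with respect to \<open>y v\<close>.\<close>

definition L :: "'i \<Rightarrow> ('i \<Rightarrow> real) \<Rightarrow> real" where "L v x = c v x + BY v x"
definition q :: "('i \<Rightarrow> real) \<Rightarrow> real" where "q x = (\<Sum>v\<in>V. y v x * (c v x + BY v x / 2))"
definition A :: "('i \<Rightarrow> real) \<Rightarrow> real" where "A x = (\<Sum>v\<in>V. (c v x)\<^sup>2)"
text \<open>The damping factor stands in for conditioning on the variables indexed by \<^term>\<open>J\<close>: at \<open>s = 1\<close> it
  disappears, at \<open>s = 0\<close> it is the Gaussian factor of the limit.\<close>

definition E :: "real \<Rightarrow> ('i \<Rightarrow> real) \<Rightarrow> complex" where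
  "E s x = exp (\<i> * of_real (s * q x) - of_real ((1 - s\<^sup>2) * A x / 2))"
text \<open>The second moment of \<open>L v\<close>, that is, the influence of the variable
  \<open>v\<close> on the form; for a graph it is a rescaled degree.\<close>

definition ell :: "'i \<Rightarrow> real" where "ell v = (\<Sum>s\<in>J. (C s v)\<^sup>2) + (\<Sum>w\<in>V. (B v w)\<^sup>2)"

text \<open>\<open>qr v\<close> and \<open>Er s v\<close> are the parts of \<open>q\<close> and \<open>E s\<close> free of the variable \<open>v\<close>.\<close>

definition qr :: "'i \<Rightarrow> ('i \<Rightarrow> real) \<Rightarrow> real" where
  "qr v x = (\<Sum>a\<in>V - {v}. y a x * (c a x + (\<Sum>w\<in>V - {v}. B a w * y w x) / 2))"
definition Er :: "real \<Rightarrow> 'i \<Rightarrow> ('i \<Rightarrow> real) \<Rightarrow> complex" where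
  "Er s v x = exp (\<i> * of_real (s * qr v x) - of_real ((1 - s\<^sup>2) * A x / 2))"

lemma finJ: "finite J" using J_sub fin finite_subset by blast

lemma in_V_I [simp]: "v \<in> V \<Longrightarrow> v \<in> I" using V_sub by blast
lemma in_J_I [simp]: "v \<in> J \<Longrightarrow> v \<in> I" using J_sub by blast

lemma bm_c: "bm (c v)" unfolding c_def by (intro bm_intros) simp
lemma bm_BY: "bm (BY v)" unfolding BY_def by (intro bm_intros) simp
lemma bm_L: "bm (L v)" unfolding L_def by (intro bm_intros bm_c bm_BY)
lemma bm_q: "bm q" unfolding q_def by (intro bm_intros bm_c bm_BY) simp
lemma bm_A: "bm A" unfolding A_def by (intro bm_intros bm_c)
lemma bm_qr: "bm (qr v)" unfolding qr_def by (intro bm_intros bm_c) auto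
lemma bm_PY: "bm (\<lambda>x. \<Sum>w\<in>V. W w * of_real (y w x) :: complex)" by (intro bm_intros) simp

lemma A_nonneg: "0 \<le> A x" unfolding A_def by (intro sum_nonneg) simp

lemma damp_nonneg: "0 \<le> s \<Longrightarrow> s \<le> 1 \<Longrightarrow> 0 \<le> (1 - s\<^sup>2) * A x / 2"
  using A_nonneg by (simp add: power_le_one)

lemma bm_E: "0 \<le> s \<Longrightarrow> s \<le> 1 \<Longrightarrow> bm (E s)"
  unfolding E_def using damp_nonneg by (intro bm_exp_phase bm_intros bm_q bm_A) auto

lemma bm_Er: "0 \<le> s \<Longrightarrow> s \<le> 1 \<Longrightarrow> bm (Er s v)"
  unfolding Er_def using damp_nonneg by (intro bm_exp_phase bm_intros bm_qr bm_A) auto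

lemma norm_E: "0 \<le> s \<Longrightarrow> s \<le> 1 \<Longrightarrow> cmod (E s x) \<le> 1"
  unfolding E_def using damp_nonneg by (intro norm_exp_phase) auto

lemma norm_Er: "0 \<le> s \<Longrightarrow> s \<le> 1 \<Longrightarrow> cmod (Er s v x) \<le> 1"
  unfolding Er_def using damp_nonneg by (intro norm_exp_phase) auto

section \<open>Dependence on a single tail variable\<close>

lemma c_upd: "v \<in> V \<Longrightarrow> c a (x(v := z)) = c a x"
  unfolding c_def using JV by (intro sum.cong refl) (auto simp: y_upd)

lemma A_upd: "v \<in> V \<Longrightarrow> A (x(v := z)) = A x"
  by (simp add: A_def c_upd)

lemma L_upd: "v \<in> V \<Longrightarrow> L v (x(v := z)) = L v x"
  unfolding L_def BY_def by (simp add: c_upd) (intro sum.cong refl, auto simp: y_upd B_diag)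

lemma qr_upd: "v \<in> V \<Longrightarrow> qr v (x(v := z)) = qr v x"
  unfolding qr_def by (intro sum.cong refl) (auto simp: y_upd c_upd)

lemma Er_upd: "v \<in> V \<Longrightarrow> Er s v (x(v := z)) = Er s v x"
  by (simp add: Er_def qr_upd A_upd)

text \<open>Zero diagonal makes \<open>q\<close> affine in each tail variable. Row and column
  \<open>v\<close> of the halved form contribute equally, which restores the full coefficient
  \<open>BY v\<close> in the slope.\<close>

lemma q_split:
  assumes v: "v \<in> V"
  shows "q x = qr v x + y v x * L v x"
proof -
  let ?V = "V - {v}"
  have BYs: "BY a x = B a v * y v x + (\<Sum>w\<in>?V. B a w * y w x)" for a
    unfolding BY_def using v finV by (simp add: sum.remove)
  have "q x = y v x * (c v x + BY v x / 2) + (\<Sum>a\<in>?V. y a x * (c a x + BY a x / 2))"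
    unfolding q_def using v finV by (simp add: sum.remove)
  also have "(\<Sum>a\<in>?V. y a x * (c a x + BY a x / 2)) = qr v x + y v x * (\<Sum>a\<in>?V. B a v * y a x) / 2"
  proof -
    define S where "S a = (\<Sum>w\<in>?V. B a w * y w x)" for a
    show ?thesis
      unfolding qr_def BYs S_def[symmetric] sum_distrib_left sum_divide_distrib sum.distrib[symmetric]
      by (intro sum.cong refl) (simp add: algebra_simps add_divide_distrib)
  qed
  also have "(\<Sum>a\<in>?V. B a v * y a x) = BY v x"
    unfolding BYs[of v] using v by (simp add: B_diag B_sym[of _ v])
  finally show ?thesis by (simp add: L_def algebra_simps)
qed

lemma E_split: "v \<in> V \<Longrightarrow> E s x = Er s v x * iexp (s * y v x * L v x)"
  unfolding E_def Er_def exp_add[symmetric] q_split by (simp add: algebra_simps)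

lemma abs_y: "\<bar>y v x\<bar> \<le> T" by (simp add: y_def xi_bound)

text \<open>Expanding \<open>iexp \<theta>\<close> around the part of \<open>E s\<close> free of
  \<open>v\<close> leaves the exact terms \<open>y v\<close> and
  \<open>((y v)\<^sup>2 - 1) * \<i> * s * L v\<close>, both of mean zero since the first two moments
  of \<open>y v\<close> are the Gaussian ones. Only the remainder \<open>r\<close>, quadratic in
  \<open>L v\<close>, survives.\<close>

lemma stein:
  assumes v: "v \<in> V" and g: "bm g" "\<And>x z. g (x(v := z)) = g x" and s: "0 \<le> s" "s \<le> 1"
  shows "cmod (\<integral>x. g x * (of_real (y v x) - \<i> * of_real s * of_real (L v x)) * E s x \<partial>P)
    \<le> 2 * T ^ 3 * (\<integral>x. cmod (g x) * (L v x)\<^sup>2 \<partial>P)"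
proof -
  define \<theta> where "\<theta> x = s * y v x * L v x" for x
  define H where "H x = g x * Er s v x" for x
  define r where "r x = of_real (y v x) * (iexp (\<theta> x) - 1 - \<i> * of_real (\<theta> x))
    - \<i> * of_real s * of_real (L v x) * (iexp (\<theta> x) - 1)" for x
  have bH: "bm H" unfolding H_def using g s by (intro bm_intros bm_Er)
  have H_upd: "H (x(v := z)) = H x" for x z unfolding H_def using v by (simp add: g Er_upd)
  have bHL: "bm (\<lambda>x. \<i> * of_real s * of_real (L v x) * H x)" using bH by (intro bm_intros bm_L)
  have b\<theta>: "bm \<theta>" unfolding \<theta>_def using v by (intro bm_intros bm_L) simp
  have biexp: "bm (\<lambda>x. iexp (\<theta> x))"
    using bm_exp_phase[OF b\<theta>, of "\<lambda>_. 0"] by simp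
  have br: "bm r" unfolding r_def by (intro bm_intros bm_L biexp b\<theta>) (use v in simp)
  have "g x * (of_real (y v x) - \<i> * of_real s * of_real (L v x)) * E s x
     = of_real (y v x) * H x + of_real ((y v x)\<^sup>2 - 1) * (\<i> * of_real s * of_real (L v x) * H x)
       + r x * H x" for x
    unfolding E_split[OF v] r_def H_def \<theta>_def[symmetric]
    by (simp add: \<theta>_def[of x] algebra_simps power2_eq_square)
  then have "(\<integral>x. g x * (of_real (y v x) - \<i> * of_real s * of_real (L v x)) * E s x \<partial>P)
     = (\<integral>x. of_real (y v x) * H x + of_real ((y v x)\<^sup>2 - 1) * (\<i> * of_real s * of_real (L v x) * H x)
       + r x * H x \<partial>P)" by simp
  also have "\<dots> = (\<integral>x. of_real (y v x) * H x \<partial>P)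
      + (\<integral>x. of_real ((y v x)\<^sup>2 - 1) * (\<i> * of_real s * of_real (L v x) * H x) \<partial>P)
      + (\<integral>x. r x * H x \<partial>P)"
  proof -
    have 1: "bm (\<lambda>x. of_real (y v x) * H x)" using bH v by (intro bm_intros) auto
    have 2: "bm (\<lambda>x. of_real ((y v x)\<^sup>2 - 1) * (\<i> * of_real s * of_real (L v x) * H x))"
      using v by (intro bm_mult[OF _ bHL] bm_intros) auto
    have 3: "bm (\<lambda>x. r x * H x)" using br bH by (intro bm_intros)
    show ?thesis using 1[THEN bm_integrable] 2[THEN bm_integrable] 3[THEN bm_integrable] by simp
  qed
  also have "(\<integral>x. of_real (y v x) * H x \<partial>P) = 0"
    using v bH H_upd by (intro integral_y_times) auto
  also have "(\<integral>x. of_real ((y v x)\<^sup>2 - 1) * (\<i> * of_real s * of_real (L v x) * H x) \<partial>P) = 0"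
    using v bHL H_upd by (intro integral_y2_minus_1_times) (auto simp: L_upd)
  finally have eq: "(\<integral>x. g x * (of_real (y v x) - \<i> * of_real s * of_real (L v x)) * E s x \<partial>P)
     = (\<integral>x. r x * H x \<partial>P)" by simp
  have "cmod (\<integral>x. r x * H x \<partial>P) \<le> (\<integral>x. 2 * T ^ 3 * (cmod (g x) * (L v x)\<^sup>2) \<partial>P)"
  proof (rule norm_integral_le)
    show "bm (\<lambda>x. r x * H x)" using br bH by (intro bm_intros)
    show "bm (\<lambda>x. 2 * T ^ 3 * (cmod (g x) * (L v x)\<^sup>2))" by (intro bm_intros bm_L g)
    fix x
    have T3: "T \<le> T ^ 3" "0 \<le> T" using T_ge_1 by (auto simp: self_le_power)
    have "\<theta> x ^ 2 = s\<^sup>2 * \<bar>y v x\<bar>\<^sup>2 * (L v x)\<^sup>2" by (simp add: \<theta>_def power_mult_distrib)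
    also have "\<dots> \<le> 1 * T\<^sup>2 * (L v x)\<^sup>2"
      using s abs_y[of v x] by (intro mult_right_mono mult_mono power_mono) (auto simp: power_le_one)
    finally have t2: "(\<theta> x)\<^sup>2 \<le> T\<^sup>2 * (L v x)\<^sup>2" by simp
    have "\<bar>\<theta> x\<bar> = s * \<bar>y v x\<bar> * \<bar>L v x\<bar>" using s by (simp add: \<theta>_def abs_mult)
    also have "\<dots> \<le> 1 * T * \<bar>L v x\<bar>"
      using s abs_y[of v x] by (intro mult_right_mono mult_mono) auto
    finally have t1: "\<bar>\<theta> x\<bar> \<le> T * \<bar>L v x\<bar>" by simp
    have "cmod (r x) \<le> \<bar>y v x\<bar> * cmod (iexp (\<theta> x) - 1 - \<i> * of_real (\<theta> x))
        + s * \<bar>L v x\<bar> * cmod (iexp (\<theta> x) - 1)"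
      unfolding r_def using s by (intro norm_triangle_le_diff) (simp add: norm_mult)
    also have "\<dots> \<le> T * ((T\<^sup>2 * (L v x)\<^sup>2) / 2) + 1 * \<bar>L v x\<bar> * (T * \<bar>L v x\<bar>)"
    proof (intro add_mono mult_mono)
      show "cmod (iexp (\<theta> x) - 1 - \<i> * of_real (\<theta> x)) \<le> (T\<^sup>2 * (L v x)\<^sup>2) / 2"
        using norm_iexp_minus_linear[of "\<theta> x"] t2 by linarith
      show "cmod (iexp (\<theta> x) - 1) \<le> T * \<bar>L v x\<bar>" using norm_iexp_minus_1[of "\<theta> x"] t1 by linarith
    qed (use abs_y s T3 in auto)
    also have "\<dots> = (T ^ 3 / 2 + T) * (L v x)\<^sup>2"
      by (simp add: power2_eq_square power3_eq_cube algebra_simps)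
    also have "\<dots> \<le> 2 * T ^ 3 * (L v x)\<^sup>2"
      using T3 by (intro mult_right_mono) auto
    finally have r: "cmod (r x) \<le> 2 * T ^ 3 * (L v x)\<^sup>2" .
    have "cmod (H x) \<le> cmod (g x)"
      unfolding H_def norm_mult using norm_Er[OF s] by (simp add: mult_left_le)
    from mult_mono[OF r this] show "cmod (r x * H x) \<le> 2 * T ^ 3 * (cmod (g x) * (L v x)\<^sup>2)"
      using T3 by (simp add: norm_mult mult_ac)
  qed
  then show ?thesis unfolding eq by simp
qed

text \<open>Here a first-order expansion is enough: the estimate is multiplied later by
  \<open>Res s v v\<close>, which is already bounded by \<open>ell v\<close>.\<close>

lemma stein_square:
  assumes v: "v \<in> V" and s: "0 \<le> s" "s \<le> 1"
  shows "cmod (\<integral>x. of_real ((y v x)\<^sup>2 - 1) * E s x \<partial>P) \<le> T ^ 3 * (\<integral>x. \<bar>L v x\<bar> \<partial>P)"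
proof -
  define \<theta> where "\<theta> x = s * y v x * L v x" for x
  have b\<theta>: "bm \<theta>" unfolding \<theta>_def using v by (intro bm_intros bm_L) simp
  have biexp: "bm (\<lambda>x. iexp (\<theta> x))"
    using bm_exp_phase[OF b\<theta>, of "\<lambda>_. 0"] by simp
  let ?r = "\<lambda>x. of_real ((y v x)\<^sup>2 - 1) * (iexp (\<theta> x) - 1)"
  have b1: "bm (\<lambda>x. of_real ((y v x)\<^sup>2 - 1) * Er s v x)"
    using v s by (intro bm_intros bm_Er) simp
  have br: "bm ?r" using v by (intro bm_intros biexp) simp
  have b2: "bm (\<lambda>x. ?r x * Er s v x)" by (rule bm_mult[OF br bm_Er[OF s]])
  have "of_real ((y v x)\<^sup>2 - 1) * E s x = of_real ((y v x)\<^sup>2 - 1) * Er s v x + ?r x * Er s v x" for x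
    unfolding E_split[OF v] \<theta>_def by (simp add: algebra_simps)
  then have "(\<integral>x. of_real ((y v x)\<^sup>2 - 1) * E s x \<partial>P)
      = (\<integral>x. of_real ((y v x)\<^sup>2 - 1) * Er s v x \<partial>P) + (\<integral>x. ?r x * Er s v x \<partial>P)"
    using b1[THEN bm_integrable] b2[THEN bm_integrable] by simp
  also have "(\<integral>x. of_real ((y v x)\<^sup>2 - 1) * Er s v x \<partial>P) = 0"
    using v s by (intro integral_y2_minus_1_times bm_Er) (auto simp: Er_upd)
  finally have eq: "(\<integral>x. of_real ((y v x)\<^sup>2 - 1) * E s x \<partial>P) = (\<integral>x. ?r x * Er s v x \<partial>P)" by simp
  have "cmod (\<integral>x. ?r x * Er s v x \<partial>P) \<le> (\<integral>x. T ^ 3 * \<bar>L v x\<bar> \<partial>P)"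
  proof (rule norm_integral_times_le[OF br _ bm_Er[OF s] _ norm_Er[OF s]])
    show "bm (\<lambda>x. T ^ 3 * \<bar>L v x\<bar>)" by (intro bm_intros bm_L)
    fix x
    have "\<bar>\<theta> x\<bar> = s * \<bar>y v x\<bar> * \<bar>L v x\<bar>" using s by (simp add: \<theta>_def abs_mult)
    also have "\<dots> \<le> 1 * T * \<bar>L v x\<bar>"
      using s abs_y[of v x] by (intro mult_right_mono mult_mono) auto
    finally have t1: "cmod (iexp (\<theta> x) - 1) \<le> T * \<bar>L v x\<bar>"
      using norm_iexp_minus_1[of "\<theta> x"] by simp
    have "(y v x)\<^sup>2 \<le> T\<^sup>2" using power_mono[OF abs_y[of v x], of 2] by simp
    moreover have "1 \<le> T\<^sup>2" using T_ge_1 by (simp add: one_le_power)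
    moreover have "0 \<le> (y v x)\<^sup>2" by simp
    ultimately have "\<bar>(y v x)\<^sup>2 - 1\<bar> \<le> T\<^sup>2" by linarith
    from mult_mono[OF this t1] show "cmod (?r x) \<le> T ^ 3 * \<bar>L v x\<bar>"
      unfolding norm_mult norm_of_real by (simp add: power2_eq_square power3_eq_cube mult_ac)
  qed
  then show ?thesis unfolding eq by simp
qed

section \<open>Moments of the partial derivatives\<close>

lemma ell_nonneg: "0 \<le> ell v" unfolding ell_def by (intro add_nonneg_nonneg sum_nonneg) auto

lemma L_linear:
  fixes v defines "a \<equiv> \<lambda>i. if i \<in> J then C i v else B v i"
  shows "L v x = (\<Sum>i\<in>J \<union> V. a i * y i x)" "ell v = (\<Sum>i\<in>J \<union> V. (a i)\<^sup>2)"
proof -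
  have *: "a i = B v i" if "i \<in> V" for i using that JV by (auto simp: a_def)
  show "L v x = (\<Sum>i\<in>J \<union> V. a i * y i x)" "ell v = (\<Sum>i\<in>J \<union> V. (a i)\<^sup>2)"
    unfolding L_def c_def BY_def ell_def using finJ finV JV
    by (simp_all add: sum.union_disjoint *) (simp_all add: a_def)
qed

lemma JV_sub: "J \<union> V \<subseteq> I" using J_sub V_sub by blast

lemma integral_L_sq: "(\<integral>x. (L v x)\<^sup>2 \<partial>P) = ell v"
  unfolding L_linear using JV_sub by (rule integral_linear_sq)

lemma integral_L_fourth: "(\<integral>x. (L v x) ^ 4 \<partial>P) \<le> (3 + T\<^sup>2) * (ell v)\<^sup>2"
  unfolding L_linear using JV_sub by (rule integral_linear_fourth)

text \<open>The inequality of arithmetic and geometric means with weight \<open>h\<close> balances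
  the second moment of \<open>g\<close> against the fourth moment of \<open>L v\<close>. The fourth
  moment is of order \<open>(ell v)\<^sup>2\<close>, at most \<open>h\<^sup>2 * ell v\<close>, so
  one factor \<open>h\<close> is gained over \<open>ell v\<close>.\<close>

lemma integral_weighted_L_sq:
  assumes g: "bm g" "(\<integral>x. (cmod (g x))\<^sup>2 \<partial>P) \<le> ell v" and h: "0 < h" "ell v \<le> h\<^sup>2"
  shows "(\<integral>x. cmod (g x) * (L v x)\<^sup>2 \<partial>P) \<le> (4 + T\<^sup>2) / 2 * h * ell v"
proof -
  have "cmod (g x) * (L v x)\<^sup>2 \<le> (h * (cmod (g x))\<^sup>2 + (L v x) ^ 4 / h) / 2" for x
  proof -
    have "0 \<le> (h * cmod (g x) - (L v x)\<^sup>2)\<^sup>2" by simp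
    then have "2 * h * (cmod (g x) * (L v x)\<^sup>2) \<le> h\<^sup>2 * (cmod (g x))\<^sup>2 + (L v x) ^ 4"
      by (simp add: power2_eq_square power4_eq_xxxx algebra_simps)
    then show ?thesis using h(1) by (simp add: field_simps power2_eq_square)
  qed
  then have "(\<integral>x. cmod (g x) * (L v x)\<^sup>2 \<partial>P) \<le> (\<integral>x. (h * (cmod (g x))\<^sup>2 + (L v x) ^ 4 / h) / 2 \<partial>P)"
    using g(1) by (intro integral_mono bm_integrable bm_intros bm_L)
  also have "\<dots> = (h * (\<integral>x. (cmod (g x))\<^sup>2 \<partial>P) + (\<integral>x. (L v x) ^ 4 \<partial>P) / h) / 2"
  proof -
    have "integrable P (\<lambda>x. (cmod (g x))\<^sup>2)" using g(1) by (intro bm_integrable bm_intros)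
    moreover have "integrable P (\<lambda>x. (L v x) ^ 4)" by (intro bm_integrable bm_intros bm_L)
    ultimately show ?thesis by simp
  qed
  also have "\<dots> \<le> (h * ell v + ((3 + T\<^sup>2) * (h\<^sup>2 * ell v)) / h) / 2"
  proof (intro divide_right_mono add_mono mult_left_mono)
    have "(ell v)\<^sup>2 \<le> h\<^sup>2 * ell v"
      using h(2) ell_nonneg[of v] by (simp add: power2_eq_square mult_right_mono)
    then have "(3 + T\<^sup>2) * (ell v)\<^sup>2 \<le> (3 + T\<^sup>2) * (h\<^sup>2 * ell v)" by (intro mult_left_mono) auto
    then show "(\<integral>x. (L v x) ^ 4 \<partial>P) \<le> (3 + T\<^sup>2) * (h\<^sup>2 * ell v)"
      using integral_L_fourth[of v] by linarith
  qed (use h g in auto)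
  also have "\<dots> = (4 + T\<^sup>2) / 2 * h * ell v"
    using h(1) by (simp add: field_simps power2_eq_square)
  finally show ?thesis .
qed

lemma integral_abs_L:
  assumes "0 < h" "ell v \<le> h\<^sup>2"
  shows "(\<integral>x. \<bar>L v x\<bar> \<partial>P) \<le> h"
  using integral_norm_le_of_square[of "L v" h] assms bm_L integral_L_sq by simp

text \<open>The products \<open>y s * y w\<close> with \<open>s\<close> in \<open>J\<close> and
  \<open>w\<close> in \<open>V\<close> are orthonormal, so the \<open>L\<^sup>2\<close> norm is the
  Frobenius norm of the coefficient matrix, here the product of \<open>C\<close> and
  \<open>W\<close>.\<close>

lemma integral_bilinear_sq:
  fixes W :: "'i \<Rightarrow> 'i \<Rightarrow> complex"
  shows "(\<integral>x. (cmod (\<Sum>v\<in>V. of_real (c v x) * (\<Sum>w\<in>V. W v w * of_real (y w x))))\<^sup>2 \<partial>P)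
    = (\<Sum>s\<in>J. \<Sum>w\<in>V. (cmod (\<Sum>v\<in>V. of_real (C s v) * W v w))\<^sup>2)"
proof -
  define Z where "Z e x = y (fst e) x * y (snd e) x" for e :: "'i \<times> 'i" and x
  define g where "g e = (\<Sum>v\<in>V. of_real (C (fst e) v) * W v (snd e))" for e
  have "(\<Sum>v\<in>V. of_real (c v x) * (\<Sum>w\<in>V. W v w * of_real (y w x))) = (\<Sum>e\<in>J \<times> V. g e * of_real (Z e x))" for x
  proof -
    have "(\<Sum>v\<in>V. of_real (c v x) * (\<Sum>w\<in>V. W v w * of_real (y w x)))
      = (\<Sum>v\<in>V. \<Sum>s\<in>J. \<Sum>w\<in>V. of_real (C s v) * W v w * of_real (y s x * y w x))"
      unfolding c_def of_real_sum sum_product by (simp add: mult_ac)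
    also have "\<dots> = (\<Sum>s\<in>J. \<Sum>w\<in>V. \<Sum>v\<in>V. of_real (C s v) * W v w * of_real (y s x * y w x))"
      by (subst sum.swap) (intro sum.cong refl sum.swap)
    also have "\<dots> = (\<Sum>s\<in>J. \<Sum>w\<in>V. g (s, w) * of_real (Z (s, w) x))"
      unfolding g_def Z_def sum_distrib_right by simp
    finally show ?thesis by (simp add: sum.cartesian_product)
  qed
  then have "(\<integral>x. (cmod (\<Sum>v\<in>V. of_real (c v x) * (\<Sum>w\<in>V. W v w * of_real (y w x))))\<^sup>2 \<partial>P)
    = (\<integral>x. (cmod (\<Sum>e\<in>J \<times> V. g e * of_real (Z e x)))\<^sup>2 \<partial>P)" by simp
  also have "\<dots> = (\<Sum>e\<in>J \<times> V. (cmod (g e))\<^sup>2)"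
  proof (rule integral_cmod_sum_sq_orthonormal)
    show "bm (Z e)" if "e \<in> J \<times> V" for e
      unfolding Z_def using that by (intro bm_intros) auto
    show "(\<integral>x. Z e x * Z e' x \<partial>P) = (if e = e' then 1 else 0)" if "e \<in> J \<times> V" "e' \<in> J \<times> V" for e e'
    proof -
      have "fst e \<noteq> snd e" "fst e \<noteq> snd e'" using that JV by auto
      then show ?thesis
        using that integral_yy_yy[of "fst e" "fst e'" "snd e" "snd e'"] unfolding Z_def
        by (auto simp: prod_eq_iff)
    qed
  qed (use finJ finV in auto)
  also have "\<dots> = (\<Sum>s\<in>J. \<Sum>w\<in>V. (cmod (g (s, w)))\<^sup>2)" by (simp add: sum.cartesian_product)
  finally show ?thesis by (simp add: g_def)
qed

text \<open>\<open>h\<close> bounds the influence of every single tail variable and \<open>d\<close>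
  the size of \<open>B c\<close>. For graphs they are of order \<open>1 / sqrt K\<close> and
  \<open>sqrt (K0 / K)\<close>.\<close>

context
  fixes h d :: real
  assumes h: "0 < h" "\<And>v. v \<in> V \<Longrightarrow> ell v \<le> h\<^sup>2"
    and d: "0 < d" "(\<Sum>s\<in>J. \<Sum>w\<in>V. (\<Sum>v\<in>V. C s v * B v w)\<^sup>2) \<le> d\<^sup>2"
begin

lemma integral_c_BY: "(\<integral>x. \<bar>\<Sum>v\<in>V. c v x * BY v x\<bar> \<partial>P) \<le> d"
proof -
  let ?f = "\<lambda>x. \<Sum>v\<in>V. of_real (c v x) * (\<Sum>w\<in>V. of_real (B v w) * of_real (y w x)) :: complex"
  have f: "?f x = of_real (\<Sum>v\<in>V. c v x * BY v x)" for x by (simp add: BY_def)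
  have "(\<integral>x. cmod (?f x) \<partial>P) \<le> d"
  proof (rule integral_norm_le_of_square[OF _ _ d(1)])
    show "bm ?f" by (intro bm_intros bm_c bm_PY)
    have "(\<integral>x. (cmod (?f x))\<^sup>2 \<partial>P) = (\<Sum>s\<in>J. \<Sum>w\<in>V. (cmod (of_real (\<Sum>v\<in>V. C s v * B v w)))\<^sup>2)"
      unfolding integral_bilinear_sq by simp
    then show "(\<integral>x. (cmod (?f x))\<^sup>2 \<partial>P) \<le> d\<^sup>2" using d(2) by (simp del: of_real_sum)
  qed
  then show ?thesis unfolding f norm_of_real .
qed

lemma integral_c_Res:
  "(\<integral>x. cmod (\<Sum>v\<in>V. of_real (c v x) * (\<Sum>w\<in>V. Res s v w * of_real (y w x))) \<partial>P) \<le> d"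
proof (rule integral_norm_le_of_square[OF _ _ d(1)])
  show "bm (\<lambda>x. \<Sum>v\<in>V. of_real (c v x) * (\<Sum>w\<in>V. Res s v w * of_real (y w x)))"
    by (intro bm_sum bm_mult bm_of_real bm_c bm_PY)
  have "(\<Sum>r\<in>J. \<Sum>w\<in>V. (cmod (\<Sum>v\<in>V. of_real (C r v) * Res s v w))\<^sup>2)
      \<le> (\<Sum>r\<in>J. \<Sum>w\<in>V. (\<Sum>v\<in>V. C r v * B v w)\<^sup>2)"
    by (intro sum_mono Res_row_bound)
  then show "(\<integral>x. (cmod (\<Sum>v\<in>V. of_real (c v x) * (\<Sum>w\<in>V. Res s v w * of_real (y w x))))\<^sup>2 \<partial>P) \<le> d\<^sup>2"
    unfolding integral_bilinear_sq using d(2) by linarith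
qed

section \<open>The approximate differential equation\<close>

definition PY :: "real \<Rightarrow> 'i \<Rightarrow> ('i \<Rightarrow> real) \<Rightarrow> complex" where
  "PY s v x = (\<Sum>w\<in>V. Res s v w * of_real (y w x))"
text \<open>Without the diagonal entry this is free of the variable \<open>v\<close>, as
  \<open>stein\<close> demands of its test function; the diagonal entry goes to
  \<open>stein_square\<close>.\<close>

definition PY' :: "real \<Rightarrow> 'i \<Rightarrow> ('i \<Rightarrow> real) \<Rightarrow> complex" where
  "PY' s v x = (\<Sum>w\<in>V - {v}. Res s v w * of_real (y w x))"

lemma PY_split: "v \<in> V \<Longrightarrow> PY s v x = Res s v v * of_real (y v x) + PY' s v x"
  unfolding PY_def PY'_def using finV by (simp add: sum.remove)

lemma bm_PY'1: "bm (PY s v)" unfolding PY_def by (rule bm_PY)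
lemma bm_PY': "bm (PY' s v)" unfolding PY'_def by (intro bm_intros) simp

text \<open>The first two terms have the shape treated by \<open>stein\<close>, the third that of
  \<open>stein_square\<close>, and the fourth is small outright because the diagonal resolvent entry
  is of second order. In the first one, the square of \<open>c v\<close> needed to complete the
  slope \<open>L v\<close> comes from differentiating the damping factor.\<close>

definition F :: "real \<Rightarrow> 'i \<Rightarrow> ('i \<Rightarrow> real) \<Rightarrow> complex" where
  "F s v x = \<i> * (of_real (c v x) * (of_real (y v x) - \<i> * of_real s * of_real (L v x)) * E s x)
    + \<i> / 2 * (PY' s v x * (of_real (y v x) - \<i> * of_real s * of_real (L v x)) * E s x)
    + \<i> / 2 * Res s v v * (of_real ((y v x)\<^sup>2 - 1) * E s x)
    + of_real s / 2 * Res s v v * (of_real (y v x * L v x) * E s x)"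

text \<open>The cross terms left when the full slope \<open>L v = c v + BY v\<close> is inserted
  where only \<open>c v\<close> or only \<open>BY v\<close> was available. Both contain
  \<open>B\<close> or its resolvent applied to \<open>c\<close> and are therefore controlled by
  \<open>d\<close>.\<close>

definition R :: "real \<Rightarrow> ('i \<Rightarrow> real) \<Rightarrow> complex" where
  "R s x = - of_real s * of_real (\<Sum>v\<in>V. c v x * BY v x)
     - of_real s / 2 * (\<Sum>v\<in>V. of_real (c v x) * PY s v x)"

text \<open>Rewriting \<open>y \<bullet> B y\<close> through the resolvent makes the term that Stein's identity returns for
  \<open>(P y) v\<close> the trace of \<open>P\<close>, instead of a new quadratic form with matrix \<open>B\<^sup>2\<close>.\<close>

lemma derivative_decomposition:
  "(\<i> * of_real (q x) + of_real (s * A x)) * E s x - \<i> / 2 * (\<Sum>i\<in>N. \<kappa> s i) * E s x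
    = (\<Sum>v\<in>V. F s v x) + R s x * E s x"
proof -
  let ?m = "\<lambda>v. of_real (y v x) - \<i> * of_real s * of_real (BY v x) :: complex"
  define f where "f v = \<i> * (of_real (c v x) * (of_real (y v x) - \<i> * of_real s * of_real (L v x)))
    + \<i> / 2 * (PY' s v x * (of_real (y v x) - \<i> * of_real s * of_real (L v x)))
    + \<i> / 2 * Res s v v * (of_real ((y v x)\<^sup>2 - 1))
    + of_real s / 2 * Res s v v * (of_real (y v x * L v x))" for v
  have q: "q x = (\<Sum>v\<in>V. y v x * c v x) + (\<Sum>v\<in>V. y v x * BY v x) / 2"
    unfolding q_def by (simp add: sum.distrib sum_divide_distrib distrib_left)
  have "complex_of_real (q x) = (\<Sum>v\<in>V. of_real (y v x) * of_real (c v x)) + (\<Sum>v\<in>V. PY s v x * ?m v) / 2"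
    unfolding q using Res_form[of "\<lambda>v. y v x" s] by (simp add: PY_def BY_def)
  then have "(\<i> * of_real (q x) + of_real (s * A x)) - \<i> / 2 * (\<Sum>i\<in>N. \<kappa> s i)
    = (\<Sum>v\<in>V. \<i> * (of_real (y v x) * of_real (c v x)) + \<i> / 2 * (PY s v x * ?m v)
        + of_real s * of_real ((c v x)\<^sup>2) - \<i> / 2 * Res s v v)"
    unfolding Res_trace[symmetric] A_def
    by (simp add: sum.distrib sum_subtractf sum_distrib_left sum_divide_distrib distrib_left)
  also have "\<dots> = (\<Sum>v\<in>V. \<i> * (of_real (c v x) * (of_real (y v x) - \<i> * of_real s * of_real (L v x)))
    + \<i> / 2 * (PY' s v x * (of_real (y v x) - \<i> * of_real s * of_real (L v x)))
    + \<i> / 2 * Res s v v * (of_real ((y v x)\<^sup>2 - 1))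
    + of_real s / 2 * Res s v v * (of_real (y v x * L v x))
    - of_real s * of_real (c v x * BY v x) - of_real s / 2 * (of_real (c v x) * PY s v x))"
  proof (intro sum.cong refl)
    fix v assume "v \<in> V"
    from PY_split[OF this, of s x]
    show "\<i> * (of_real (y v x) * of_real (c v x)) + \<i> / 2 * (PY s v x * ?m v)
        + of_real s * of_real ((c v x)\<^sup>2) - \<i> / 2 * Res s v v
      = \<i> * (of_real (c v x) * (of_real (y v x) - \<i> * of_real s * of_real (L v x)))
    + \<i> / 2 * (PY' s v x * (of_real (y v x) - \<i> * of_real s * of_real (L v x)))
    + \<i> / 2 * Res s v v * (of_real ((y v x)\<^sup>2 - 1))
    + of_real s / 2 * Res s v v * (of_real (y v x * L v x))
    - of_real s * of_real (c v x * BY v x) - of_real s / 2 * (of_real (c v x) * PY s v x)"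
      by (simp add: L_def field_simps power2_eq_square)
  qed
  finally have X: "(\<i> * of_real (q x) + of_real (s * A x)) - \<i> / 2 * (\<Sum>i\<in>N. \<kappa> s i) = (\<Sum>v\<in>V. f v) + R s x"
    unfolding f_def[symmetric] R_def
    by (simp add: sum_subtractf sum_distrib_left sum_negf sum_divide_distrib)
  have "F s v x = f v * E s x" for v
    unfolding F_def f_def distrib_right by (simp only: mult.assoc)
  then show ?thesis
    unfolding left_diff_distrib[symmetric] X by (simp add: sum_distrib_right distrib_right)
qed

lemma bm_F: "0 \<le> s \<Longrightarrow> s \<le> 1 \<Longrightarrow> v \<in> V \<Longrightarrow> bm (F s v)"
  unfolding F_def by (intro bm_intros bm_c bm_L bm_E bm_PY') auto

lemma bm_R: "bm (R s)"
  unfolding R_def by (intro bm_intros bm_c bm_BY bm_PY'1)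

text \<open>Each of the four terms is at most a power of \<open>T\<close> times
  \<open>h * ell v\<close>. The factor \<open>ell v\<close> can be summed over all vertices, and
  \<open>h\<close> remains as the gain.\<close>

lemma integral_F:
  assumes v: "v \<in> V" and s: "0 \<le> s" "s \<le> 1"
  shows "cmod (\<integral>x. F s v x \<partial>P) \<le> 9 * T ^ 5 * h * ell v"
proof -
  note hv = h(1) h(2)[OF v]
  let ?l = "\<lambda>x. of_real (y v x) - \<i> * of_real s * of_real (L v x) :: complex"
  let ?I1 = "\<integral>x. of_real (c v x) * ?l x * E s x \<partial>P"
  let ?I2 = "\<integral>x. PY' s v x * ?l x * E s x \<partial>P"
  let ?I3 = "\<integral>x. of_real ((y v x)\<^sup>2 - 1) * E s x \<partial>P"
  let ?I4 = "\<integral>x. of_real (y v x * L v x) * E s x \<partial>P"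
  have "bm (\<lambda>x. of_real (c v x) * ?l x * E s x)" "bm (\<lambda>x. PY' s v x * ?l x * E s x)"
    "bm (\<lambda>x. of_real ((y v x)\<^sup>2 - 1) * E s x :: complex)" "bm (\<lambda>x. of_real (y v x * L v x) * E s x :: complex)"
    using v s by (auto intro!: bm_mult bm_diff bm_of_real bm_c bm_L bm_E bm_PY' bm_power bm_y)
  note b = this[THEN bm_integrable]
  have eq: "(\<integral>x. F s v x \<partial>P) = \<i> * ?I1 + \<i> / 2 * ?I2 + \<i> / 2 * Res s v v * ?I3 + of_real s / 2 * Res s v v * ?I4"
    unfolding F_def using b by simp
  have "cmod (\<integral>x. F s v x \<partial>P) \<le> cmod ?I1 + cmod ?I2 / 2 + cmod (Res s v v) * cmod ?I3 / 2 + cmod (Res s v v) * cmod ?I4 / 2"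
    unfolding eq using s by (rule norm_four_terms)
  also have "\<dots> \<le> T ^ 3 * (4 + T\<^sup>2) * h * ell v + T ^ 3 * (4 + T\<^sup>2) * h * ell v / 2
      + ell v * (T ^ 3 * h) / 2 + ell v * (T * h) / 2"
  proof (intro add_mono divide_right_mono mult_mono)
    have T3: "0 \<le> 2 * T ^ 3" using T_ge_1 by simp
    have cl: "c v x = (\<Sum>i\<in>J. C i v * y i x)" for x by (simp add: c_def)
    have g1: "(\<integral>x. (cmod (of_real (c v x)))\<^sup>2 \<partial>P) \<le> ell v"
      using integral_linear_sq[OF J_sub, of "\<lambda>i. C i v"] unfolding ell_def cl norm_of_real power2_abs by (simp add: sum_nonneg)
    have "cmod ?I1 \<le> 2 * T ^ 3 * (\<integral>x. cmod (of_real (c v x)) * (L v x)\<^sup>2 \<partial>P)"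
      using v s by (intro stein bm_of_real bm_c) (simp_all add: c_upd)
    also have "\<dots> \<le> 2 * T ^ 3 * ((4 + T\<^sup>2) / 2 * h * ell v)"
      by (intro mult_left_mono integral_weighted_L_sq g1 hv bm_of_real bm_c T3)
    finally show "cmod ?I1 \<le> T ^ 3 * (4 + T\<^sup>2) * h * ell v" by simp
    have "(\<integral>x. (cmod (PY' s v x))\<^sup>2 \<partial>P) = (\<Sum>w\<in>V - {v}. (cmod (Res s v w))\<^sup>2)"
      unfolding PY'_def using V_sub by (intro integral_linear_cmod_sq) auto
    also have "\<dots> \<le> (\<Sum>w\<in>V. (cmod (Res s v w))\<^sup>2)"
      using finV by (intro sum_mono2) auto
    also have "\<dots> \<le> ell v"
      using Res_row_norm[OF v, of s] unfolding ell_def by (simp add: sum_nonneg add_increasing)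
    finally have g2: "(\<integral>x. (cmod (PY' s v x))\<^sup>2 \<partial>P) \<le> ell v" .
    have "cmod ?I2 \<le> 2 * T ^ 3 * (\<integral>x. cmod (PY' s v x) * (L v x)\<^sup>2 \<partial>P)"
      using v s by (intro stein bm_PY') (auto simp: PY'_def y_upd intro!: sum.cong)
    also have "\<dots> \<le> 2 * T ^ 3 * ((4 + T\<^sup>2) / 2 * h * ell v)"
      by (intro mult_left_mono integral_weighted_L_sq g2 hv bm_PY' T3)
    finally show "cmod ?I2 \<le> T ^ 3 * (4 + T\<^sup>2) * h * ell v" by simp
    show P: "cmod (Res s v v) \<le> ell v" "cmod (Res s v v) \<le> ell v"
      using Res_diag[OF v, of s] s unfolding ell_def by (auto simp: sum_nonneg add_increasing)
    have "cmod ?I3 \<le> T ^ 3 * (\<integral>x. \<bar>L v x\<bar> \<partial>P)" by (rule stein_square[OF v s])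
    also have "\<dots> \<le> T ^ 3 * h"
      using T_ge_1 by (intro mult_left_mono integral_abs_L hv) auto
    finally show "cmod ?I3 \<le> T ^ 3 * h" .
    have "cmod ?I4 \<le> (\<integral>x. T * \<bar>L v x\<bar> \<partial>P)"
    proof (rule norm_integral_times_le[OF _ _ bm_E[OF s] _ norm_E[OF s]])
      show "bm (\<lambda>x. complex_of_real (y v x * L v x))" using v by (intro bm_intros bm_L) simp
      show "bm (\<lambda>x. T * \<bar>L v x\<bar>)" by (intro bm_intros bm_L)
      show "cmod (complex_of_real (y v x * L v x)) \<le> T * \<bar>L v x\<bar>" for x
        unfolding norm_of_real abs_mult using abs_y by (intro mult_right_mono) auto
    qed
    also have "\<dots> = T * (\<integral>x. \<bar>L v x\<bar> \<partial>P)" by simp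
    also have "\<dots> \<le> T * h"
      using T_ge_1 by (intro mult_left_mono integral_abs_L hv) auto
    finally show "cmod ?I4 \<le> T * h" .
  qed (use ell_nonneg in auto)
  also have "\<dots> = (3/2 * (4 * T ^ 3 + T ^ 5) + T ^ 3 / 2 + T / 2) * (h * ell v)"
    by (simp add: field_simps power2_eq_square power3_eq_cube power_numeral_reduce)
  \<comment> \<open>Replacing every power of \<open>T\<close> by \<open>T ^ 5\<close>, the
    coefficients add up to 17/2.\<close>
  also have "\<dots> \<le> 9 * T ^ 5 * (h * ell v)"
  proof (intro mult_right_mono)
    have *: "3/2 * (4 * a + c) + a / 2 + b / 2 \<le> 9 * c" if "a \<le> c" "b \<le> c" "1 \<le> c" for a b c :: real
      using that by (simp add: field_simps)
    show "3/2 * (4 * T ^ 3 + T ^ 5) + T ^ 3 / 2 + T / 2 \<le> 9 * T ^ 5"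
      using T_ge_1 power_increasing[of 1 5 T] by (intro *) (auto simp: power_increasing one_le_power)
  qed (use h ell_nonneg in auto)
  finally show ?thesis by (simp add: mult_ac)
qed

lemma integral_R:
  assumes s: "0 \<le> s" "s \<le> 1"
  shows "cmod (\<integral>x. R s x * E s x \<partial>P) \<le> 2 * d"
proof -
  let ?a = "\<lambda>x. \<bar>\<Sum>v\<in>V. c v x * BY v x\<bar>" and ?b = "\<lambda>x. cmod (\<Sum>v\<in>V. of_real (c v x) * PY s v x)"
  have ba: "bm ?a" "bm ?b" by (intro bm_intros bm_c bm_BY bm_PY'1)+
  have "cmod (\<integral>x. R s x * E s x \<partial>P) \<le> (\<integral>x. ?a x + ?b x \<partial>P)"
  proof (rule norm_integral_times_le[OF bm_R _ bm_E[OF s] _ norm_E[OF s]])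
    show "bm (\<lambda>x. ?a x + ?b x)" using ba by (rule bm_add)
    fix x
    have "cmod (R s x) \<le> s * ?a x + s / 2 * ?b x"
      unfolding R_def using s by (intro norm_triangle_le_diff) (simp add: norm_mult norm_divide del: of_real_sum)
    also have "\<dots> \<le> 1 * ?a x + 1 * ?b x"
      using s by (intro add_mono mult_right_mono) auto
    finally show "cmod (R s x) \<le> ?a x + ?b x" by simp
  qed
  also have "\<dots> = (\<integral>x. ?a x \<partial>P) + (\<integral>x. ?b x \<partial>P)"
    using ba by (intro Bochner_Integration.integral_add bm_integrable)
  also have "\<dots> \<le> d + d"
    using integral_c_BY integral_c_Res[of s] unfolding PY_def by (intro add_mono)
  finally show ?thesis by simp
qed

section \<open>Comparison with the regularised determinant\<close>

definition hc :: "real \<Rightarrow> complex" where "hc s = (\<integral>x. E s x \<partial>P)"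
text \<open>\<open>det\<^sub>2 (I - i s B)\<close> to the power -1/2, the exact solution, with value
  one at zero, of the linear equation that \<open>hc\<close> satisfies approximately.\<close>

definition Fc :: "real \<Rightarrow> complex" where "Fc s = exp ((\<Sum>i\<in>N. psi (\<i> * of_real (s * \<beta> i))) / 2)"

lemma E_derivative:
  "((\<lambda>s. E s x) has_vector_derivative (\<i> * of_real (q x) + of_real (s * A x)) * E s x) (at s within S)"
proof -
  have "((\<lambda>z. exp (\<i> * z * of_real (q x) - (1 - z\<^sup>2) * of_real (A x) / 2)) has_field_derivative
      (\<i> * of_real (q x) + of_real s * of_real (A x)) * exp (\<i> * of_real s * of_real (q x) - (1 - (of_real s)\<^sup>2) * of_real (A x) / 2))
      (at (of_real s))"
    by (rule derivative_eq_intros refl | simp add: algebra_simps)+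
  from has_vector_derivative_real_field[OF this] show ?thesis
    unfolding E_def by (simp add: mult.assoc)
qed

text \<open>The terms \<open>- \<i> * \<beta> i\<close> produced by the regularisation cancel in the
  sum because \<open>B\<close> has trace zero, which leaves the trace of the resolvent
  matrix.\<close>

lemma Fc_derivative:
  "(Fc has_vector_derivative \<i> / 2 * (\<Sum>i\<in>N. \<kappa> s i) * Fc s) (at s within S)"
proof -
  have sb: "(\<Sum>i\<in>N. of_real (\<beta> i)) = (0 :: complex)"
    unfolding of_real_sum[symmetric] sum_eigenvalues by simp
  have nz: "1 - \<i> * of_real s * of_real (\<beta> i) \<notin> \<real>\<^sub>\<le>\<^sub>0" for i
    by (simp add: complex_nonpos_Reals_iff)
  define f where "f = (\<lambda>z. exp ((\<Sum>i\<in>N. psi (\<i> * z * of_real (\<beta> i))) / 2))"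
  have "(f has_field_derivative
      (\<Sum>i\<in>N. - (\<i> * of_real (\<beta> i)) + \<i> * of_real (\<beta> i) / (1 - \<i> * of_real s * of_real (\<beta> i))) / 2
        * exp ((\<Sum>i\<in>N. psi (\<i> * of_real s * of_real (\<beta> i))) / 2)) (at (of_real s))"
  proof -
    have dterm: "((\<lambda>z. psi (\<i> * z * of_real (\<beta> i))) has_field_derivative
        - (\<i> * of_real (\<beta> i)) + \<i> * of_real (\<beta> i) / (1 - \<i> * of_real s * of_real (\<beta> i))) (at (of_real s))" for i
      unfolding psi_def using nz[of i] by (auto intro!: derivative_eq_intros simp: divide_inverse mult.commute)
    have "((\<lambda>z. (\<Sum>i\<in>N. psi (\<i> * z * of_real (\<beta> i))) / 2) has_field_derivative
        (\<Sum>i\<in>N. - (\<i> * of_real (\<beta> i)) + \<i> * of_real (\<beta> i) / (1 - \<i> * of_real s * of_real (\<beta> i))) / 2) (at (of_real s))"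
      by (intro DERIV_cdivide DERIV_sum dterm)
    from DERIV_chain2[OF DERIV_exp this] show ?thesis unfolding f_def by (simp only: mult.commute)
  qed
  moreover have "(\<Sum>i\<in>N. - (\<i> * of_real (\<beta> i)) + \<i> * of_real (\<beta> i) / (1 - \<i> * of_real s * of_real (\<beta> i))) / 2
      = \<i> / 2 * (\<Sum>i\<in>N. \<kappa> s i)"
  proof -
    have "(\<Sum>i\<in>N. \<i> * of_real (\<beta> i) / (1 - \<i> * of_real s * of_real (\<beta> i))) = \<i> * (\<Sum>i\<in>N. \<kappa> s i)"
      by (simp add: \<kappa>_def sum_distrib_left mult.assoc)
    then show ?thesis
      unfolding sum.distrib sum_negf sum_distrib_left[symmetric] sb by simp
  qed
  ultimately have "(f has_field_derivative \<i> / 2 * (\<Sum>i\<in>N. \<kappa> s i) * f (of_real s)) (at (of_real s))"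
    unfolding f_def by simp
  from has_vector_derivative_real_field[OF this]
  have d: "((\<lambda>s. f (of_real s)) has_vector_derivative \<i> / 2 * (\<Sum>i\<in>N. \<kappa> s i) * f (of_real s)) (at s within S)" .
  have fc: "f (of_real s) = Fc s" for s by (simp add: f_def Fc_def mult.assoc)
  show ?thesis using d unfolding fc .
qed

lemma norm_Fc: "cmod (Fc s) = exp (- (\<Sum>i\<in>N. ln (cmod (1 - \<i> * of_real (s * \<beta> i)))) / 2)"
proof -
  have "Re (psi (\<i> * of_real (s * \<beta> i))) = - ln (cmod (1 - \<i> * of_real (s * \<beta> i)))" for i
    unfolding psi_def by (simp del: of_real_mult)
  then show ?thesis
    unfolding Fc_def norm_exp_eq_Re by (simp add: sum_negf del: of_real_mult)
qed

text \<open>By \<open>norm_Fc\<close> the modulus is a product of the factors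
  \<open>cmod (1 - \<i> * (s * \<beta> i))\<close> to the power -1/2, and each such factor increases
  with \<open>s\<close>.\<close>

lemma norm_Fc_ge:
  assumes s: "0 \<le> s" "s \<le> 1"
  shows "cmod (Fc 1) \<le> cmod (Fc s)"
proof -
  have "ln (cmod (1 - \<i> * of_real (s * \<beta> i))) \<le> ln (cmod (1 - \<i> * of_real (1 * \<beta> i)))" for i
  proof -
    have "s\<^sup>2 * (\<beta> i)\<^sup>2 \<le> 1 * (\<beta> i)\<^sup>2" using s by (intro mult_right_mono) (auto simp: power_le_one)
    then have "cmod (1 - \<i> * of_real (s * \<beta> i)) \<le> cmod (1 - \<i> * of_real (1 * \<beta> i))"
      by (simp add: cmod_def power_mult_distrib)
    moreover have "0 < cmod (1 - \<i> * of_real (s * \<beta> i))"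
      using norm_one_minus_i[of "s * \<beta> i"] by linarith
    ultimately show ?thesis by simp
  qed
  then show ?thesis unfolding norm_Fc by (simp add: sum_mono del: of_real_mult)
qed

text \<open>The ends of the path give the two quantities compared: \<open>E 1\<close> is the
  exponential of the form alone, and \<open>E 0\<close> is the damping alone, which the equation
  multiplies by the determinant factor.\<close>

theorem char_quadratic_form:
  "cmod ((\<integral>x. iexp (q x) \<partial>P) - of_real (\<integral>x. exp (- A x / 2) \<partial>P) * exp ((\<Sum>i\<in>N. psi (\<i> * of_real (\<beta> i))) / 2))
    \<le> 9 * T ^ 5 * h * (\<Sum>v\<in>V. ell v) + 2 * d"
proof -
  define K where "K = 9 * T ^ 5 * h * (\<Sum>v\<in>V. ell v) + 2 * d"
  define e where "e s = (\<integral>x. (\<i> * of_real (q x) + of_real (s * A x)) * E s x \<partial>P) - \<i> / 2 * (\<Sum>i\<in>N. \<kappa> s i) * hc s" for s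
  obtain bq where bq: "\<And>x. \<bar>q x\<bar> \<le> bq" using bm_q unfolding bm_def by auto
  obtain bA where bA: "\<And>x. \<bar>A x\<bar> \<le> bA" using bm_A unfolding bm_def by auto
  have bd: "bm (\<lambda>x. (\<i> * of_real (q x) + of_real (s * A x)) * E s x)" if "s \<in> {0..1}" for s
    using that by (intro bm_intros bm_q bm_A bm_E) auto
  have hd: "(hc has_vector_derivative (\<integral>x. (\<i> * of_real (q x) + of_real (s * A x)) * E s x \<partial>P)) (at s within {0..1})"
    if s: "s \<in> {0..1}" for s
    unfolding hc_def
  proof (rule has_vector_derivative_integral_dominated[where K = "\<lambda>_. bq + bA"])
    show "integrable P (\<lambda>_. bq + bA)" by simp
    show "((\<lambda>s. E s x) has_vector_derivative (\<i> * of_real (q x) + of_real (t * A x)) * E t x) (at t within {0..1})" for t x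
      by (rule E_derivative)
    show "integrable P (E t)" if "t \<in> {0..1}" for t using that by (intro bm_integrable bm_E) auto
    show "(\<lambda>x. (\<i> * of_real (q x) + of_real (t * A x)) * E t x) \<in> borel_measurable P" if "t \<in> {0..1}" for t
      using bd[OF that] by (rule bm_measurable)
    fix t x assume t: "t \<in> {0..1::real}"
    have "cmod (\<i> * of_real (q x) + of_real (t * A x)) \<le> \<bar>q x\<bar> + \<bar>t * A x\<bar>"
      by (rule norm_triangle_le) (simp add: norm_mult abs_mult)
    also have "\<bar>t * A x\<bar> \<le> 1 * \<bar>A x\<bar>" unfolding abs_mult using t by (intro mult_right_mono) auto
    finally have "cmod (\<i> * of_real (q x) + of_real (t * A x)) \<le> bq + bA" using bq[of x] bA[of x] by linarith
    from mult_mono[OF this norm_E[of t x]] show "cmod ((\<i> * of_real (q x) + of_real (t * A x)) * E t x) \<le> bq + bA"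
      using t bq[of x] bA[of x] by (simp add: norm_mult)
  qed (use s in auto)
  have ebound: "cmod (e s) \<le> K" if s: "s \<in> {0..1}" for s
  proof -
    have s': "0 \<le> s" "s \<le> 1" using s by auto
    have i1: "integrable P (\<lambda>x. (\<i> * of_real (q x) + of_real (s * A x)) * E s x)" using bd[OF s] by (rule bm_integrable)
    have i2: "integrable P (E s)" using bm_E[OF s'] by (rule bm_integrable)
    have i3: "integrable P (F s v)" if "v \<in> V" for v using bm_F[OF s' that] by (rule bm_integrable)
    have i4: "integrable P (\<lambda>x. R s x * E s x)" using bm_mult[OF bm_R bm_E[OF s']] by (rule bm_integrable)
    have "e s = (\<integral>x. (\<i> * of_real (q x) + of_real (s * A x)) * E s x - \<i> / 2 * (\<Sum>i\<in>N. \<kappa> s i) * E s x \<partial>P)"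
      unfolding e_def hc_def using i1 i2 by (subst Bochner_Integration.integral_diff) auto
    also have "\<dots> = (\<Sum>v\<in>V. \<integral>x. F s v x \<partial>P) + (\<integral>x. R s x * E s x \<partial>P)"
      unfolding derivative_decomposition using i3 i4
      by (subst Bochner_Integration.integral_add) (auto simp: Bochner_Integration.integral_sum)
    finally have es: "e s = (\<Sum>v\<in>V. \<integral>x. F s v x \<partial>P) + (\<integral>x. R s x * E s x \<partial>P)" .
    have "cmod (e s) \<le> (\<Sum>v\<in>V. 9 * T ^ 5 * h * ell v) + 2 * d"
      unfolding es using integral_F s' integral_R[OF s']
      by (intro norm_triangle_le add_mono sum_norm_le) auto
    then show ?thesis by (simp add: K_def sum_distrib_left)
  qed
  have Fnz: "Fc s \<noteq> 0" for s by (simp add: Fc_def)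
  \<comment> \<open>Variation of constants, normalised at the right end: the derivative of
    \<open>g\<close> is \<open>e s * (Fc 1 / Fc s)\<close>, and by \<open>norm_Fc_ge\<close> the
    quotient does not amplify the error.\<close>
  define g where "g s = hc s * (Fc 1 / Fc s)" for s
  have "cmod (g 1 - g 0) \<le> K * \<bar>1 - 0\<bar>"
  proof (rule norm_diff_le_of_vector_derivative[where S = "{0..1}" and f = g and f' = "\<lambda>s. e s * (Fc 1 / Fc s)"])
    fix s :: real assume s: "s \<in> {0..1}"
    have "((\<lambda>s. inverse (Fc s)) has_vector_derivative - (inverse (Fc s) * (\<i> / 2 * (\<Sum>i\<in>N. \<kappa> s i) * Fc s) * inverse (Fc s))) (at s within {0..1})"
      unfolding has_vector_derivative_def
      by (rule has_derivative_eq_rhs[OF Deriv.has_derivative_inverse[where f = Fc and x = s and S = "{0..1}", OF Fnz Fc_derivative[unfolded has_vector_derivative_def]]])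
        (simp add: fun_eq_iff)
    moreover have "inverse (Fc s) * (\<i> / 2 * (\<Sum>i\<in>N. \<kappa> s i) * Fc s) * inverse (Fc s)
        = \<i> / 2 * (\<Sum>i\<in>N. \<kappa> s i) * inverse (Fc s)"
      using Fnz[of s] by simp
    ultimately have "((\<lambda>s. inverse (Fc s)) has_vector_derivative - (\<i> / 2 * (\<Sum>i\<in>N. \<kappa> s i) * inverse (Fc s))) (at s within {0..1})"
      by (simp only:)
    from has_vector_derivative_mult[OF hd[OF s] this]
    moreover have "hc s * - (\<i> / 2 * (\<Sum>i\<in>N. \<kappa> s i) * inverse (Fc s))
        + (\<integral>x. (\<i> * of_real (q x) + of_real (s * A x)) * E s x \<partial>P) * inverse (Fc s) = e s * inverse (Fc s)"
      unfolding e_def left_diff_distrib by (simp only: mult_minus_right mult_ac diff_conv_add_uminus add.commute)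
    ultimately have "((\<lambda>s. hc s * inverse (Fc s)) has_vector_derivative e s * inverse (Fc s)) (at s within {0..1})"
      by (simp only:)
    from has_vector_derivative_mult_right[OF this, of "Fc 1"]
    show "(g has_vector_derivative e s * (Fc 1 / Fc s)) (at s within {0..1})"
      unfolding g_def by (simp add: divide_inverse mult_ac)
    have "cmod (Fc 1 / Fc s) \<le> 1"
      using norm_Fc_ge[of s] s Fnz[of s] by (simp add: norm_divide divide_le_eq)
    from mult_mono[OF ebound[OF s] this] show "cmod (e s * (Fc 1 / Fc s)) \<le> K"
      using order_trans[OF norm_ge_zero ebound[OF s]] unfolding norm_mult[symmetric] by simp
  qed auto
  moreover have "g 1 = hc 1" using Fnz[of 1] by (simp add: g_def)
  moreover have "g 0 = hc 0 * Fc 1"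
  proof -
    have "Fc 0 = 1" by (simp add: Fc_def psi_def)
    then show ?thesis by (simp add: g_def)
  qed
  ultimately have le: "cmod (hc 1 - hc 0 * Fc 1) \<le> K" by simp
  have h1: "hc 1 = (\<integral>x. iexp (q x) \<partial>P)" by (simp add: hc_def E_def)
  have "E 0 = (\<lambda>x. of_real (exp (- A x / 2)))"
    unfolding E_def by (simp add: fun_eq_iff flip: exp_of_real)
  then have h0: "hc 0 = of_real (\<integral>x. exp (- A x / 2) \<partial>P)"
    unfolding hc_def by (simp only: integral_complex_of_real)
  have F1: "Fc 1 = exp ((\<Sum>i\<in>N. psi (\<i> * of_real (\<beta> i))) / 2)" by (simp add: Fc_def)
  show ?thesis using le unfolding h1 h0 F1 K_def .
qed

end
end

section \<open>Centred chi-square variables\<close>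

text \<open>Subtracting the quadratic Taylor term makes \<^term>\<open>psi3\<close> cubic at zero; the eigenvalues are
  \<open>O(1 / sqrt s)\<close>, hence sums of \<^term>\<open>psi3\<close> over them are dominated.\<close>

definition psi3 :: "real \<Rightarrow> complex" where
  "psi3 y = psi (\<i> * of_real y) + of_real (y\<^sup>2 / 2)"

lemma one_minus_imag [simp]: "1 - \<i> * of_real y \<noteq> 0" "1 - \<i> * of_real y \<notin> \<real>\<^sub>\<le>\<^sub>0"
  by (auto simp: complex_eq_iff complex_nonpos_Reals_iff)

lemma psi3_derivative:
  "(psi3 has_vector_derivative - (\<i> * of_real (y\<^sup>2)) / (1 - \<i> * of_real y)) (at y within S)"
proof -
  have "((\<lambda>z. psi (\<i> * z) + z\<^sup>2 / 2) has_field_derivative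
      - \<i> + \<i> / (1 - \<i> * of_real y) + of_real y) (at (of_real y))"
    unfolding psi_def by (auto intro!: derivative_eq_intros simp: field_simps)
  from has_vector_derivative_real_field[OF this]
  have "(psi3 has_vector_derivative - \<i> + \<i> / (1 - \<i> * of_real y) + of_real y) (at y within S)"
    unfolding psi3_def by simp
  moreover have "- \<i> + \<i> / (1 - \<i> * of_real y) + of_real y = - (\<i> * of_real (y\<^sup>2)) / (1 - \<i> * of_real y)"
    by (simp add: field_simps power2_eq_square)
  ultimately show ?thesis by simp
qed

text \<open>The derivative \<open>- \<i> * y\<^sup>2 / (1 - \<i> * y)\<close> has modulus at most
  \<open>y\<^sup>2\<close>, since the denominator has real part one.\<close>

lemma norm_psi3_le: "cmod (psi3 y) \<le> \<bar>y\<bar> ^ 3"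
proof -
  have "cmod (psi3 y - psi3 0) \<le> y\<^sup>2 * \<bar>y - 0\<bar>"
  proof (rule norm_diff_le_of_vector_derivative[of "{- \<bar>y\<bar>..\<bar>y\<bar>}", OF _ psi3_derivative])
    fix t assume "t \<in> {- \<bar>y\<bar>..\<bar>y\<bar>}"
    then have "\<bar>t\<bar> \<le> \<bar>y\<bar>" by auto
    then have t: "t\<^sup>2 \<le> y\<^sup>2" by (simp add: abs_le_square_iff)
    have "1 \<le> cmod (1 - \<i> * of_real t)"
      using abs_Re_le_cmod[of "1 - \<i> * of_real t"] by simp
    then have "cmod (- (\<i> * of_real (t\<^sup>2)) / (1 - \<i> * of_real t)) \<le> t\<^sup>2"
      by (simp add: norm_divide norm_mult norm_power divide_le_eq mult_le_cancel_left1)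
    then show "cmod (- (\<i> * of_real (t\<^sup>2)) / (1 - \<i> * of_real t)) \<le> y\<^sup>2" using t by linarith
  qed auto
  then show ?thesis by (simp add: psi3_def psi_def power2_eq_square power3_eq_cube abs_mult)
qed

lemma continuous_psi3: "isCont psi3 y"
  using has_vector_derivative_continuous[OF psi3_derivative[of y UNIV]] by simp

section \<open>The square of a standard normal variable\<close>

lemma gauss_derivative:
  fixes k w z :: complex
  shows "((\<lambda>z. k * (z * exp (w * z\<^sup>2 / 2))) has_field_derivative
    k * ((1 + w * z\<^sup>2) * exp (w * z\<^sup>2 / 2))) (at z)"
proof -
  have "((\<lambda>z. w * z\<^sup>2 / 2) has_field_derivative w * z) (at z)"
    by (auto intro!: derivative_eq_intros)
  note d = DERIV_chain2[OF DERIV_exp this]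
  have "((\<lambda>z. z * exp (w * z\<^sup>2 / 2)) has_field_derivative
      1 * exp (w * z\<^sup>2 / 2) + exp (w * z\<^sup>2 / 2) * (w * z) * z) (at z)"
    by (rule DERIV_mult[OF DERIV_ident d])
  from DERIV_cmult[OF this, of k] show ?thesis
    by (simp add: algebra_simps power2_eq_square)
qed

text \<open>With the normal density included, the integrand is the derivative of
  \<open>x * iexp (r * (x\<^sup>2 / 2))\<close> times the density, which vanishes at both
  ends.\<close>

lemma gaussian_by_parts:
  "(\<integral>x. (1 + (\<i> * of_real r - 1) * of_real (x\<^sup>2)) * iexp (r * (x\<^sup>2 / 2)) \<partial>std_normal_distribution) = 0"
proof -
  let ?d = std_normal_density
  define f where "f x = ?d x *\<^sub>R ((1 + (\<i> * of_real r - 1) * of_real (x\<^sup>2)) * iexp (r * (x\<^sup>2 / 2)))" for x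
  define F where "F x = ?d x *\<^sub>R (of_real x * iexp (r * (x\<^sup>2 / 2)))" for x
  have Fd: "(F has_vector_derivative f x) (at x)" for x
  proof -
    have e: "?d x = (1 / sqrt (2 * pi)) * exp (- x\<^sup>2 / 2)" for x by (rule std_normal_density_def)
    have F_eq: "F = (\<lambda>x. of_real (1 / sqrt (2 * pi)) * (of_real x * exp ((\<i> * of_real r - 1) * (of_real x)\<^sup>2 / 2)))"
    proof
      fix x
      have "of_real (exp (- x\<^sup>2 / 2)) * iexp (r * (x\<^sup>2 / 2)) = exp ((\<i> * of_real r - 1) * (of_real x)\<^sup>2 / 2)"
        unfolding exp_of_real[symmetric] exp_add[symmetric] by (simp add: field_simps)
      then show "F x = of_real (1 / sqrt (2 * pi)) * (of_real x * exp ((\<i> * of_real r - 1) * (of_real x)\<^sup>2 / 2))"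
        unfolding F_def e scaleR_conv_of_real by (simp add: mult_ac)
    qed
    have f_eq: "f x = of_real (1 / sqrt (2 * pi)) * ((1 + (\<i> * of_real r - 1) * (of_real x)\<^sup>2) * exp ((\<i> * of_real r - 1) * (of_real x)\<^sup>2 / 2))"
    proof -
      have "of_real (exp (- x\<^sup>2 / 2)) * iexp (r * (x\<^sup>2 / 2)) = exp ((\<i> * of_real r - 1) * (of_real x)\<^sup>2 / 2)"
        unfolding exp_of_real[symmetric] exp_add[symmetric] by (simp add: field_simps)
      then show ?thesis
        unfolding f_def e scaleR_conv_of_real by (simp add: mult_ac)
    qed
    have "((\<lambda>z. of_real (1 / sqrt (2 * pi)) * (z * exp ((\<i> * of_real r - 1) * z\<^sup>2 / 2))) has_field_derivative f x) (at (of_real x))"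
      unfolding f_eq by (rule gauss_derivative)
    from has_vector_derivative_real_field[OF this] show ?thesis unfolding F_eq .
  qed
  have int: "integrable lborel f"
  proof -
    have m: "integrable std_normal_distribution (\<lambda>x. 1 + cmod (\<i> * of_real r - 1) * x\<^sup>2)"
      using integrable_std_normal_distribution_moment[of 0] integrable_std_normal_distribution_moment[of 2] by simp
    have "integrable std_normal_distribution (\<lambda>x. (1 + (\<i> * of_real r - 1) * of_real (x\<^sup>2)) * iexp (r * (x\<^sup>2 / 2)))"
    proof (rule Bochner_Integration.integrable_bound[OF m])
      show "AE x in std_normal_distribution. cmod ((1 + (\<i> * of_real r - 1) * of_real (x\<^sup>2)) * iexp (r * (x\<^sup>2 / 2)))
          \<le> norm (1 + cmod (\<i> * of_real r - 1) * x\<^sup>2)"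
      proof (rule AE_I2)
        fix x
        have "cmod (1 + (\<i> * of_real r - 1) * of_real (x\<^sup>2)) \<le> 1 + cmod (\<i> * of_real r - 1) * x\<^sup>2"
          by (rule order_trans[OF norm_triangle_ineq]) (simp add: norm_mult norm_power)
        then show "cmod ((1 + (\<i> * of_real r - 1) * of_real (x\<^sup>2)) * iexp (r * (x\<^sup>2 / 2)))
          \<le> norm (1 + cmod (\<i> * of_real r - 1) * x\<^sup>2)"
          by (simp add: norm_mult)
      qed
    qed measurable
    then show ?thesis
      unfolding f_def by (subst (asm) integrable_density) (auto simp: normal_density_nonneg)
  qed
  have lim: "(F \<longlongrightarrow> 0) at_top" "(F \<longlongrightarrow> 0) at_bot"
  proof -
    have n: "norm (F x) = \<bar>x\<bar> * (1 / sqrt (2 * pi) * exp (- x\<^sup>2 / 2))" for x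
      unfolding F_def std_normal_density_def by (simp add: norm_mult)
    have "((\<lambda>x::real. \<bar>x\<bar> * (1 / sqrt (2 * pi) * exp (- x\<^sup>2 / 2))) \<longlongrightarrow> 0) at_top"
      by real_asymp
    then show "(F \<longlongrightarrow> 0) at_top" unfolding n[symmetric] by (rule tendsto_norm_zero_cancel)
    have "((\<lambda>x::real. \<bar>x\<bar> * (1 / sqrt (2 * pi) * exp (- x\<^sup>2 / 2))) \<longlongrightarrow> 0) at_bot"
      by real_asymp
    then show "(F \<longlongrightarrow> 0) at_bot" unfolding n[symmetric] by (rule tendsto_norm_zero_cancel)
  qed
  have fc: "isCont f x" for x
    unfolding f_def std_normal_density_def by (intro continuous_intros) auto
  have "(LBINT x=-\<infinity>..\<infinity>. f x) = 0 - 0"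
  proof (rule interval_integral_FTC_integrable[where F = F])
    show "(F has_vector_derivative f x) (at x)" for x by (rule Fd)
    show "isCont f x" for x by (rule fc)
    show "set_integrable lborel (einterval (-\<infinity>) \<infinity>) f"
      using int by (simp add: einterval_def set_integrable_def)
    show "((F \<circ> real_of_ereal) \<longlongrightarrow> 0) (at_right (-\<infinity>))" "((F \<circ> real_of_ereal) \<longlongrightarrow> 0) (at_left \<infinity>)"
      using lim by (simp_all add: ereal_tendsto_simps)
  qed simp
  then have "integral\<^sup>L lborel f = 0"
    by (simp add: interval_lebesgue_integral_def einterval_def set_lebesgue_integral_def)
  then show ?thesis
    unfolding f_def by (subst integral_density) (auto simp: normal_density_nonneg)
qed

text \<open>Integration by parts turns the derivative in \<open>r\<close> into a multiple of the
  function itself, namely by \<open>\<i> / 2 / (1 - \<i> * r)\<close>. Hence the product with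
  \<open>H\<close>, the reciprocal of the claimed value, is constant; no contour has to be
  shifted.\<close>

lemma char_square_std_normal:
  "(\<integral>x. iexp (r * (x\<^sup>2 / 2)) \<partial>std_normal_distribution) = exp (- Ln (1 - \<i> * of_real r) / 2)"
proof -
  interpret real_distribution std_normal_distribution by (rule real_dist_normal_dist)
  define \<phi> where "\<phi> r = (\<integral>x. iexp (r * (x\<^sup>2 / 2)) \<partial>std_normal_distribution)" for r
  define W where "W r = (\<integral>x. of_real (x\<^sup>2) * iexp (r * (x\<^sup>2 / 2)) \<partial>std_normal_distribution)" for r
  define H where "H r = exp (Ln (1 - \<i> * of_real r) / 2)" for r
  have i0: "integrable std_normal_distribution (\<lambda>x. iexp (r * (x\<^sup>2 / 2)))" for r
    by (intro integrable_const_bound[of _ 1]) auto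
  have m2: "integrable std_normal_distribution (\<lambda>x. x\<^sup>2)" by (rule integrable_std_normal_distribution_moment)
  have i2: "integrable std_normal_distribution (\<lambda>x. of_real (x\<^sup>2) * iexp (r * (x\<^sup>2 / 2)))" for r
    by (rule Bochner_Integration.integrable_bound[OF m2]) (auto simp: norm_mult norm_power)
  have W: "W r = \<phi> r / (1 - \<i> * of_real r)" for r
  proof -
    have "(\<integral>x. (1 + (\<i> * of_real r - 1) * of_real (x\<^sup>2)) * iexp (r * (x\<^sup>2 / 2)) \<partial>std_normal_distribution)
      = (\<integral>x. iexp (r * (x\<^sup>2 / 2)) + (\<i> * of_real r - 1) * (of_real (x\<^sup>2) * iexp (r * (x\<^sup>2 / 2))) \<partial>std_normal_distribution)"
      by (simp add: algebra_simps)
    also have "\<dots> = \<phi> r + (\<i> * of_real r - 1) * W r"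
      unfolding \<phi>_def W_def using i0 i2
      by (subst Bochner_Integration.integral_add) (auto simp del: of_real_power)
    finally have "\<phi> r + (\<i> * of_real r - 1) * W r = 0" using gaussian_by_parts by simp
    then have "W r * (1 - \<i> * of_real r) = \<phi> r" by (simp add: algebra_simps)
    then show ?thesis by (simp add: nonzero_eq_divide_eq)
  qed
  have \<phi>d: "(\<phi> has_vector_derivative \<i> / 2 * W r) (at r within UNIV)" for r
  proof -
    have "(\<phi> has_vector_derivative (\<integral>x. \<i> / 2 * (of_real (x\<^sup>2) * iexp (r * (x\<^sup>2 / 2))) \<partial>std_normal_distribution)) (at r within UNIV)"
      unfolding \<phi>_def
    proof (rule has_vector_derivative_integral_dominated[where K = "\<lambda>x. x\<^sup>2"])
      fix t x
      have "((\<lambda>z. exp (\<i> * (z * of_real (x\<^sup>2 / 2)))) has_field_derivative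
        \<i> / 2 * (of_real (x\<^sup>2) * exp (\<i> * (of_real t * of_real (x\<^sup>2 / 2))))) (at (of_real t))"
        by (rule derivative_eq_intros refl | simp add: mult_ac)+
      from has_vector_derivative_real_field[OF this]
      show "((\<lambda>t. iexp (t * (x\<^sup>2 / 2))) has_vector_derivative \<i> / 2 * (of_real (x\<^sup>2) * iexp (t * (x\<^sup>2 / 2)))) (at t within UNIV)"
        by (simp del: of_real_power)
    qed (use i0 m2 in \<open>auto simp: norm_mult norm_power\<close>)
    then show ?thesis unfolding W_def using i2 by simp
  qed
  have Hd: "(H has_vector_derivative - (\<i> / 2) / (1 - \<i> * of_real r) * H r) (at r within UNIV)" for r
  proof -
    have "((\<lambda>z. exp (Ln (1 - \<i> * z) / 2)) has_field_derivative
      - (\<i> / 2) / (1 - \<i> * of_real r) * exp (Ln (1 - \<i> * of_real r) / 2)) (at (of_real r))"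
      by (rule derivative_eq_intros refl | simp add: field_simps)+
    from has_vector_derivative_real_field[OF this] show ?thesis unfolding H_def .
  qed
  have "((\<lambda>r. \<phi> r * H r) has_vector_derivative 0) (at r within UNIV)" for r
    using has_vector_derivative_mult[OF \<phi>d[of r] Hd[of r]] by (simp add: W algebra_simps)
  then have "\<phi> r * H r = \<phi> 0 * H 0"
    using norm_diff_le_of_vector_derivative[of UNIV "\<lambda>r. \<phi> r * H r" "\<lambda>_. 0" 0 r 0] by simp
  also have "\<dots> = 1" unfolding \<phi>_def H_def using prob_space by simp
  finally have "\<phi> r * exp (Ln (1 - \<i> * of_real r) / 2) = 1" unfolding H_def .
  then show ?thesis unfolding \<phi>_def by (simp add: exp_minus field_simps)
qed

lemma char_centered_square_std_normal:
  "(\<integral>x. iexp (r * (x\<^sup>2 - 1) / 2) \<partial>std_normal_distribution) = exp (psi (\<i> * of_real r) / 2)"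
proof -
  have "iexp (r * (x\<^sup>2 - 1) / 2) = exp (- (\<i> * of_real r) / 2) * iexp (r * (x\<^sup>2 / 2))" for x
    unfolding exp_add[symmetric] by (simp add: field_simps)
  then have "(\<integral>x. iexp (r * (x\<^sup>2 - 1) / 2) \<partial>std_normal_distribution) = exp (- (\<i> * of_real r) / 2) * (\<integral>x. iexp (r * (x\<^sup>2 / 2)) \<partial>std_normal_distribution)"
    by simp
  then show ?thesis
    unfolding char_square_std_normal exp_add[symmetric] psi_def by (simp add: field_simps)
qed

section \<open>Truncation and deletion of edges\<close>

text \<open>The second claim is the nonnegativity of the variance of
  \<open>\<bar>f x\<bar>\<close>.\<close>

lemma (in prob_space) integral_abs_le_sqrt:
  fixes f :: "'a \<Rightarrow> real"
  assumes f: "f \<in> borel_measurable M" and f2: "integrable M (\<lambda>x. (f x)\<^sup>2)"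
  shows "integrable M f" "(\<integral>x. \<bar>f x\<bar> \<partial>M) \<le> sqrt (\<integral>x. (f x)\<^sup>2 \<partial>M)"
proof -
  show i: "integrable M f" using f f2 by (rule square_integrable_imp_integrable)
  define a where "a = (\<integral>x. \<bar>f x\<bar> \<partial>M)"
  have "0 \<le> (\<integral>x. (\<bar>f x\<bar> - a)\<^sup>2 \<partial>M)" by simp
  also have "\<dots> = (\<integral>x. (f x)\<^sup>2 - 2 * a * \<bar>f x\<bar> + a\<^sup>2 \<partial>M)"
    by (simp add: power2_diff algebra_simps)
  also have "\<dots> = (\<integral>x. (f x)\<^sup>2 \<partial>M) - a\<^sup>2"
    using i f2 by (simp add: a_def[symmetric] prob_space power2_eq_square)
  finally show "(\<integral>x. \<bar>f x\<bar> \<partial>M) \<le> sqrt (\<integral>x. (f x)\<^sup>2 \<partial>M)"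
    unfolding a_def[symmetric] by (intro real_le_rsqrt) simp
qed

lemma (in prob_space) norm_integral_iexp_diff_le:
  fixes f g :: "'a \<Rightarrow> real"
  assumes [measurable]: "f \<in> borel_measurable M" "g \<in> borel_measurable M"
    and i: "integrable M (\<lambda>x. f x - g x)"
  shows "cmod ((\<integral>x. iexp (f x) \<partial>M) - (\<integral>x. iexp (g x) \<partial>M)) \<le> (\<integral>x. \<bar>f x - g x\<bar> \<partial>M)"
proof -
  have bi: "integrable M (\<lambda>x. iexp (f x))" "integrable M (\<lambda>x. iexp (g x))"
    by (rule integrable_const_bound[of _ 1]; simp)+
  have "cmod ((\<integral>x. iexp (f x) \<partial>M) - (\<integral>x. iexp (g x) \<partial>M)) = cmod (\<integral>x. iexp (f x) - iexp (g x) \<partial>M)"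
    using bi by simp
  also have "\<dots> \<le> (\<integral>x. cmod (iexp (f x) - iexp (g x)) \<partial>M)" by (rule integral_norm_bound)
  also have "\<dots> \<le> (\<integral>x. \<bar>f x - g x\<bar> \<partial>M)"
  proof (rule integral_mono)
    show "integrable M (\<lambda>x. cmod (iexp (f x) - iexp (g x)))"
      using bi by (intro integrable_norm Bochner_Integration.integrable_diff)
    show "integrable M (\<lambda>x. \<bar>f x - g x\<bar>)" using i by (rule integrable_abs)
    fix x
    have "iexp (f x) - iexp (g x) = iexp (g x) * (iexp (f x - g x) - 1)"
      by (simp add: algebra_simps exp_add[symmetric])
    then have "cmod (iexp (f x) - iexp (g x)) = cmod (iexp (f x - g x) - 1)"
      by (simp add: norm_mult)
    then show "cmod (iexp (f x) - iexp (g x)) \<le> \<bar>f x - g x\<bar>"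
      using norm_iexp_minus_1[of "f x - g x"] by simp
  qed
  finally show ?thesis .
qed

locale bounded_iid_sq = bounded_iid \<mu> \<xi> T I for \<mu> \<xi> T and I :: "nat set" +
  assumes sq_int: "integrable \<mu> (\<lambda>x. x\<^sup>2)" and mu_mean: "(\<integral>x. x \<partial>\<mu>) = 0" and mu_var: "(\<integral>x. x\<^sup>2 \<partial>\<mu>) = 1"
begin

text \<open>The correlation of a variable with its truncation, both being standardised. A product of
  two distinct variables has correlation \<open>kap\<^sup>2\<close> with the truncated product, so
  \<open>1 - kap\<^sup>2\<close> measures the cost per edge.\<close>

definition kap :: real where "kap = (\<integral>x. x * \<xi> x \<partial>\<mu>)"

lemma id_meas [measurable]: "(\<lambda>x. x) \<in> borel_measurable \<mu>"
  by measurable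

lemma int_id: "integrable \<mu> (\<lambda>x. x)"
  by (rule mu.square_integrable_imp_integrable[OF id_meas sq_int])

lemma int_xi: "integrable \<mu> \<xi>" "integrable \<mu> (\<lambda>x. (\<xi> x)\<^sup>2)"
proof -
  show "integrable \<mu> \<xi>" using xi_bound by (intro mu.integrable_const_bound[of _ T]) auto
  show "integrable \<mu> (\<lambda>x. (\<xi> x)\<^sup>2)"
    using xi_abs_power[of _ 2] by (intro mu.integrable_const_bound[of _ "T\<^sup>2"]) auto
qed

lemma int_cross: "integrable \<mu> (\<lambda>x. x * \<xi> x)"
proof (rule Bochner_Integration.integrable_bound[OF integrable_mult_right[OF int_id, of T]])
  show "AE x in \<mu>. norm (x * \<xi> x) \<le> norm (T * x)"
  proof (rule AE_I2)
    fix x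
    have "\<bar>x\<bar> * \<bar>\<xi> x\<bar> \<le> \<bar>x\<bar> * \<bar>T\<bar>"
      using order_trans[OF xi_bound abs_ge_self] by (intro mult_left_mono) auto
    then show "norm (x * \<xi> x) \<le> norm (T * x)" by (simp add: abs_mult mult.commute)
  qed
qed auto

lemma pair_product:
  fixes f g :: "real \<Rightarrow> real"
  assumes uv: "u \<in> I" "v \<in> I" "u \<noteq> v" and f: "integrable \<mu> f" and g: "integrable \<mu> g"
  shows "integrable P (\<lambda>x. f (x u) * g (x v))"
    "(\<integral>x. f (x u) * g (x v) \<partial>P) = (\<integral>z. f z \<partial>\<mu>) * (\<integral>z. g z \<partial>\<mu>)"
proof -
  define k where "k i = (if i = u then f else if i = v then g else (\<lambda>_. 1))" for i
  have k: "integrable \<mu> (k i)" for i using f g by (simp add: k_def)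
  have split: "(\<Prod>i\<in>I. h i) = h u * h v * (\<Prod>i\<in>I - {u} - {v}. h i)" for h :: "nat \<Rightarrow> real"
    using uv fin by (simp add: prod.remove[of I u] prod.remove[of "I - {u}" v])
  have p: "(\<Prod>i\<in>I. k i (x i)) = f (x u) * g (x v)" for x
    unfolding split[of "\<lambda>i. k i (x i)"] using uv by (simp add: k_def)
  have "(\<Prod>i\<in>I. \<integral>z. k i z \<partial>\<mu>) = (\<integral>z. f z \<partial>\<mu>) * (\<integral>z. g z \<partial>\<mu>)"
    unfolding split using uv by (simp add: k_def mu.prob_space)
  then show "integrable P (\<lambda>x. f (x u) * g (x v))"
    "(\<integral>x. f (x u) * g (x v) \<partial>P) = (\<integral>z. f z \<partial>\<mu>) * (\<integral>z. g z \<partial>\<mu>)"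
    using prod.product_integrable_prod[of I k] prod.product_integral_prod[of I k] k fin unfolding p by auto
qed

lemma integral_zero_coordinate:
  fixes f :: "(nat \<Rightarrow> real) \<Rightarrow> real"
  assumes "k \<in> I" "integrable P f" "\<And>x. (\<integral>z. f (x(k := z)) \<partial>\<mu>) = 0"
  shows "(\<integral>x. f x \<partial>P) = 0"
proof -
  have I: "insert k (I - {k}) = I" using assms by auto
  show ?thesis
    using prod.product_integral_insert[of "I - {k}" k f] assms fin unfolding I by simp
qed

text \<open>What one edge contributes to the difference of the two forms. The two weights are kept
  apart so that a deleted edge is the case \<open>b = 0\<close>, and truncation and deletion are
  estimated together.\<close>

definition W :: "real \<Rightarrow> real \<Rightarrow> nat \<times> nat \<Rightarrow> (nat \<Rightarrow> real) \<Rightarrow> real" where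
  "W a b e x = a * (x (fst e) * x (snd e)) - b * (y (fst e) x * y (snd e) x)"

lemma W_measurable:
  assumes "fst e \<in> I" "snd e \<in> I"
  shows "W a b e \<in> borel_measurable P"
  using assms unfolding W_def y_def by measurable

lemma W_square:
  assumes e: "fst e \<in> I" "snd e \<in> I" "fst e \<noteq> snd e"
  shows "integrable P (\<lambda>x. (W a b e x)\<^sup>2)"
    "(\<integral>x. (W a b e x)\<^sup>2 \<partial>P) = a\<^sup>2 - 2 * a * b * kap\<^sup>2 + b\<^sup>2"
proof -
  note 1 = pair_product[OF e sq_int sq_int] and 2 = pair_product[OF e int_cross int_cross]
    and 3 = pair_product[OF e int_xi(2) int_xi(2)]
  have eq: "(W a b e x)\<^sup>2 = a\<^sup>2 * ((x (fst e))\<^sup>2 * (x (snd e))\<^sup>2)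
     - 2 * a * b * ((x (fst e) * \<xi> (x (fst e))) * (x (snd e) * \<xi> (x (snd e))))
     + b\<^sup>2 * ((\<xi> (x (fst e)))\<^sup>2 * (\<xi> (x (snd e)))\<^sup>2)" for x
    unfolding W_def y_def by (simp add: power2_eq_square algebra_simps)
  show "integrable P (\<lambda>x. (W a b e x)\<^sup>2)" unfolding eq using 1(1) 2(1) 3(1) by simp
  show "(\<integral>x. (W a b e x)\<^sup>2 \<partial>P) = a\<^sup>2 - 2 * a * b * kap\<^sup>2 + b\<^sup>2"
    unfolding eq using 1 2 3 by (simp add: mu_var xi_var kap_def[symmetric] power2_eq_square[of kap])
qed

text \<open>Two different increasing pairs differ as vertex sets, so some endpoint of
  \<open>e\<close> is missing from \<open>e'\<close>. As a function of that coordinate the product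
  is a combination of \<open>z\<close> and \<open>\<xi> z\<close>, both centred.\<close>

lemma W_orth:
  assumes e: "fst e \<in> I" "snd e \<in> I" "fst e < snd e" and e': "fst e' \<in> I" "snd e' \<in> I" "fst e' < snd e'"
    and ne: "e \<noteq> e'"
  shows "integrable P (\<lambda>x. W a b e x * W a' b' e' x)" "(\<integral>x. W a b e x * W a' b' e' x \<partial>P) = 0"
proof -
  have sq: "integrable P (\<lambda>x. (W a b e x)\<^sup>2)" "integrable P (\<lambda>x. (W a' b' e' x)\<^sup>2)"
    using e e' by (auto intro: W_square(1))
  show i: "integrable P (\<lambda>x. W a b e x * W a' b' e' x)"
  proof (rule Bochner_Integration.integrable_bound[OF Bochner_Integration.integrable_add[OF sq]])
    show "(\<lambda>x. W a b e x * W a' b' e' x) \<in> borel_measurable P"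
      using W_measurable[OF e(1,2)] W_measurable[OF e'(1,2)] by measurable
    have "\<bar>p * r\<bar> \<le> p\<^sup>2 + r\<^sup>2" for p r :: real
    proof -
      have "0 \<le> (\<bar>p\<bar> - \<bar>r\<bar>)\<^sup>2" by simp
      then have "2 * (\<bar>p\<bar> * \<bar>r\<bar>) \<le> p\<^sup>2 + r\<^sup>2" by (simp add: power2_diff algebra_simps)
      moreover have "0 \<le> \<bar>p\<bar> * \<bar>r\<bar>" by simp
      ultimately show ?thesis unfolding abs_mult by linarith
    qed
    then show "AE x in P. norm (W a b e x * W a' b' e' x) \<le> norm ((W a b e x)\<^sup>2 + (W a' b' e' x)\<^sup>2)"
      by (intro AE_I2) (simp add: abs_of_nonneg)
  qed
  have "fst e \<notin> {fst e', snd e'} \<or> snd e \<notin> {fst e', snd e'}"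
    using ne e(3) e'(3) by (auto simp: prod_eq_iff)
  then show "(\<integral>x. W a b e x * W a' b' e' x \<partial>P) = 0"
  proof
    assume k: "fst e \<notin> {fst e', snd e'}"
    show ?thesis
    proof (rule integral_zero_coordinate[OF e(1) i])
      fix x
      have "W a b e (x(fst e := z)) * W a' b' e' (x(fst e := z))
        = (a * x (snd e) * W a' b' e' x) * z - (b * y (snd e) x * W a' b' e' x) * \<xi> z" for z
        using k e(3) by (simp add: W_def y_def algebra_simps)
      then show "(\<integral>z. W a b e (x(fst e := z)) * W a' b' e' (x(fst e := z)) \<partial>\<mu>) = 0"
        using int_id int_xi(1) by (simp add: mu_mean xi_mean)
    qed
  next
    assume k: "snd e \<notin> {fst e', snd e'}"
    show ?thesis
    proof (rule integral_zero_coordinate[OF e(2) i])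
      fix x
      have "W a b e (x(snd e := z)) * W a' b' e' (x(snd e := z))
        = (a * x (fst e) * W a' b' e' x) * z - (b * y (fst e) x * W a' b' e' x) * \<xi> z" for z
        using k e(3) by (simp add: W_def y_def algebra_simps)
      then show "(\<integral>z. W a b e (x(snd e := z)) * W a' b' e' (x(snd e := z)) \<partial>\<mu>) = 0"
        using int_id int_xi(1) by (simp add: mu_mean xi_mean)
    qed
  qed
qed

text \<open>The \<open>L\<^sup>1\<close> distance of the two forms bounds the difference of the
  characteristic functions, and orthogonality computes the \<open>L\<^sup>2\<close> distance
  exactly, using second moments of the original variables only.\<close>

lemma truncation_error:
  fixes D :: "(nat \<times> nat) set" and a b :: "nat \<times> nat \<Rightarrow> real"
  assumes D: "finite D" "\<And>e. e \<in> D \<Longrightarrow> fst e \<in> I \<and> snd e \<in> I \<and> fst e < snd e"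
  shows "cmod ((\<integral>x. iexp (\<Sum>e\<in>D. a e * (x (fst e) * x (snd e))) \<partial>P)
      - (\<integral>x. iexp (\<Sum>e\<in>D. b e * (y (fst e) x * y (snd e) x)) \<partial>P))
    \<le> sqrt (\<Sum>e\<in>D. (a e)\<^sup>2 - 2 * a e * b e * kap\<^sup>2 + (b e)\<^sup>2)"
proof -
  let ?S = "\<lambda>x. \<Sum>e\<in>D. a e * (x (fst e) * x (snd e))" and ?S' = "\<lambda>x. \<Sum>e\<in>D. b e * (y (fst e) x * y (snd e) x)"
  let ?w = "\<lambda>e. W (a e) (b e) e"
  have diff: "?S x - ?S' x = (\<Sum>e\<in>D. ?w e x)" for x
    unfolding W_def by (simp add: sum_subtractf)
  have wi: "integrable P (\<lambda>x. ?w e x * ?w e' x)" if "e \<in> D" "e' \<in> D" for e e'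
    using that D(2)[OF that(1)] D(2)[OF that(2)] W_orth(1)[of e e'] W_square(1)[of e]
    by (cases "e = e'") (auto simp: power2_eq_square)
  have sq: "(\<Sum>e\<in>D. ?w e x)\<^sup>2 = (\<Sum>e\<in>D. \<Sum>e'\<in>D. ?w e x * ?w e' x)" for x
    by (simp add: power2_eq_square sum_product)
  have isq: "integrable P (\<lambda>x. (\<Sum>e\<in>D. ?w e x)\<^sup>2)"
    unfolding sq using wi by simp
  have "(\<integral>x. (\<Sum>e\<in>D. ?w e x)\<^sup>2 \<partial>P) = (\<Sum>e\<in>D. \<Sum>e'\<in>D. \<integral>x. ?w e x * ?w e' x \<partial>P)"
    unfolding sq using wi by (simp add: Bochner_Integration.integral_sum)
  also have "\<dots> = (\<Sum>e\<in>D. \<Sum>e'\<in>D. if e = e' then (a e)\<^sup>2 - 2 * a e * b e * kap\<^sup>2 + (b e)\<^sup>2 else 0)"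
  proof (intro sum.cong refl)
    fix e e' assume "e \<in> D" "e' \<in> D"
    then show "(\<integral>x. ?w e x * ?w e' x \<partial>P) = (if e = e' then (a e)\<^sup>2 - 2 * a e * b e * kap\<^sup>2 + (b e)\<^sup>2 else 0)"
      using D(2)[of e] D(2)[of e'] W_orth(2)[of e e'] W_square(2)[of e] by (auto simp: power2_eq_square)
  qed
  also have "\<dots> = (\<Sum>e\<in>D. (a e)\<^sup>2 - 2 * a e * b e * kap\<^sup>2 + (b e)\<^sup>2)" using D(1) by simp
  finally have val: "(\<integral>x. (\<Sum>e\<in>D. ?w e x)\<^sup>2 \<partial>P) = \<dots>" .
  have wm: "(\<lambda>x. \<Sum>e\<in>D. ?w e x) \<in> borel_measurable P"
    by (intro borel_measurable_sum W_measurable) (use D(2) in auto)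
  have co: "(\<lambda>x. x i) \<in> borel_measurable P" "(\<lambda>x. y i x) \<in> borel_measurable P" if "i \<in> I" for i
    using that unfolding y_def by measurable
  have m: "?S \<in> borel_measurable P" "?S' \<in> borel_measurable P"
    by (intro borel_measurable_sum borel_measurable_times borel_measurable_const co; use D(2) in blast)+
  have idiff: "integrable P (\<lambda>x. ?S x - ?S' x)"
    unfolding diff using wm isq by (rule prod.P.integral_abs_le_sqrt(1))
  have "cmod ((\<integral>x. iexp (?S x) \<partial>P) - (\<integral>x. iexp (?S' x) \<partial>P)) \<le> (\<integral>x. \<bar>?S x - ?S' x\<bar> \<partial>P)"
    using m idiff by (rule prod.P.norm_integral_iexp_diff_le)
  also have "\<dots> \<le> sqrt (\<integral>x. (\<Sum>e\<in>D. ?w e x)\<^sup>2 \<partial>P)"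
    unfolding diff using wm isq by (rule prod.P.integral_abs_le_sqrt(2))
  finally show ?thesis unfolding val .
qed

end

section \<open>Graphs with sorted degrees\<close>

lemma sum_symmetric_off_diagonal:
  fixes f :: "'a::linorder \<Rightarrow> 'a \<Rightarrow> real"
  assumes "finite V" "\<And>v w. v \<in> V \<Longrightarrow> w \<in> V \<Longrightarrow> f v w = f w v" "\<And>v. v \<in> V \<Longrightarrow> f v v = 0"
  shows "(\<Sum>v\<in>V. \<Sum>w\<in>V. f v w) = 2 * (\<Sum>v\<in>V. \<Sum>w\<in>V. if v < w then f v w else 0)"
proof -
  have "(\<Sum>v\<in>V. \<Sum>w\<in>V. f v w)
      = (\<Sum>v\<in>V. \<Sum>w\<in>V. (if v < w then f v w else 0) + (if w < v then f w v else 0))"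
    using assms by (intro sum.cong refl) (auto simp: not_less order_le_less)
  also have "\<dots> = (\<Sum>v\<in>V. \<Sum>w\<in>V. if v < w then f v w else 0) + (\<Sum>v\<in>V. \<Sum>w\<in>V. if w < v then f w v else 0)"
    by (simp add: sum.distrib)
  also have "(\<Sum>v\<in>V. \<Sum>w\<in>V. if w < v then f w v else 0) = (\<Sum>v\<in>V. \<Sum>w\<in>V. if v < w then f v w else 0)"
    by (rule sum.swap)
  finally show ?thesis by simp
qed

locale ordered_graph =
  fixes n :: nat and E :: "nat \<Rightarrow> nat \<Rightarrow> bool"
  assumes cls: "in_graph_class n E" and pos: "0 < num_edges n E"
begin

abbreviation a :: "nat \<Rightarrow> nat \<Rightarrow> real" where "a \<equiv> adj E"
definition m :: real where "m = real (num_edges n E)"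
definition deg :: "nat \<Rightarrow> real" where "deg s = (\<Sum>v\<in>{1..n}. a s v)"

lemma m_pos: "0 < m" using pos by (simp add: m_def)

lemma a_sym: "a u v = a v u"
  using cls by (auto simp: in_graph_class_def simple_graph_on_def adj_def)

lemma a_diag [simp]: "a u u = 0"
  using cls by (auto simp: in_graph_class_def simple_graph_on_def adj_def)

lemma a_nonneg [simp]: "0 \<le> a u v" and a_le_1 [simp]: "a u v \<le> 1" and a_sq [simp]: "(a u v)\<^sup>2 = a u v" "a u v * a u v = a u v"
  by (auto simp: adj_def)

lemma edges_sum: "(\<Sum>u\<in>{1..n}. \<Sum>v\<in>{u<..n}. a u v) = m"
proof -
  have "(\<Sum>u\<in>{1..n}. \<Sum>v\<in>{u<..n}. a u v) = (\<Sum>e\<in>Sigma {1..n} (\<lambda>u. {u<..n}). if E (fst e) (snd e) then 1 else 0)"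
    by (simp add: sum.Sigma adj_def case_prod_beta)
  also have "\<dots> = real (card {e \<in> Sigma {1..n} (\<lambda>u. {u<..n}). E (fst e) (snd e)})"
    by (simp add: sum.If_cases Int_def)
  also have "{e \<in> Sigma {1..n} (\<lambda>u. {u<..n}). E (fst e) (snd e)} = {(u, v). 1 \<le> u \<and> u < v \<and> v \<le> n \<and> E u v}"
    by auto
  finally show ?thesis by (simp add: m_def num_edges_def)
qed

lemma sum_greater: "(\<Sum>v\<in>{u<..n}. f v) = (\<Sum>v\<in>{1..n}. if u < v then f v else (0::real))"
proof -
  have "(\<Sum>v\<in>{u<..n}. f v) = (\<Sum>v\<in>{u<..n}. if u < v then f v else 0)" by (intro sum.cong) auto
  also have "\<dots> = (\<Sum>v\<in>{1..n}. if u < v then f v else 0)"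
    by (intro sum.mono_neutral_left) auto
  finally show ?thesis .
qed

lemma handshake: "(\<Sum>s\<in>{1..n}. deg s) = 2 * m"
  using sum_symmetric_off_diagonal[of "{1..n}" a] a_sym edges_sum unfolding deg_def sum_greater by simp

lemma deg_eq: "deg s = real (gdegree n E s)"
proof -
  have "{w \<in> {1..n}. E s w} = {1..n} \<inter> {w. E s w}" by auto
  then show ?thesis
    unfolding deg_def gdegree_def adj_def by (simp add: sum.If_cases)
qed

lemma deg_nonneg: "0 \<le> deg s" unfolding deg_eq by simp

lemma deg_mono: "1 \<le> u \<Longrightarrow> u \<le> v \<Longrightarrow> v \<le> n \<Longrightarrow> deg v \<le> deg u"
  using cls unfolding deg_eq in_graph_class_def by auto

text \<open>At least \<open>K\<close> vertices have degree no smaller than that of \<open>v\<close>,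
  while all degrees add up to \<open>2 * m\<close>.\<close>

lemma deg_bound:
  assumes "1 \<le> K" "K < v" "v \<le> n"
  shows "deg v \<le> 2 * m / real K"
proof -
  have "real K * deg v = (\<Sum>s\<in>{1..K}. deg v)" by simp
  also have "\<dots> \<le> (\<Sum>s\<in>{1..K}. deg s)" using assms by (intro sum_mono deg_mono) auto
  also have "\<dots> \<le> (\<Sum>s\<in>{1..n}. deg s)" using assms deg_nonneg by (intro sum_mono2) auto
  finally have "real K * deg v \<le> 2 * m" unfolding handshake .
  then show ?thesis using assms by (simp add: field_simps)
qed

lemma partial_deg: "V \<subseteq> {1..n} \<Longrightarrow> (\<Sum>v\<in>V. a s v) \<le> deg s"
  unfolding deg_def by (intro sum_mono2) auto

lemma sum_deg_le: "V \<subseteq> {1..n} \<Longrightarrow> (\<Sum>v\<in>V. deg v) \<le> 2 * m"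
  unfolding handshake[symmetric] using deg_nonneg by (intro sum_mono2) auto

text \<open>This bound makes \<open>B c\<close> small and is the reason why \<open>Q1\<close> and \<open>Q3\<close> decouple.\<close>

lemma codegree_square_sum:
  assumes "1 \<le> K"
  shows "(\<Sum>w\<in>{K+1..n}. (\<Sum>v\<in>{K+1..n}. a s v * a v w)\<^sup>2) \<le> 4 * m\<^sup>2 / real K"
proof -
  let ?V = "{K+1..n}"
  let ?g = "\<lambda>w. \<Sum>v\<in>?V. a s v * a v w"
  have sub: "?V \<subseteq> {1..n}" by auto
  have g0: "0 \<le> ?g w" for w by (intro sum_nonneg mult_nonneg_nonneg) auto
  have g1: "?g w \<le> 2 * m / real K" if "w \<in> ?V" for w
  proof -
    have "?g w \<le> (\<Sum>v\<in>?V. a w v)"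
      by (intro sum_mono) (simp add: a_sym[of w] mult_left_le_one_le)
    also have "\<dots> \<le> deg w" by (rule partial_deg[OF sub])
    also have "\<dots> \<le> 2 * m / real K" using that assms by (intro deg_bound) auto
    finally show ?thesis .
  qed
  have "(\<Sum>w\<in>?V. (?g w)\<^sup>2) \<le> (\<Sum>w\<in>?V. 2 * m / real K * ?g w)"
    unfolding power2_eq_square using g0 g1 by (intro sum_mono mult_right_mono) auto
  also have "\<dots> = 2 * m / real K * (\<Sum>v\<in>?V. a s v * (\<Sum>w\<in>?V. a v w))"
    unfolding sum_distrib_left[symmetric] by (subst sum.swap) (simp add: sum_distrib_left)
  also have "\<dots> \<le> 2 * m / real K * (\<Sum>v\<in>?V. deg v)"
  proof (intro mult_left_mono sum_mono)
    fix v
    have "a s v * (\<Sum>w\<in>?V. a v w) \<le> 1 * (\<Sum>w\<in>?V. a v w)"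
      by (intro mult_right_mono sum_nonneg) auto
    then show "a s v * (\<Sum>w\<in>?V. a v w) \<le> deg v" using partial_deg[OF sub, of v] by simp
  qed (use m_pos in auto)
  also have "\<dots> \<le> 2 * m / real K * (2 * m)"
    using sum_deg_le[OF sub] m_pos by (intro mult_left_mono) auto
  finally show ?thesis by (simp add: power2_eq_square)
qed

text \<open>Inclusion and exclusion over ordered pairs: subtracting the head degrees once for each
  position removes the pairs inside the head twice. That correction is at most
  \<open>K\<^sup>2\<close>.\<close>

lemma tail_edges:
  assumes "K \<le> n"
  shows "(\<Sum>v\<in>{K+1..n}. \<Sum>w\<in>{K+1..n}. a v w)
    = 2 * m - 2 * (\<Sum>s\<in>{1..K}. deg s) + (\<Sum>s\<in>{1..K}. \<Sum>r\<in>{1..K}. a s r)"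
proof -
  let ?J = "{1..K}" and ?V = "{K+1..n}"
  have split: "(\<Sum>v\<in>{1..n}. f v) = (\<Sum>v\<in>?J. f v) + (\<Sum>v\<in>?V. f v)" for f :: "nat \<Rightarrow> real"
    using assms by (subst sum.union_disjoint[symmetric]) (auto intro!: sum.cong)
  have "2 * m = (\<Sum>s\<in>?J. deg s) + (\<Sum>s\<in>?V. deg s)" using handshake split[of deg] by simp
  also have "(\<Sum>s\<in>?V. deg s) = (\<Sum>s\<in>?V. \<Sum>v\<in>?J. a s v) + (\<Sum>s\<in>?V. \<Sum>v\<in>?V. a s v)"
    unfolding deg_def split sum.distrib ..
  also have "(\<Sum>s\<in>?V. \<Sum>v\<in>?J. a s v) = (\<Sum>v\<in>?J. \<Sum>s\<in>?V. a v s)"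
    by (subst sum.swap) (simp add: a_sym)
  also have "\<dots> = (\<Sum>v\<in>?J. deg v) - (\<Sum>v\<in>?J. \<Sum>s\<in>?J. a v s)"
    unfolding deg_def split sum.distrib by simp
  finally show ?thesis by simp
qed

text \<open>The eigenbasis is chosen before the scaling \<open>r\<close>: with \<open>r = 1\<close>
  it expresses the edge count through eigenvalues, with \<open>r = t / sqrt m\<close> it feeds the
  quadratic form.\<close>

lemma exists_eigenbasis:
  obtains u es where "length es = n - K" "mset es = mset (eig_list (adj_mat_K n K E))"
    "\<And>r. eigen_data {K+1..n} {..<n-K} (\<lambda>v w. r * a v w) u (\<lambda>i. r * es ! i)"
proof -
  let ?A = "adj_mat_K n K E"
  have A: "?A \<in> carrier_mat (n - K) (n - K)" by (simp add: adj_mat_K_def)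
  have AT: "?A\<^sup>T = ?A" by (rule eq_matI) (auto simp: adj_mat_K_def a_sym)
  obtain es u where es: "length es = n - K" "proots (char_poly ?A) = mset es"
    and 1: "\<And>v w. v < n - K \<Longrightarrow> w < n - K \<Longrightarrow> ?A $$ (v, w) = (\<Sum>i<n - K. u v i * u w i * es ! i)"
    and 2: "\<And>i j. i < n - K \<Longrightarrow> j < n - K \<Longrightarrow> (\<Sum>v<n - K. u v i * u v j) = (if i = j then 1 else 0)"
    by (rule symmetric_mat_eigenbasis[OF A AT], rule that)
  \<comment> \<open>Matrix index \<open>i\<close> stands for vertex
    \<open>i + K + 1\<close>.\<close>
  define u' where "u' v i = u (v - (K + 1)) i" for v i
  have re: "(\<Sum>v\<in>{K+1..n}. f (v - (K + 1))) = (\<Sum>v<n - K. f v)" for f :: "nat \<Rightarrow> real"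
    by (rule sum.reindex_bij_witness[of _ "\<lambda>v. v + (K + 1)" "\<lambda>v. v - (K + 1)"]) auto
  show thesis
  proof (rule that[OF es(1)])
    show "mset es = mset (eig_list ?A)"
      unfolding eig_list_def es(2)[symmetric] by simp
    fix r
    show "eigen_data {K+1..n} {..<n-K} (\<lambda>v w. r * a v w) u' (\<lambda>i. r * es ! i)"
    proof
      fix v w assume v: "v \<in> {K+1..n}" and w: "w \<in> {K+1..n}"
      have "a v w = ?A $$ (v - (K + 1), w - (K + 1))"
        using v w by (auto simp: adj_mat_K_def)
      also have "\<dots> = (\<Sum>i<n - K. u' v i * u' w i * es ! i)"
        unfolding u'_def using v w by (intro 1) auto
      finally show "r * a v w = (\<Sum>i<n - K. u' v i * u' w i * (r * es ! i))"
        by (simp add: sum_distrib_left mult_ac)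
    next
      fix i j assume "i \<in> {..<n - K}" "j \<in> {..<n - K}"
      then show "(\<Sum>v\<in>{K+1..n}. u' v i * u' v j) = (if i = j then 1 else 0)"
        unfolding u'_def using re[of "\<lambda>v. u v i * u v j"] 2 by simp
    qed auto
  qed
qed

section \<open>Eigenvalues ordered by modulus\<close>

lemma length_eig_list: "length (eig_list (adj_mat_K n K E)) = n - K"
proof -
  obtain u es where "length es = n - K" "mset es = mset (eig_list (adj_mat_K n K E))"
    "\<And>r. eigen_data {K+1..n} {..<n-K} (\<lambda>v w. r * a v w) u (\<lambda>i. r * es ! i)"
    by (rule exists_eigenbasis[of K], rule that)
  then show ?thesis by (metis size_mset)
qed

text \<open>Positions start at one, hence \<open>Suc s\<close>. The default value zero past the end
  lets finite sums over eigenvalues be read as infinite series later.\<close>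

lemma eigval_eq: "s < n - K \<Longrightarrow> eigval_nK n K E (Suc s) = eig_list (adj_mat_K n K E) ! s"
  "n - K \<le> s \<Longrightarrow> eigval_nK n K E (Suc s) = 0"
  unfolding eigval_nK_def Let_def length_eig_list by auto

lemma sum_eigval:
  fixes f :: "real \<Rightarrow> 'b::comm_monoid_add"
  assumes "length es = n - K" "mset es = mset (eig_list (adj_mat_K n K E))"
  shows "(\<Sum>i<n - K. f (es ! i)) = (\<Sum>s<n - K. f (eigval_nK n K E (Suc s)))"
proof -
  let ?l = "eig_list (adj_mat_K n K E)"
  have nth: "(\<Sum>i<length xs. f (xs ! i)) = sum_mset (image_mset f (mset xs))" for xs
  proof -
    have "sum_mset (image_mset f (mset xs)) = sum_list (map f xs)"
      by (simp add: sum_mset_sum_list[symmetric])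
    then show ?thesis by (simp add: sum_list_sum_nth atLeast0LessThan)
  qed
  have "(\<Sum>i<n - K. f (es ! i)) = (\<Sum>i<n - K. f (?l ! i))"
    using nth[of es] nth[of ?l] assms length_eig_list by simp
  also have "\<dots> = (\<Sum>s<n - K. f (eigval_nK n K E (Suc s)))"
    by (intro sum.cong refl) (simp add: eigval_eq)
  finally show ?thesis .
qed

lemma sum_eigval_square:
  "(\<Sum>s<n - K. (eigval_nK n K E (Suc s))\<^sup>2) = (\<Sum>v\<in>{K+1..n}. \<Sum>w\<in>{K+1..n}. a v w)"
proof -
  obtain u es where es: "length es = n - K" "mset es = mset (eig_list (adj_mat_K n K E))"
    and ed: "\<And>r. eigen_data {K+1..n} {..<n-K} (\<lambda>v w. r * a v w) u (\<lambda>i. r * es ! i)"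
    by (rule exists_eigenbasis[of K], rule that)
  show ?thesis
    using eigen_data.B_norm[OF ed[of 1]] sum_eigval[OF es, of "\<lambda>x. x\<^sup>2"] by simp
qed

lemma sum_eigval_square_le: "(\<Sum>s<n - K. (eigval_nK n K E (Suc s))\<^sup>2) \<le> 2 * m"
proof -
  have "(\<Sum>v\<in>{K+1..n}. \<Sum>w\<in>{K+1..n}. a v w) \<le> (\<Sum>v\<in>{K+1..n}. deg v)"
    by (intro sum_mono partial_deg) auto
  also have "\<dots> \<le> 2 * m" by (intro sum_deg_le) auto
  finally show ?thesis unfolding sum_eigval_square .
qed

lemma abs_eigval_antimono:
  assumes "i \<le> j" "j < n - K"
  shows "\<bar>eigval_nK n K E (Suc j)\<bar> \<le> \<bar>eigval_nK n K E (Suc i)\<bar>"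
proof -
  let ?l = "eig_list (adj_mat_K n K E)"
  have "sorted (map (\<lambda>x. - \<bar>x\<bar>) ?l)"
    unfolding eig_list_def by simp
  then have "map (\<lambda>x. - \<bar>x\<bar>) ?l ! i \<le> map (\<lambda>x. - \<bar>x\<bar>) ?l ! j"
    using assms length_eig_list by (intro sorted_nth_mono) auto
  then show ?thesis using assms length_eig_list by (simp add: eigval_eq)
qed

text \<open>The first \<open>Suc s\<close> eigenvalues are at least as large in modulus, and all
  squares together are at most \<open>2 * m\<close>. After scaling this is a decay rate uniform in
  the graph and in \<open>K\<close>.\<close>

lemma eigval_bound: "real (Suc s) * (eigval_nK n K E (Suc s))\<^sup>2 \<le> 2 * m"
proof (cases "s < n - K")
  case True
  have "real (Suc s) * (eigval_nK n K E (Suc s))\<^sup>2 = (\<Sum>i<Suc s. (eigval_nK n K E (Suc s))\<^sup>2)" by simp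
  also have "\<dots> \<le> (\<Sum>i<Suc s. (eigval_nK n K E (Suc i))\<^sup>2)"
    using True by (intro sum_mono) (auto simp: abs_le_square_iff[symmetric] intro!: abs_eigval_antimono)
  also have "\<dots> \<le> (\<Sum>i<n - K. (eigval_nK n K E (Suc i))\<^sup>2)"
    using True by (intro sum_mono2) auto
  also have "\<dots> \<le> 2 * m" by (rule sum_eigval_square_le)
  finally show ?thesis .
next
  case False
  then show ?thesis using m_pos by (simp add: eigval_eq)
qed

end

section \<open>Approximation of the characteristic function for one graph\<close>

locale graph_form = bounded_iid_sq \<mu> \<xi> T "{1..n}" + ordered_graph n E for \<mu> \<xi> T n E
begin

text \<open>\<open>\<bar>c\<bar>\<^sup>2\<close> at \<open>t = 1\<close>, written as a form in the
  head variables: its matrix consists of the scaled codegrees through the tail, which tend to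
  \<open>\<sigma>\<close>.\<close>

definition Qn :: "nat \<Rightarrow> nat \<Rightarrow> (nat \<Rightarrow> real) \<Rightarrow> real" where
  "Qn K0 K z = (\<Sum>s\<in>{1..K0}. \<Sum>r\<in>{1..K0}. z s * z r * ((\<Sum>v\<in>{K+1..n}. a s v * a v r) / m))"

text \<open>The first summand of the bound pays for truncation and deleted edges, the second is
  \<open>char_quadratic_form\<close>, with \<open>2 * t\<^sup>2\<close> bounding the total influence
  because the degrees add up to \<open>2 * m\<close>.\<close>

theorem char_approximation:
  assumes t: "t \<noteq> 0" and K: "1 \<le> K0" "K0 \<le> K" "K \<le> n"
  shows "cmod ((\<integral>x. iexp (t * S_G n E x) \<partial>P)
      - of_real (\<integral>x. exp (- t\<^sup>2 / 2 * Qn K0 K (\<lambda>i. y i x)) \<partial>P)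
        * exp ((\<Sum>s<n - K. psi (\<i> * of_real (t * eigval_nK n K E (Suc s) / sqrt m))) / 2))
    \<le> \<bar>t\<bar> * sqrt (2 * \<bar>1 - kap\<^sup>2\<bar> + ((real K)\<^sup>2 + (\<Sum>s\<in>{K0<..K}. deg s)) / m)
      + (9 * T ^ 5 * (\<bar>t\<bar> * sqrt (2 / K)) * (2 * t\<^sup>2) + 2 * (2 * t\<^sup>2 * sqrt (K0 / K)))"
proof -
  \<comment> \<open>The scaling absorbs \<open>t\<close>, so the form is examined at argument
    one.\<close>
  define r where "r = t / sqrt m"
  have r2: "r\<^sup>2 = t\<^sup>2 / m" using m_pos by (simp add: r_def power_divide)
  have K1: "1 \<le> K" using K by simp
  let ?J = "{1..K0}" and ?V = "{K+1..n}" and ?N = "{..<n-K}"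
  obtain u es where es: "length es = n - K" "mset es = mset (eig_list (adj_mat_K n K E))"
    and ed: "\<And>r. eigen_data ?V ?N (\<lambda>v w. r * a v w) u (\<lambda>i. r * es ! i)"
    by (rule exists_eigenbasis[of K], rule that)
  interpret eigen_data ?V ?N "\<lambda>v w. r * a v w" u "\<lambda>i. r * es ! i" by (rule ed)
  interpret qf: quad_form \<mu> \<xi> T "{1..n}" ?V ?N "\<lambda>v w. r * a v w" u "\<lambda>i. r * es ! i" ?J "\<lambda>s v. r * a s v"
    using K by unfold_locales auto
  define D where "D = Sigma {1..n} (\<lambda>u. {u<..n})"
  define keep where "keep e \<longleftrightarrow> (fst e \<le> K0 \<and> K < snd e) \<or> K < fst e" for e :: "nat \<times> nat"
  define ae where "ae e = r * a (fst e) (snd e)" for e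
  define be where "be e = (if keep e then ae e else 0)" for e
  have S: "t * S_G n E x = (\<Sum>e\<in>D. ae e * (x (fst e) * x (snd e)))" for x
    unfolding S_G_def D_def ae_def r_def m_def
    by (simp add: sum.Sigma sum_distrib_left case_prod_beta mult_ac)
  have sumD: "(\<Sum>e\<in>D. f e) = (\<Sum>p\<in>{1..n}. \<Sum>w\<in>{1..n}. if p < w then f (p, w) else 0)"
    for f :: "nat \<times> nat \<Rightarrow> real"
    unfolding D_def sum_greater[symmetric] by (simp add: sum.Sigma)
  have q: "qf.q x = (\<Sum>e\<in>D. be e * (y (fst e) x * y (snd e) x))" for x
  proof -
    let ?f = "\<lambda>p w. r * a p w * (y p x * y w x)"
    have "qf.q x = (\<Sum>w\<in>?V. \<Sum>p\<in>?J. ?f p w) + (\<Sum>v\<in>?V. \<Sum>w\<in>?V. ?f v w) / 2"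
      unfolding qf.q_def qf.c_def qf.BY_def
      by (simp add: distrib_left sum.distrib sum_distrib_left sum_divide_distrib mult_ac)
    also have "(\<Sum>w\<in>?V. \<Sum>p\<in>?J. ?f p w) = (\<Sum>p\<in>?J. \<Sum>w\<in>?V. ?f p w)" by (rule sum.swap)
    also have "(\<Sum>v\<in>?V. \<Sum>w\<in>?V. ?f v w) / 2 = (\<Sum>v\<in>?V. \<Sum>w\<in>?V. if v < w then ?f v w else 0)"
      by (subst sum_symmetric_off_diagonal) (auto simp: a_sym mult_ac)
    finally have 1: "qf.q x = (\<Sum>p\<in>?J. \<Sum>w\<in>?V. ?f p w) + (\<Sum>v\<in>?V. \<Sum>w\<in>?V. if v < w then ?f v w else 0)" .
    have ext: "(\<Sum>p\<in>X. \<Sum>w\<in>?V. g p w) = (\<Sum>p\<in>{1..n}. \<Sum>w\<in>{1..n}. if p \<in> X \<and> K < w then g p w else 0)"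
      if "X \<subseteq> {1..n}" for g :: "nat \<Rightarrow> nat \<Rightarrow> real" and X
    proof -
      have "(\<Sum>w\<in>?V. g p w) = (\<Sum>w\<in>{1..n}. if K < w then g p w else 0)" for p
        using sum_greater[of "g p" K] by (simp add: atLeastSucAtMost_greaterThanAtMost)
      then have "(\<Sum>p\<in>X. \<Sum>w\<in>?V. g p w) = (\<Sum>p\<in>X. \<Sum>w\<in>{1..n}. if K < w then g p w else 0)"
        by (simp only:)
      also have "\<dots> = (\<Sum>p\<in>X. \<Sum>w\<in>{1..n}. if p \<in> X \<and> K < w then g p w else 0)"
        by (intro sum.cong refl) auto
      also have "\<dots> = (\<Sum>p\<in>{1..n}. \<Sum>w\<in>{1..n}. if p \<in> X \<and> K < w then g p w else 0)"
        using that by (intro sum.mono_neutral_left) auto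
      finally show ?thesis .
    qed
    have "qf.q x = (\<Sum>p\<in>{1..n}. \<Sum>w\<in>{1..n}. (if p \<in> ?J \<and> K < w then ?f p w else 0)
        + (if p \<in> ?V \<and> K < w then if p < w then ?f p w else 0 else 0))"
      unfolding 1 sum.distrib using K by (subst (1 2) ext) auto
    also have "\<dots> = (\<Sum>e\<in>D. be e * (y (fst e) x * y (snd e) x))"
      unfolding sumD be_def ae_def keep_def using K
      by (intro sum.cong refl) auto
    finally show ?thesis .
  qed
  have A: "qf.A x = t\<^sup>2 * Qn K0 K (\<lambda>i. y i x)" for x
  proof -
    have "qf.A x = (\<Sum>v\<in>?V. \<Sum>s\<in>?J. \<Sum>p\<in>?J. r\<^sup>2 * (a s v * a v p) * (y s x * y p x))"
      unfolding qf.A_def qf.c_def by (simp add: power2_eq_square sum_product a_sym mult_ac)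
    also have "\<dots> = (\<Sum>s\<in>?J. \<Sum>p\<in>?J. \<Sum>v\<in>?V. r\<^sup>2 * (a s v * a v p) * (y s x * y p x))"
      by (subst sum.swap) (intro sum.cong refl sum.swap)
    finally show ?thesis
      unfolding Qn_def r2 by (simp add: sum_distrib_left sum_distrib_right sum_divide_distrib mult_ac)
  qed
  have psi: "(\<Sum>i\<in>?N. psi (\<i> * of_real (r * es ! i))) = (\<Sum>s<n - K. psi (\<i> * of_real (t * eigval_nK n K E (Suc s) / sqrt m)))"
    using sum_eigval[OF es, of "\<lambda>x. psi (\<i> * of_real (r * x))"] by (simp add: r_def)
  have ell: "qf.ell v \<le> r\<^sup>2 * deg v" if "v \<in> ?V" for v
  proof -
    have "qf.ell v = r\<^sup>2 * (\<Sum>w\<in>?J \<union> ?V. a v w)"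
      unfolding qf.ell_def using K
      by (subst sum.union_disjoint) (auto simp: power_mult_distrib sum_distrib_left distrib_left a_sym)
    also have "\<dots> \<le> r\<^sup>2 * deg v" using K by (intro mult_left_mono partial_deg) auto
    finally show ?thesis .
  qed
  have suml: "(\<Sum>v\<in>?V. qf.ell v) \<le> 2 * t\<^sup>2"
  proof -
    have "(\<Sum>v\<in>?V. qf.ell v) \<le> r\<^sup>2 * (\<Sum>v\<in>?V. deg v)"
      unfolding sum_distrib_left by (intro sum_mono ell)
    also have "\<dots> \<le> r\<^sup>2 * (2 * m)" using K by (intro mult_left_mono sum_deg_le) auto
    finally show ?thesis using m_pos by (simp add: r2)
  qed
  \<comment> \<open>\<open>deg_bound\<close> gives squared row norms of at most
    \<open>t\<^sup>2 / m * (2 * m / K) = h\<^sup>2\<close>. For \<open>d\<close>, each of the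
    \<open>K0\<close> head vertices contributes at most \<open>4 * m\<^sup>2 / K\<close> by
    \<open>codegree_square_sum\<close>, times \<open>(t\<^sup>2 / m)\<^sup>2\<close>.\<close>
  define h where "h = \<bar>t\<bar> * sqrt (2 / K)"
  define d where "d = 2 * t\<^sup>2 * sqrt (K0 / K)"
  have h: "0 < h" using t K1 by (simp add: h_def)
  have d: "0 < d" using t K by (simp add: d_def)
  have hb: "qf.ell v \<le> h\<^sup>2" if "v \<in> ?V" for v
  proof -
    have "r\<^sup>2 * deg v \<le> r\<^sup>2 * (2 * m / real K)"
      using that K1 by (intro mult_left_mono deg_bound) auto
    also have "\<dots> = h\<^sup>2" using m_pos by (simp add: r2 h_def power_mult_distrib)
    finally show ?thesis using ell[OF that] by simp
  qed
  have db: "(\<Sum>s\<in>?J. \<Sum>w\<in>?V. (\<Sum>v\<in>?V. (r * a s v) * (r * a v w))\<^sup>2) \<le> d\<^sup>2"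
  proof -
    have "(\<Sum>s\<in>?J. \<Sum>w\<in>?V. (\<Sum>v\<in>?V. (r * a s v) * (r * a v w))\<^sup>2)
      = (r\<^sup>2)\<^sup>2 * (\<Sum>s\<in>?J. \<Sum>w\<in>?V. (\<Sum>v\<in>?V. a s v * a v w)\<^sup>2)"
    proof -
      have "(\<Sum>v\<in>?V. (r * a s v) * (r * a v w)) = r\<^sup>2 * (\<Sum>v\<in>?V. a s v * a v w)" for s w
        by (simp add: sum_distrib_left power2_eq_square mult_ac)
      then show ?thesis by (simp only: power_mult_distrib sum_distrib_left[symmetric])
    qed
    also have "\<dots> \<le> (r\<^sup>2)\<^sup>2 * (\<Sum>s\<in>?J. 4 * m\<^sup>2 / real K)"
      using K1 by (intro mult_left_mono sum_mono codegree_square_sum) auto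
    also have "\<dots> = d\<^sup>2"
      using m_pos by (simp add: r2 d_def power_mult_distrib power_divide)
    finally show ?thesis .
  qed
  have T5: "0 \<le> 9 * T ^ 5 * h" using T_ge_1 h by simp
  have core: "cmod ((\<integral>x. iexp (qf.q x) \<partial>P) - of_real (\<integral>x. exp (- qf.A x / 2) \<partial>P)
      * exp ((\<Sum>s<n - K. psi (\<i> * of_real (t * eigval_nK n K E (Suc s) / sqrt m))) / 2))
    \<le> 9 * T ^ 5 * h * (2 * t\<^sup>2) + 2 * d"
    using qf.char_quadratic_form[OF h hb d db] mult_left_mono[OF suml T5] unfolding psi by linarith
  have trunc: "cmod ((\<integral>x. iexp (t * S_G n E x) \<partial>P) - (\<integral>x. iexp (qf.q x) \<partial>P))
    \<le> \<bar>t\<bar> * sqrt (2 * \<bar>1 - kap\<^sup>2\<bar> + ((real K)\<^sup>2 + (\<Sum>s\<in>{K0<..K}. deg s)) / m)"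
  proof -
    have "(\<Sum>e\<in>D. (ae e)\<^sup>2 - 2 * ae e * be e * kap\<^sup>2 + (be e)\<^sup>2)
      \<le> (\<Sum>e\<in>D. r\<^sup>2 * (2 * \<bar>1 - kap\<^sup>2\<bar> * a (fst e) (snd e) + (if keep e then 0 else a (fst e) (snd e))))"
    proof (rule sum_mono)
      fix e
      have sq: "(ae e)\<^sup>2 = r\<^sup>2 * a (fst e) (snd e)" by (simp add: ae_def power_mult_distrib)
      have nn: "0 \<le> r\<^sup>2 * a (fst e) (snd e)" by simp
      show "(ae e)\<^sup>2 - 2 * ae e * be e * kap\<^sup>2 + (be e)\<^sup>2
        \<le> r\<^sup>2 * (2 * \<bar>1 - kap\<^sup>2\<bar> * a (fst e) (snd e) + (if keep e then 0 else a (fst e) (snd e)))"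
      proof (cases "keep e")
        case True
        then have "(ae e)\<^sup>2 - 2 * ae e * be e * kap\<^sup>2 + (be e)\<^sup>2 = (r\<^sup>2 * a (fst e) (snd e)) * (2 * (1 - kap\<^sup>2))"
          unfolding sq[symmetric] be_def by (simp add: power2_eq_square algebra_simps)
        also have "\<dots> \<le> (r\<^sup>2 * a (fst e) (snd e)) * (2 * \<bar>1 - kap\<^sup>2\<bar>)"
          using nn by (intro mult_left_mono) auto
        finally show ?thesis using True by (simp add: mult_ac)
      next
        case False
        have "0 \<le> (r\<^sup>2 * a (fst e) (snd e)) * (2 * \<bar>1 - kap\<^sup>2\<bar>)" using nn by (intro mult_nonneg_nonneg) auto
        then show ?thesis using False by (simp add: be_def sq algebra_simps)
      qed
    qed
    also have "\<dots> = r\<^sup>2 * (2 * \<bar>1 - kap\<^sup>2\<bar> * (\<Sum>e\<in>D. a (fst e) (snd e)) + (\<Sum>e\<in>D. if keep e then 0 else a (fst e) (snd e)))"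
      by (simp add: sum_distrib_left sum.distrib distrib_left)
    also have "(\<Sum>e\<in>D. a (fst e) (snd e)) = m"
      unfolding sumD fst_conv snd_conv using edges_sum unfolding sum_greater .
    also have "r\<^sup>2 * (2 * \<bar>1 - kap\<^sup>2\<bar> * m + (\<Sum>e\<in>D. if keep e then 0 else a (fst e) (snd e)))
      \<le> r\<^sup>2 * (2 * \<bar>1 - kap\<^sup>2\<bar> * m + ((real K)\<^sup>2 + (\<Sum>s\<in>{K0<..K}. deg s)))"
    proof (intro mult_left_mono add_left_mono)
      have "(\<Sum>e\<in>D. if keep e then 0 else a (fst e) (snd e))
        = (\<Sum>p\<in>{1..n}. \<Sum>w\<in>{1..n}. if p < w \<and> \<not> keep (p, w) then a p w else 0)"
        unfolding sumD by (intro sum.cong refl) auto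
      \<comment> \<open>A deleted pair either lies inside \<open>{1..K}\<close>, where counting
        pairs is enough, or its larger end is beyond \<open>K\<close> and its smaller end in
        \<open>{K0<..K}\<close>, where it is charged to a degree.\<close>
      also have "\<dots> \<le> (\<Sum>p\<in>{1..n}. \<Sum>w\<in>{1..n}. (if p \<in> {1..K} \<and> w \<in> {1..K} then 1 else 0)
          + (if p \<in> {K0<..K} then a p w else 0))"
        unfolding keep_def by (intro sum_mono) auto
      also have "\<dots> = (\<Sum>p\<in>{1..n}. \<Sum>w\<in>{1..n}. (if p \<in> {1..K} \<and> w \<in> {1..K} then 1 else 0))
          + (\<Sum>p\<in>{1..n}. if p \<in> {K0<..K} then deg p else 0)"
        unfolding sum.distrib deg_def by (intro arg_cong2[where f = "(+)"] refl sum.cong) auto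
      also have "(\<Sum>p\<in>{1..n}. if p \<in> {K0<..K} then deg p else 0) = (\<Sum>p\<in>{K0<..K}. deg p)"
        using K by (subst sum.inter_restrict[symmetric]) (auto intro!: sum.cong)
      also have "(\<Sum>p\<in>{1..n}. \<Sum>w\<in>{1..n}. (if p \<in> {1..K} \<and> w \<in> {1..K} then 1 else 0)) = (real K)\<^sup>2"
      proof -
        have inner: "(\<Sum>w\<in>{1..n}. if w \<in> {1..K} then 1 else 0) = real K"
          using K by (subst sum.inter_restrict[symmetric]) (auto simp: min_def)
        have "(\<Sum>p\<in>{1..n}. \<Sum>w\<in>{1..n}. (if p \<in> {1..K} \<and> w \<in> {1..K} then 1 else (0 :: real)))
          = (\<Sum>p\<in>{1..n}. (if p \<in> {1..K} then 1 else 0) * (\<Sum>w\<in>{1..n}. if w \<in> {1..K} then 1 else 0))"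
          unfolding sum_distrib_left by (intro sum.cong refl) auto
        also have "\<dots> = real K * real K"
          unfolding sum_distrib_right[symmetric] inner ..
        finally show ?thesis by (simp add: power2_eq_square)
      qed
      finally show "(\<Sum>e\<in>D. if keep e then 0 else a (fst e) (snd e)) \<le> (real K)\<^sup>2 + (\<Sum>s\<in>{K0<..K}. deg s)" .
    qed simp
    also have "\<dots> = t\<^sup>2 * (2 * \<bar>1 - kap\<^sup>2\<bar> + ((real K)\<^sup>2 + (\<Sum>s\<in>{K0<..K}. deg s)) / m)"
      using m_pos by (simp add: r2 field_simps)
    finally have sq: "(\<Sum>e\<in>D. (ae e)\<^sup>2 - 2 * ae e * be e * kap\<^sup>2 + (be e)\<^sup>2) \<le> \<dots>" .
    have "cmod ((\<integral>x. iexp (t * S_G n E x) \<partial>P) - (\<integral>x. iexp (qf.q x) \<partial>P))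
      \<le> sqrt (\<Sum>e\<in>D. (ae e)\<^sup>2 - 2 * ae e * be e * kap\<^sup>2 + (be e)\<^sup>2)"
      unfolding S q by (rule truncation_error) (auto simp: D_def)
    also have "\<dots> \<le> sqrt (t\<^sup>2 * (2 * \<bar>1 - kap\<^sup>2\<bar> + ((real K)\<^sup>2 + (\<Sum>s\<in>{K0<..K}. deg s)) / m))"
      using sq by (rule real_sqrt_le_mono)
    finally show ?thesis by (simp add: real_sqrt_mult)
  qed
  have eqA: "- qf.A x / 2 = - t\<^sup>2 / 2 * Qn K0 K (\<lambda>i. y i x)" for x unfolding A by simp
  show ?thesis
    using norm_triangle_mono[OF trunc core] unfolding eqA h_def d_def by simp
qed

end

section \<open>Iterated limits\<close>

text \<open>A hard cut-off is recentred and rescaled so that the first two moments stay exactly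
  those of a standard variable, as the Stein step needs; dominated convergence shows that the
  corrections disappear.\<close>

lemma standardized_truncation_exists:
  fixes \<mu> :: "real measure"
  assumes "prob_space \<mu>" and s [measurable_cong]: "sets \<mu> = sets borel"
    and sq: "integrable \<mu> (\<lambda>x. x\<^sup>2)" and mean: "(\<integral>x. x \<partial>\<mu>) = 0" and var: "(\<integral>x. x\<^sup>2 \<partial>\<mu>) = 1"
  obtains \<xi> :: "nat \<Rightarrow> real \<Rightarrow> real" and T :: "nat \<Rightarrow> real" where
    "\<And>k. \<xi> k \<in> borel_measurable borel" "\<And>k x. \<bar>\<xi> k x\<bar> \<le> T k" "\<And>k. 1 \<le> T k"
    "\<And>k. (\<integral>x. \<xi> k x \<partial>\<mu>) = 0" "\<And>k. (\<integral>x. (\<xi> k x)\<^sup>2 \<partial>\<mu>) = 1"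
    "\<And>x. (\<lambda>k. \<xi> k x) \<longlonglongrightarrow> x" "(\<lambda>k. \<integral>x. x * \<xi> k x \<partial>\<mu>) \<longlonglongrightarrow> 1"
proof -
  interpret prob_space \<mu> by fact
  have id: "integrable \<mu> (\<lambda>x. x)"
    by (rule square_integrable_imp_integrable[OF _ sq]) measurable
  define c where "c k x = (if \<bar>x\<bar> \<le> real k then x else 0)" for k x
  have c_meas [measurable]: "c k \<in> borel_measurable borel" for k unfolding c_def by measurable
  have c_le: "\<bar>c k x\<bar> \<le> \<bar>x\<bar>" "\<bar>c k x\<bar> \<le> real k" for k x by (auto simp: c_def)
  have c_lim: "(\<lambda>k. c k x) \<longlonglongrightarrow> x" for x
  proof (rule tendsto_eventually)
    obtain k0 where "\<bar>x\<bar> \<le> real k0" using real_arch_simple by blast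
    then show "eventually (\<lambda>k. c k x = x) sequentially"
      unfolding eventually_sequentially c_def by (intro exI[of _ k0]) auto
  qed
  have ic: "integrable \<mu> (c k)" for k
    using c_le(2) by (intro integrable_const_bound[of _ "real k"]) auto
  have ic2: "integrable \<mu> (\<lambda>x. (c k x)\<^sup>2)" for k
  proof (rule integrable_const_bound[of _ "(real k)\<^sup>2"])
    show "AE x in \<mu>. norm ((c k x)\<^sup>2) \<le> (real k)\<^sup>2"
    proof (rule AE_I2)
      fix x show "norm ((c k x)\<^sup>2) \<le> (real k)\<^sup>2"
        using power_mono[OF c_le(2)[of k x] abs_ge_zero, of 2] by simp
    qed
  qed measurable
  define e where "e k = (\<integral>x. c k x \<partial>\<mu>)" for k
  define q where "q k = (\<integral>x. (c k x)\<^sup>2 \<partial>\<mu>)" for k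
  define v where "v k = q k - (e k)\<^sup>2" for k
  have "e \<longlonglongrightarrow> (\<integral>x. x \<partial>\<mu>)"
    unfolding e_def
  proof (rule integral_dominated_convergence[where w = "\<lambda>x. \<bar>x\<bar>"])
    show "integrable \<mu> (\<lambda>x. \<bar>x\<bar>)" using id by (rule integrable_abs)
    show "AE x in \<mu>. (\<lambda>k. c k x) \<longlonglongrightarrow> x" by (intro AE_I2 c_lim)
    show "AE x in \<mu>. norm (c k x) \<le> \<bar>x\<bar>" for k by (intro AE_I2) (simp add: c_le(1))
  qed measurable
  then have e0: "e \<longlonglongrightarrow> 0" using mean by simp
  have "q \<longlonglongrightarrow> (\<integral>x. x\<^sup>2 \<partial>\<mu>)"
    unfolding q_def
  proof (rule integral_dominated_convergence[where w = "\<lambda>x. x\<^sup>2"])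
    show "AE x in \<mu>. (\<lambda>k. (c k x)\<^sup>2) \<longlonglongrightarrow> x\<^sup>2" by (intro AE_I2 tendsto_power c_lim)
    show "AE x in \<mu>. norm ((c k x)\<^sup>2) \<le> x\<^sup>2" for k
      by (intro AE_I2) (simp add: c_le(1) abs_le_square_iff[symmetric])
  qed (measurable, rule sq)
  then have q1: "q \<longlonglongrightarrow> 1" using var by simp
  have v1: "v \<longlonglongrightarrow> 1"
    unfolding v_def using tendsto_diff[OF q1 tendsto_power[OF e0, of 2]] by simp
  then have "eventually (\<lambda>k. 1/4 < v k) sequentially" by (rule order_tendstoD) simp
  then obtain k0 where k0: "\<And>k. k0 \<le> k \<Longrightarrow> 1/4 < v k" unfolding eventually_sequentially by blast
  \<comment> \<open>The shift by \<open>k0\<close> skips the levels at which the truncated variance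
    might vanish. Variance above 1/4 explains the factor 2 in \<open>T\<close>, and the added 1
    ensures \<open>1 \<le> T k\<close>.\<close>
  define \<xi> where "\<xi> k x = (c (k + k0) x - e (k + k0)) / sqrt (v (k + k0))" for k x
  define T where "T k = 2 * (real (k + k0) + \<bar>e (k + k0)\<bar>) + 1" for k
  have vpos: "0 < v (k + k0)" for k using k0[of "k + k0"] by simp
  have sv: "1/2 \<le> sqrt (v (k + k0))" for k
    using real_sqrt_le_mono[OF less_imp_le[OF k0[of "k + k0"]]] by (simp add: real_sqrt_divide)
  show thesis
  proof (rule that[of \<xi> T])
    fix k
    show "\<xi> k \<in> borel_measurable borel" unfolding \<xi>_def by measurable
    show "1 \<le> T k" unfolding T_def by simp
    show "(\<integral>x. \<xi> k x \<partial>\<mu>) = 0"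
      unfolding \<xi>_def using ic[of "k + k0"] by (simp add: prob_space e_def)
    have "(\<integral>x. (\<xi> k x)\<^sup>2 \<partial>\<mu>) = (\<integral>x. ((c (k + k0) x)\<^sup>2 - 2 * e (k + k0) * c (k + k0) x + (e (k + k0))\<^sup>2) / v (k + k0) \<partial>\<mu>)"
      unfolding \<xi>_def using vpos[of k] by (simp add: power_divide power2_diff algebra_simps)
    also have "\<dots> = (q (k + k0) - 2 * e (k + k0) * e (k + k0) + (e (k + k0))\<^sup>2) / v (k + k0)"
      using ic[of "k + k0"] ic2[of "k + k0"] by (simp add: prob_space e_def[symmetric] q_def[symmetric])
    also have "\<dots> = 1" using vpos[of k] by (simp add: v_def power2_eq_square)
    finally show "(\<integral>x. (\<xi> k x)\<^sup>2 \<partial>\<mu>) = 1" .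
    fix x
    have "\<bar>c (k + k0) x - e (k + k0)\<bar> \<le> real (k + k0) + \<bar>e (k + k0)\<bar>"
      using c_le(2)[of "k + k0" x] by linarith
    also have "\<dots> \<le> (2 * (real (k + k0) + \<bar>e (k + k0)\<bar>)) * sqrt (v (k + k0))"
      using mult_left_mono[OF sv[of k], of "2 * (real (k + k0) + \<bar>e (k + k0)\<bar>)"] by simp
    also have "\<dots> \<le> T k * sqrt (v (k + k0))"
      unfolding T_def using vpos[of k] by (intro mult_right_mono) auto
    finally show "\<bar>\<xi> k x\<bar> \<le> T k"
      unfolding \<xi>_def using vpos[of k] by (simp add: divide_le_eq)
  next
    fix x
    have "(\<lambda>k. \<xi> k x) \<longlonglongrightarrow> (x - 0) / sqrt 1"
      unfolding \<xi>_def using c_lim[of x] e0 v1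
      by (intro tendsto_intros LIMSEQ_ignore_initial_segment[of _ _ k0]) auto
    then show "(\<lambda>k. \<xi> k x) \<longlonglongrightarrow> x" by simp
  next
    have "(\<integral>x. x * \<xi> k x \<partial>\<mu>) = q (k + k0) / sqrt (v (k + k0))" for k
    proof -
      \<comment> \<open>A hard cut-off satisfies \<open>x * c k x = (c k x)\<^sup>2\<close>, so the
        correlation is expressed by the truncated moments.\<close>
      have "x * \<xi> k x = ((c (k + k0) x)\<^sup>2 - e (k + k0) * x) / sqrt (v (k + k0))" for x
        unfolding \<xi>_def c_def by (simp add: field_simps power2_eq_square)
      then show ?thesis using id ic2[of "k + k0"] by (simp add: mean q_def)
    qed
    moreover have "(\<lambda>k. q (k + k0) / sqrt (v (k + k0))) \<longlonglongrightarrow> 1 / sqrt 1"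
      using q1 v1 by (intro tendsto_intros LIMSEQ_ignore_initial_segment[of _ _ k0]) auto
    ultimately show "(\<lambda>k. \<integral>x. x * \<xi> k x \<partial>\<mu>) \<longlonglongrightarrow> 1" by simp
  qed
qed

text \<open>Encodes that the upper limit of \<open>cmod (f n - a)\<close> is at most
  \<open>b\<close>. Since \<open>f\<close> depends on \<open>n\<close> alone, the remaining
  parameters can afterwards be sent to their limits one by one inside \<open>a\<close> and
  \<open>b\<close>.\<close>

definition limsup_dist_le :: "(nat \<Rightarrow> complex) \<Rightarrow> complex \<Rightarrow> real \<Rightarrow> bool" where
  "limsup_dist_le f a b \<longleftrightarrow> (\<forall>\<epsilon>>0. eventually (\<lambda>n. cmod (f n - a) \<le> b + \<epsilon>) sequentially)"

lemma limsup_dist_leI: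
  assumes "eventually (\<lambda>n. cmod (f n - g n) \<le> h n) sequentially" "g \<longlonglongrightarrow> a" "h \<longlonglongrightarrow> b"
  shows "limsup_dist_le f a b"
  unfolding limsup_dist_le_def
proof (intro allI impI)
  fix \<epsilon> :: real assume "0 < \<epsilon>"
  then have e: "0 < \<epsilon> / 2" by simp
  have "eventually (\<lambda>n. dist (g n) a < \<epsilon> / 2) sequentially" "eventually (\<lambda>n. dist (h n) b < \<epsilon> / 2) sequentially"
    using tendstoD[OF assms(2) e] tendstoD[OF assms(3) e] by auto
  with assms(1) show "eventually (\<lambda>n. cmod (f n - a) \<le> b + \<epsilon>) sequentially"
  proof eventually_elim
    case (elim n)
    have "cmod (f n - a) \<le> cmod (f n - g n) + cmod (g n - a)" by (rule norm_diff_triangle_ineq[of "f n" "g n" "g n" a, simplified]) 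
    then show ?case using elim by (simp add: dist_norm abs_if split: if_splits)
  qed
qed

lemma limsup_dist_le_limit:
  assumes "eventually (\<lambda>k. limsup_dist_le f (a k) (b k)) sequentially" "a \<longlonglongrightarrow> a'" "b \<longlonglongrightarrow> b'"
  shows "limsup_dist_le f a' b'"
  unfolding limsup_dist_le_def
proof (intro allI impI)
  fix \<epsilon> :: real assume "0 < \<epsilon>"
  then have e: "0 < \<epsilon> / 3" by simp
  have "eventually (\<lambda>k. limsup_dist_le f (a k) (b k) \<and> dist (a k) a' < \<epsilon> / 3 \<and> dist (b k) b' < \<epsilon> / 3) sequentially"
    using assms(1) tendstoD[OF assms(2) e] tendstoD[OF assms(3) e] by eventually_elim auto
  then obtain k where k: "limsup_dist_le f (a k) (b k)" "dist (a k) a' < \<epsilon> / 3" "dist (b k) b' < \<epsilon> / 3"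
    by (auto simp: eventually_sequentially)
  have "eventually (\<lambda>n. cmod (f n - a k) \<le> b k + \<epsilon> / 3) sequentially"
    using k(1) e unfolding limsup_dist_le_def by blast
  then show "eventually (\<lambda>n. cmod (f n - a') \<le> b' + \<epsilon>) sequentially"
  proof eventually_elim
    case (elim n)
    have "cmod (f n - a') \<le> cmod (f n - a k) + cmod (a k - a')" by (rule norm_diff_triangle_ineq[of "f n" "a k" "a k" a', simplified])
    then show ?case using elim k(2,3) by (simp add: dist_norm abs_if split: if_splits)
  qed
qed

lemma limsup_dist_le_zero: "limsup_dist_le f a 0 \<Longrightarrow> f \<longlonglongrightarrow> a"
  unfolding limsup_dist_le_def
proof (rule tendstoI)
  fix e :: real assume h: "\<forall>\<epsilon>>0. eventually (\<lambda>n. cmod (f n - a) \<le> 0 + \<epsilon>) sequentially" and e: "0 < e"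
  have "0 < e / 2" using e by simp
  with h have "eventually (\<lambda>n. cmod (f n - a) \<le> e / 2) sequentially" by fastforce
  then show "eventually (\<lambda>n. dist (f n) a < e) sequentially"
    by eventually_elim (use e in \<open>simp add: dist_norm\<close>)
qed

text \<open>A subsequence converges almost everywhere, and Fatou's lemma along it bounds the
  distance to the limit. The subsequence is kept in the conclusion because it transfers
  nonnegativity to \<open>A\<close>.\<close>

lemma L1_complete:
  fixes s :: "nat \<Rightarrow> 'a \<Rightarrow> real"
  assumes int: "\<And>n. integrable M (s n)"
    and cauchy: "\<And>e. 0 < e \<Longrightarrow> \<exists>N. \<forall>i\<ge>N. \<forall>j\<ge>N. (\<integral>x. \<bar>s i x - s j x\<bar> \<partial>M) < e"
  obtains A r where "integrable M A" "(\<lambda>n. \<integral>x. \<bar>s n x - A x\<bar> \<partial>M) \<longlonglongrightarrow> 0"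
    "strict_mono r" "AE x in M. (\<lambda>i. s (r i) x) \<longlonglongrightarrow> A x"
proof -
  obtain r where r: "strict_mono r" and AEc: "AE x in M. Cauchy (\<lambda>i. s (r i) x)"
    using cauchy_L1_AE_cauchy_subseq[of M s] int cauchy by auto
  have sm [measurable]: "s n \<in> borel_measurable M" for n using int by auto
  define A where "A x = lim (\<lambda>i. s (r i) x)" for x
  have Am [measurable]: "A \<in> borel_measurable M"
    unfolding A_def by (rule borel_measurable_lim_metric) simp
  have lim: "AE x in M. (\<lambda>i. s (r i) x) \<longlonglongrightarrow> A x"
    using AEc unfolding A_def by eventually_elim (simp add: Cauchy_convergent_iff convergent_LIMSEQ_iff)
  have nn: "(\<integral>\<^sup>+x. ennreal \<bar>s n x - A x\<bar> \<partial>M) \<le> ennreal e"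
    if N: "\<forall>i\<ge>N. \<forall>j\<ge>N. (\<integral>x. \<bar>s i x - s j x\<bar> \<partial>M) < e" and n: "N \<le> n" for n N e
  proof -
    have "(\<integral>\<^sup>+x. ennreal \<bar>s n x - A x\<bar> \<partial>M) = (\<integral>\<^sup>+x. liminf (\<lambda>i. ennreal \<bar>s n x - s (r i) x\<bar>) \<partial>M)"
    proof (rule nn_integral_cong_AE)
      show "AE x in M. ennreal \<bar>s n x - A x\<bar> = liminf (\<lambda>i. ennreal \<bar>s n x - s (r i) x\<bar>)"
        using lim
      proof eventually_elim
        case (elim x)
        then have "(\<lambda>i. ennreal \<bar>s n x - s (r i) x\<bar>) \<longlonglongrightarrow> ennreal \<bar>s n x - A x\<bar>"
          by (intro tendsto_ennrealI tendsto_intros)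
        then show ?case by (rule lim_imp_Liminf[OF sequentially_bot, symmetric])
      qed
    qed
    also have "\<dots> \<le> liminf (\<lambda>i. \<integral>\<^sup>+x. ennreal \<bar>s n x - s (r i) x\<bar> \<partial>M)"
      by (rule nn_integral_liminf) measurable
    also have "\<dots> \<le> ennreal e"
    proof (rule order_trans[OF Liminf_le_Limsup Limsup_bounded])
      show "eventually (\<lambda>i. (\<integral>\<^sup>+x. ennreal \<bar>s n x - s (r i) x\<bar> \<partial>M) \<le> ennreal e) sequentially"
        unfolding eventually_sequentially
      proof (intro exI[of _ N] allI impI)
        fix i assume "N \<le> i"
        then have "N \<le> r i" using seq_suble[OF r, of i] by linarith
        then have "(\<integral>x. \<bar>s n x - s (r i) x\<bar> \<partial>M) < e" using N n by blast
        moreover have "(\<integral>\<^sup>+x. ennreal \<bar>s n x - s (r i) x\<bar> \<partial>M) = ennreal (\<integral>x. \<bar>s n x - s (r i) x\<bar> \<partial>M)"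
          using int by (intro nn_integral_eq_integral) auto
        ultimately show "(\<integral>\<^sup>+x. ennreal \<bar>s n x - s (r i) x\<bar> \<partial>M) \<le> ennreal e"
          by (simp add: ennreal_leI)
      qed
    qed simp
    finally show ?thesis .
  qed
  obtain N1 where N1: "\<forall>i\<ge>N1. \<forall>j\<ge>N1. (\<integral>x. \<bar>s i x - s j x\<bar> \<partial>M) < 1" using cauchy[of 1] by auto
  have "integrable M (\<lambda>x. s N1 x - A x)"
  proof (rule integrableI_bounded)
    show "(\<integral>\<^sup>+x. ennreal (norm (s N1 x - A x)) \<partial>M) < \<infinity>"
      using nn[OF N1, of N1] by (simp add: ennreal_1[symmetric] le_less_trans del: ennreal_1)
  qed measurable
  then have Ai: "integrable M A" using int[of N1] Bochner_Integration.integrable_diff[of M "s N1" "\<lambda>x. s N1 x - A x"] by simp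
  have "(\<lambda>n. \<integral>x. \<bar>s n x - A x\<bar> \<partial>M) \<longlonglongrightarrow> 0"
  proof (rule tendstoI)
    fix e :: real assume e: "0 < e"
    obtain N where N: "\<forall>i\<ge>N. \<forall>j\<ge>N. (\<integral>x. \<bar>s i x - s j x\<bar> \<partial>M) < e / 2" using cauchy[of "e / 2"] e by auto
    show "eventually (\<lambda>n. dist (\<integral>x. \<bar>s n x - A x\<bar> \<partial>M) 0 < e) sequentially"
      unfolding eventually_sequentially
    proof (intro exI[of _ N] allI impI)
      fix n assume "N \<le> n"
      from nn[OF N this] have "ennreal (\<integral>x. \<bar>s n x - A x\<bar> \<partial>M) \<le> ennreal (e / 2)"
        using int[of n] Ai by (subst (asm) nn_integral_eq_integral) auto
      then have "(\<integral>x. \<bar>s n x - A x\<bar> \<partial>M) \<le> e / 2" using e by (simp add: ennreal_le_iff)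
      then show "dist (\<integral>x. \<bar>s n x - A x\<bar> \<partial>M) 0 < e" using e by (simp add: dist_norm)
    qed
  qed
  then show thesis using that Ai r lim by blast
qed

section \<open>Series over the limiting eigenvalues\<close>

lemma summable_sqrt_cube: "summable (\<lambda>s. (sqrt (2 / real (Suc s))) ^ 3)"
proof -
  have "summable (\<lambda>s. real (Suc s) powr (- 3/2))"
    using summable_real_powr_iff[of "- 3/2"] summable_Suc_iff[of "\<lambda>s. real s powr (- 3/2)"] by simp
  then have "summable (\<lambda>s. sqrt 2 ^ 3 * real (Suc s) powr (- 3/2))" by (rule summable_mult)
  moreover have "(sqrt (2 / real (Suc s))) ^ 3 = sqrt 2 ^ 3 * real (Suc s) powr (- 3/2)" for s
  proof -
    have "sqrt (real (Suc s)) ^ 3 = real (Suc s) powr (3/2)"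
      by (simp add: powr_half_sqrt[symmetric] powr_power)
    then show ?thesis by (simp add: real_sqrt_divide power_divide powr_minus field_simps)
  qed
  ultimately show ?thesis by simp
qed

lemma abs_le_of_square_times:
  assumes "real (Suc s) * b\<^sup>2 \<le> 2"
  shows "\<bar>b\<bar> \<le> sqrt (2 / real (Suc s))"
proof -
  have "b\<^sup>2 \<le> 2 / real (Suc s)" using assms by (simp add: field_simps)
  then show ?thesis by (metis real_sqrt_abs real_sqrt_le_mono)
qed

text \<open>Tannery's theorem: the eigenvalue decay and the cubic bound on \<open>psi3\<close> give
  a dominating series with exponent 3/2. It serves both for \<open>n\<close> tending to infinity
  with \<open>K\<close> fixed and for \<open>K\<close> tending to infinity.\<close>

lemma psi3_series_tendsto:
  assumes lim: "\<And>s. (\<lambda>n. b n s) \<longlonglongrightarrow> \<beta> s"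
    and bd: "eventually (\<lambda>n. \<forall>s. real (Suc s) * (b n s)\<^sup>2 \<le> 2) sequentially"
  shows "summable (\<lambda>s. psi3 (t * \<beta> s))" "(\<lambda>n. \<Sum>s. psi3 (t * b n s)) \<longlonglongrightarrow> (\<Sum>s. psi3 (t * \<beta> s))"
proof -
  let ?M = "\<lambda>s. \<bar>t\<bar> ^ 3 * (sqrt (2 / real (Suc s))) ^ 3"
  have "eventually (\<lambda>n. summable (\<lambda>s. norm (psi3 (t * b n s)))) sequentially \<and> summable (\<lambda>s. norm (psi3 (t * \<beta> s)))
      \<and> (\<lambda>n. \<Sum>s. psi3 (t * b n s)) \<longlonglongrightarrow> (\<Sum>s. psi3 (t * \<beta> s))"
  proof (rule tannerys_theorem[where M = ?M])
    show "(\<lambda>n. psi3 (t * b n s)) \<longlonglongrightarrow> psi3 (t * \<beta> s)" for s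
      by (rule isCont_tendsto_compose[OF continuous_psi3]) (intro tendsto_intros lim)
    show "eventually (\<lambda>(s, n). norm (psi3 (t * b n s)) \<le> ?M s) (at_top \<times>\<^sub>F sequentially)"
      unfolding eventually_prod_filter
    proof (intro exI conjI allI impI)
      show "eventually (\<lambda>_. True) sequentially" by simp
      show "eventually (\<lambda>n. \<forall>s. real (Suc s) * (b n s)\<^sup>2 \<le> 2) sequentially" by (rule bd)
      fix s n assume "\<forall>s. real (Suc s) * (b n s)\<^sup>2 \<le> 2"
      then have "\<bar>b n s\<bar> \<le> sqrt (2 / real (Suc s))" by (intro abs_le_of_square_times) simp
      then have "\<bar>t * b n s\<bar> ^ 3 \<le> ?M s"
        unfolding abs_mult power_mult_distrib by (intro mult_left_mono power_mono) auto
      then show "case (s, n) of (s, n) \<Rightarrow> norm (psi3 (t * b n s)) \<le> ?M s"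
        using norm_psi3_le[of "t * b n s"] by simp
    qed
    show "summable ?M" by (intro summable_mult summable_sqrt_cube)
  qed simp
  then show "summable (\<lambda>s. psi3 (t * \<beta> s))" "(\<lambda>n. \<Sum>s. psi3 (t * b n s)) \<longlonglongrightarrow> (\<Sum>s. psi3 (t * \<beta> s))"
    by (auto intro: summable_norm_cancel)
qed

lemma psi_eq_psi3: "psi (\<i> * of_real y) = psi3 y - of_real (y\<^sup>2 / 2)"
  by (simp add: psi3_def)

text \<open>The partial sums have product characteristic functions. Each \<open>psi\<close> is split
  into \<open>psi3\<close> and its quadratic term, the form in which the limit of the determinants
  appears, and almost sure convergence carries the formula to \<open>Q\<close>.\<close>

lemma char_weighted_chi_square:
  fixes N :: "'b measure" and Z :: "nat \<Rightarrow> 'b \<Rightarrow> real"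
  assumes N: "prob_space N" and Zm: "\<And>s. Z s \<in> borel_measurable N" and Q: "Q \<in> borel_measurable N"
    and indep: "prob_space.indep_vars N (\<lambda>_. borel) Z {1..}"
    and law: "\<And>s. 1 \<le> s \<Longrightarrow> distr N borel (Z s) = std_normal_distribution"
    and lim: "AE \<omega> in N. (\<lambda>K. (\<Sum>s\<in>{1..K}. \<rho> s * ((Z s \<omega>)\<^sup>2 - 1)) / 2) \<longlonglongrightarrow> Q \<omega>"
    and s2: "summable (\<lambda>s. (\<rho> (Suc s))\<^sup>2)" and s3: "summable (\<lambda>s. psi3 (t * \<rho> (Suc s)))"
  shows "char (distr N borel Q) t
    = exp (((\<Sum>s. psi3 (t * \<rho> (Suc s))) - of_real (t\<^sup>2 / 2 * (\<Sum>s. (\<rho> (Suc s))\<^sup>2))) / 2)"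
proof -
  interpret prob_space N by fact
  note [measurable] = Zm Q
  define S where "S K \<omega> = (\<Sum>s\<in>{1..K}. \<rho> s * ((Z s \<omega>)\<^sup>2 - 1) / 2)" for K \<omega>
  have Sm [measurable]: "S K \<in> borel_measurable N" for K unfolding S_def by measurable
  have charS: "char (distr N borel (S K)) t = exp ((\<Sum>s<K. psi (\<i> * of_real (t * \<rho> (Suc s)))) / 2)" for K
  proof -
    have "indep_vars (\<lambda>_. borel) (\<lambda>s \<omega>. \<rho> s * ((Z s \<omega>)\<^sup>2 - 1) / 2) {1..K}"
      by (rule indep_vars_compose2[OF indep_vars_subset[OF indep]]) auto
    then have "char (distr N borel (S K)) t = (\<Prod>s\<in>{1..K}. char (distr N borel (\<lambda>\<omega>. \<rho> s * ((Z s \<omega>)\<^sup>2 - 1) / 2)) t)"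
      unfolding S_def by (rule char_distr_sum)
    also have "\<dots> = (\<Prod>s\<in>{1..K}. exp (psi (\<i> * of_real (t * \<rho> s)) / 2))"
    proof (intro prod.cong refl)
      fix s assume "s \<in> {1..K}"
      then have l: "distr N borel (Z s) = std_normal_distribution" using law by simp
      have "char (distr N borel (\<lambda>\<omega>. \<rho> s * ((Z s \<omega>)\<^sup>2 - 1) / 2)) t = (\<integral>\<omega>. iexp (t * \<rho> s * ((Z s \<omega>)\<^sup>2 - 1) / 2) \<partial>N)"
        unfolding char_def by (subst integral_distr) (auto simp: mult_ac)
      also have "\<dots> = (\<integral>x. iexp (t * \<rho> s * (x\<^sup>2 - 1) / 2) \<partial>distr N borel (Z s))"
        by (subst integral_distr) auto
      finally show "char (distr N borel (\<lambda>\<omega>. \<rho> s * ((Z s \<omega>)\<^sup>2 - 1) / 2)) t = exp (psi (\<i> * of_real (t * \<rho> s)) / 2)"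
        unfolding l char_centered_square_std_normal .
    qed
    also have "\<dots> = (\<Prod>s<K. exp (psi (\<i> * of_real (t * \<rho> (Suc s))) / 2))"
      by (rule prod.reindex_bij_witness[of _ Suc "\<lambda>s. s - 1"]) auto
    finally show ?thesis by (simp add: exp_sum sum_divide_distrib)
  qed
  have "(\<lambda>K. char (distr N borel (S K)) t) \<longlonglongrightarrow> char (distr N borel Q) t"
  proof -
    have "(\<lambda>K. \<integral>\<omega>. iexp (t * S K \<omega>) \<partial>N) \<longlonglongrightarrow> (\<integral>\<omega>. iexp (t * Q \<omega>) \<partial>N)"
    proof (rule integral_dominated_convergence[where w = "\<lambda>_. 1"])
      show "AE \<omega> in N. (\<lambda>K. iexp (t * S K \<omega>)) \<longlonglongrightarrow> iexp (t * Q \<omega>)"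
        using lim
      proof eventually_elim
        case (elim \<omega>)
        then have "(\<lambda>K. S K \<omega>) \<longlonglongrightarrow> Q \<omega>" unfolding S_def by (simp add: sum_divide_distrib)
        then show ?case by (intro tendsto_intros)
      qed
    qed auto
    then show ?thesis unfolding char_def by (simp add: integral_distr)
  qed
  moreover have "(\<lambda>K. exp ((\<Sum>s<K. psi (\<i> * of_real (t * \<rho> (Suc s)))) / 2))
    \<longlonglongrightarrow> exp (((\<Sum>s. psi3 (t * \<rho> (Suc s))) - of_real (t\<^sup>2 / 2 * (\<Sum>s. (\<rho> (Suc s))\<^sup>2))) / 2)"
  proof -
    have "(\<Sum>s<K. psi (\<i> * of_real (t * \<rho> (Suc s)))) = (\<Sum>s<K. psi3 (t * \<rho> (Suc s))) - of_real (t\<^sup>2 / 2 * (\<Sum>s<K. (\<rho> (Suc s))\<^sup>2))" for K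
      unfolding psi_eq_psi3 by (simp add: sum_subtractf power_mult_distrib sum_distrib_left)
    then show ?thesis
      using summable_LIMSEQ[OF s2] summable_LIMSEQ[OF s3] by (simp only:) (intro tendsto_intros; simp)
  qed
  ultimately show ?thesis unfolding charS by (rule LIMSEQ_unique)
qed

text \<open>\<open>ev s K\<close> names the inner limit of the spectral condition, so that the outer
  limit can be taken as a separate step.\<close>

locale codegree_spectral_limit = prob_space M for M :: "'a measure" +
  fixes X :: "nat \<Rightarrow> 'a \<Rightarrow> real" and G :: "nat \<Rightarrow> nat \<Rightarrow> nat \<Rightarrow> bool"
    and \<sigma> :: "nat \<Rightarrow> nat \<Rightarrow> real" and \<rho> :: "nat \<Rightarrow> real" and ev :: "nat \<Rightarrow> nat \<Rightarrow> real"
  assumes X_meas: "\<And>i. 1 \<le> i \<Longrightarrow> X i \<in> borel_measurable M"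
    and X_indep: "indep_vars (\<lambda>_. borel) X {1..}"
    and X_ident: "\<And>i. 1 \<le> i \<Longrightarrow> distr M borel (X i) = distr M borel (X 1)"
    and X_int: "integrable M (X 1)" and X_mean: "integral\<^sup>L M (X 1) = 0"
    and X_int2: "integrable M (\<lambda>\<omega>. (X 1 \<omega>)\<^sup>2)" and X_var: "integral\<^sup>L M (\<lambda>\<omega>. (X 1 \<omega>)\<^sup>2) = 1"
    and G_class: "\<And>n. 1 \<le> n \<Longrightarrow> in_graph_class n (G n)"
    and E_infty: "filterlim (\<lambda>n. real (num_edges n (G n))) at_top sequentially"
    and codegree: "\<And>s t. 1 \<le> s \<Longrightarrow> 1 \<le> t \<Longrightarrow>
        (\<lambda>n. (\<Sum>v\<in>{1..n}. adj (G n) s v * adj (G n) v t) / real (num_edges n (G n)))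
          \<longlonglongrightarrow> \<sigma> s t"
    and spectral_n: "\<And>s K. 1 \<le> s \<Longrightarrow>
        (\<lambda>n. eigval_nK n K (G n) s / sqrt (real (num_edges n (G n)))) \<longlonglongrightarrow> ev s K"
    and spectral_K: "\<And>s. 1 \<le> s \<Longrightarrow> ev s \<longlonglongrightarrow> \<rho> s"
begin

abbreviation "me n \<equiv> real (num_edges n (G n))"
abbreviation "\<mu> \<equiv> distr M borel (X 1)"
abbreviation "\<sigma>d s \<equiv> \<sigma> (Suc s) (Suc s)"

section \<open>Consequences of the codegree and spectral conditions\<close>

lemma eventually_graph: "eventually (\<lambda>n. ordered_graph n (G n) \<and> N \<le> n) sequentially"
proof -
  have "eventually (\<lambda>n. 0 < me n) sequentially"
    using E_infty unfolding filterlim_at_top_dense by blast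
  then show ?thesis
    using eventually_ge_at_top[of "max 1 N"]
    by eventually_elim (auto simp: ordered_graph_def G_class)
qed

lemma const_div_me: "(\<lambda>n. c / me n) \<longlonglongrightarrow> 0"
  by (rule tendsto_divide_0[OF tendsto_const filterlim_at_top_imp_at_infinity[OF E_infty]])

lemma m_eq: "ordered_graph.m n (G n) = me n" if "ordered_graph n (G n)"
  using that by (simp add: ordered_graph.m_def)

text \<open>Adjacency entries are 0 or 1, so the codegree of a vertex with itself is its
  degree.\<close>

lemma deg_lim: "1 \<le> s \<Longrightarrow> (\<lambda>n. ordered_graph.deg n (G n) s / me n) \<longlonglongrightarrow> \<sigma> s s"
proof (rule Lim_transform_eventually[OF codegree])
  show "eventually (\<lambda>n. (\<Sum>v\<in>{1..n}. adj (G n) s v * adj (G n) v s) / me n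
      = ordered_graph.deg n (G n) s / me n) sequentially"
    using eventually_graph[of 0]
  proof eventually_elim
    case (elim n)
    then interpret ordered_graph n "G n" by simp
    show ?case unfolding deg_def by (simp add: a_sym[of _ s])
  qed
qed auto

lemma sigma_sym:
  assumes "1 \<le> s" "1 \<le> r"
  shows "\<sigma> s r = \<sigma> r s"
proof (rule LIMSEQ_unique[OF codegree[OF assms]])
  have "eventually (\<lambda>n. (\<Sum>v\<in>{1..n}. adj (G n) r v * adj (G n) v s) / me n
      = (\<Sum>v\<in>{1..n}. adj (G n) s v * adj (G n) v r) / me n) sequentially"
    using eventually_graph[of 0]
  proof eventually_elim
    case (elim n)
    then interpret ordered_graph n "G n" by simp
    show ?case by (simp add: a_sym[of _ s] a_sym[of _ r] mult.commute)
  qed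
  then show "(\<lambda>n. (\<Sum>v\<in>{1..n}. adj (G n) s v * adj (G n) v r) / me n) \<longlonglongrightarrow> \<sigma> r s"
    by (rule Lim_transform_eventually[OF codegree[OF assms(2,1)]])
qed

lemma codegree_tail:
  assumes "1 \<le> s" "1 \<le> r"
  shows "(\<lambda>n. (\<Sum>v\<in>{K+1..n}. adj (G n) s v * adj (G n) v r) / me n) \<longlonglongrightarrow> \<sigma> s r"
proof -
  let ?f = "\<lambda>n v. adj (G n) s v * adj (G n) v r"
  have "(\<lambda>n. (\<Sum>v\<in>{1..K}. ?f n v) / me n) \<longlonglongrightarrow> 0"
  proof (rule Lim_null_comparison[OF _ const_div_me[of "real K"]])
    show "eventually (\<lambda>n. norm ((\<Sum>v\<in>{1..K}. ?f n v) / me n) \<le> real K / me n) sequentially"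
    proof (rule always_eventually, rule allI)
      fix n
      have "norm (\<Sum>v\<in>{1..K}. ?f n v) \<le> (\<Sum>v\<in>{1..K}. 1)"
        by (rule sum_norm_le) (simp add: adj_def)
      then show "norm ((\<Sum>v\<in>{1..K}. ?f n v) / me n) \<le> real K / me n"
        by (simp add: divide_right_mono)
    qed
  qed
  from tendsto_diff[OF codegree[OF assms] this]
  have "(\<lambda>n. (\<Sum>v\<in>{1..n}. ?f n v) / me n - (\<Sum>v\<in>{1..K}. ?f n v) / me n) \<longlonglongrightarrow> \<sigma> s r" by simp
  then show ?thesis
  proof (rule Lim_transform_eventually)
    show "eventually (\<lambda>n. (\<Sum>v\<in>{1..n}. ?f n v) / me n - (\<Sum>v\<in>{1..K}. ?f n v) / me n
        = (\<Sum>v\<in>{K+1..n}. ?f n v) / me n) sequentially"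
      using eventually_ge_at_top[of K]
    proof eventually_elim
      case (elim n)
      have "(\<Sum>v\<in>{1..n}. ?f n v) = (\<Sum>v\<in>{1..K}. ?f n v) + (\<Sum>v\<in>{K+1..n}. ?f n v)"
        using elim by (subst sum.union_disjoint[symmetric]) (auto intro!: sum.cong)
      then show ?case by (simp add: diff_divide_distrib[symmetric])
    qed
  qed
qed

lemma sigma_nonneg: "1 \<le> s \<Longrightarrow> 0 \<le> \<sigma> s s"
  by (rule LIMSEQ_le_const[OF codegree]) (auto intro!: exI[of _ 0] divide_nonneg_nonneg sum_nonneg simp: adj_def)

lemma sum_from_1: "(\<Sum>s\<in>{1..K}. f s) = (\<Sum>s<K. f (Suc s))"
  by (simp add: sum.atLeast1_atMost_eq)

text \<open>This is the limit of the sum of all squared scaled eigenvalues, including the mass of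
  those that tend to zero individually.\<close>

lemma tail_edges_lim:
  "(\<lambda>n. (\<Sum>v\<in>{K+1..n}. \<Sum>w\<in>{K+1..n}. adj (G n) v w) / me n) \<longlonglongrightarrow> 2 * (1 - (\<Sum>s<K. \<sigma>d s))"
proof -
  have head: "(\<lambda>n. (\<Sum>s\<in>{1..K}. \<Sum>r\<in>{1..K}. adj (G n) s r) / me n) \<longlonglongrightarrow> 0"
  proof (rule Lim_null_comparison[OF _ const_div_me[of "real K * real K"]])
    show "eventually (\<lambda>n. norm ((\<Sum>s\<in>{1..K}. \<Sum>r\<in>{1..K}. adj (G n) s r) / me n) \<le> real K * real K / me n) sequentially"
    proof (rule always_eventually, rule allI)
      fix n
      have "norm (\<Sum>s\<in>{1..K}. \<Sum>r\<in>{1..K}. adj (G n) s r) \<le> (\<Sum>s\<in>{1..K}. \<Sum>r\<in>{1..K}. 1)"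
        by (intro sum_norm_le) (simp add: adj_def)
      then show "norm ((\<Sum>s\<in>{1..K}. \<Sum>r\<in>{1..K}. adj (G n) s r) / me n) \<le> real K * real K / me n"
        by (simp add: divide_right_mono)
    qed
  qed
  have d: "(\<lambda>n. (\<Sum>s\<in>{1..K}. ordered_graph.deg n (G n) s / me n)) \<longlonglongrightarrow> (\<Sum>s\<in>{1..K}. \<sigma> s s)"
    by (intro tendsto_sum deg_lim) auto
  have "(\<lambda>n. 2 - 2 * (\<Sum>s\<in>{1..K}. ordered_graph.deg n (G n) s / me n)
      + (\<Sum>s\<in>{1..K}. \<Sum>r\<in>{1..K}. adj (G n) s r) / me n) \<longlonglongrightarrow> 2 - 2 * (\<Sum>s\<in>{1..K}. \<sigma> s s) + 0"
    by (intro tendsto_intros d head)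
  then have "(\<lambda>n. 2 - 2 * (\<Sum>s\<in>{1..K}. ordered_graph.deg n (G n) s / me n)
      + (\<Sum>s\<in>{1..K}. \<Sum>r\<in>{1..K}. adj (G n) s r) / me n) \<longlonglongrightarrow> 2 * (1 - (\<Sum>s<K. \<sigma>d s))"
    unfolding sum_from_1[of "\<lambda>s. \<sigma> s s"] by simp
  then show ?thesis
  proof (rule Lim_transform_eventually)
    show "eventually (\<lambda>n. 2 - 2 * (\<Sum>s\<in>{1..K}. ordered_graph.deg n (G n) s / me n)
      + (\<Sum>s\<in>{1..K}. \<Sum>r\<in>{1..K}. adj (G n) s r) / me n
      = (\<Sum>v\<in>{K+1..n}. \<Sum>w\<in>{K+1..n}. adj (G n) v w) / me n) sequentially"
      using eventually_graph[of K]
    proof eventually_elim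
      case (elim n)
      then interpret ordered_graph n "G n" by simp
      have m: "m = me n" by (simp add: m_def)
      show ?case using elim m_pos unfolding tail_edges[OF conjunct2[OF elim]] m
        by (simp only: sum_divide_distrib[symmetric]) (simp add: field_simps)
    qed
  qed
qed

text \<open>The number \<open>S\<close> of eigenvalues is fixed while \<open>n\<close> grows, so
  mass can escape to small eigenvalues and only an inequality survives. This gap is the origin of
  the variance of \<open>Q2\<close>.\<close>

lemma lambda_sum: "(\<Sum>s<S. (ev (Suc s) K)\<^sup>2) \<le> 2 * (1 - (\<Sum>s<K. \<sigma>d s))"
proof (rule tendsto_le[OF sequentially_bot tail_edges_lim])
  show "(\<lambda>n. \<Sum>s<S. (eigval_nK n K (G n) (Suc s) / sqrt (me n))\<^sup>2) \<longlonglongrightarrow> (\<Sum>s<S. (ev (Suc s) K)\<^sup>2)"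
    by (intro tendsto_sum tendsto_power spectral_n) simp
  show "eventually (\<lambda>n. (\<Sum>s<S. (eigval_nK n K (G n) (Suc s) / sqrt (me n))\<^sup>2)
      \<le> (\<Sum>v\<in>{K+1..n}. \<Sum>w\<in>{K+1..n}. adj (G n) v w) / me n) sequentially"
    using eventually_graph[of "K + S"]
  proof eventually_elim
    case (elim n)
    then interpret ordered_graph n "G n" by simp
    have "(\<Sum>s<S. (eigval_nK n K (G n) (Suc s) / sqrt (me n))\<^sup>2) = (\<Sum>s<S. (eigval_nK n K (G n) (Suc s))\<^sup>2) / me n"
      by (simp add: power_divide sum_divide_distrib)
    also have "\<dots> \<le> (\<Sum>s<n - K. (eigval_nK n K (G n) (Suc s))\<^sup>2) / me n"
      using elim by (intro divide_right_mono sum_mono2) auto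
    finally show ?case unfolding sum_eigval_square .
  qed
qed

lemma eigval_scaled_bound:
  assumes "ordered_graph n (G n)"
  shows "real (Suc s) * (eigval_nK n K (G n) (Suc s) / sqrt (me n))\<^sup>2 \<le> 2"
proof -
  interpret ordered_graph n "G n" by fact
  show ?thesis
    using eigval_bound[of s K] m_pos m_eq[OF assms] by (simp add: power_divide divide_le_eq)
qed

lemma lambda_bound: "real (Suc s) * (ev (Suc s) K)\<^sup>2 \<le> 2"
proof (rule tendsto_upperbound[OF _ _ sequentially_bot])
  show "(\<lambda>n. real (Suc s) * (eigval_nK n K (G n) (Suc s) / sqrt (me n))\<^sup>2) \<longlonglongrightarrow> real (Suc s) * (ev (Suc s) K)\<^sup>2"
    by (intro tendsto_mult tendsto_const tendsto_power spectral_n) simp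
  show "eventually (\<lambda>n. real (Suc s) * (eigval_nK n K (G n) (Suc s) / sqrt (me n))\<^sup>2 \<le> 2) sequentially"
    using eventually_graph[of 0] by eventually_elim (rule eigval_scaled_bound, simp)
qed

text \<open>For \<open>K \<ge> S\<close> the deleted head accounts for the first \<open>S\<close>
  diagonal entries of \<open>\<sigma>\<close> and \<open>lambda_sum\<close> for the eigenvalues;
  then \<open>K\<close> tends to infinity with \<open>S\<close> fixed. It makes the variance of
  \<open>Q2\<close> nonnegative.\<close>

lemma partial_sums_le_1: "(\<Sum>s<S. \<sigma>d s + (\<rho> (Suc s))\<^sup>2 / 2) \<le> 1"
proof (rule tendsto_upperbound[OF _ _ sequentially_bot])
  show "(\<lambda>K. \<Sum>s<S. \<sigma>d s + (ev (Suc s) K)\<^sup>2 / 2) \<longlonglongrightarrow> (\<Sum>s<S. \<sigma>d s + (\<rho> (Suc s))\<^sup>2 / 2)"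
    by (intro tendsto_intros spectral_K) simp_all
  show "eventually (\<lambda>K. (\<Sum>s<S. \<sigma>d s + (ev (Suc s) K)\<^sup>2 / 2) \<le> 1) sequentially"
    using eventually_ge_at_top[of S]
  proof eventually_elim
    case (elim K)
    have "(\<Sum>s<S. \<sigma>d s) \<le> (\<Sum>s<K. \<sigma>d s)"
      using elim sigma_nonneg by (intro sum_mono2) auto
    then show ?case
      using lambda_sum[where S = S and K = K] by (simp add: sum.distrib sum_divide_distrib[symmetric])
  qed
qed

lemma summable_total: "summable (\<lambda>s. \<sigma>d s + (\<rho> (Suc s))\<^sup>2 / 2)"
  using partial_sums_le_1 sigma_nonneg by (intro summableI_nonneg_bounded[where x = 1]) (auto intro!: add_nonneg_nonneg)

lemma total_le_1: "(\<Sum>s. \<sigma>d s + (\<rho> (Suc s))\<^sup>2 / 2) \<le> 1"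
  by (rule suminf_le_const[OF summable_total partial_sums_le_1])

lemma summable_sigma: "summable \<sigma>d"
  using sigma_nonneg by (intro summable_comparison_test'[OF summable_total, of 0]) auto

lemma summable_rho: "summable (\<lambda>s. (\<rho> (Suc s))\<^sup>2)"
proof -
  have "summable (\<lambda>s. (\<rho> (Suc s))\<^sup>2 / 2)"
    using sigma_nonneg by (intro summable_comparison_test'[OF summable_total, of 0]) auto
  from summable_mult[OF this, of 2] show ?thesis by simp
qed

lemma sigma_sum_le_1: "(\<Sum>s<S. \<sigma>d s) \<le> 1"
proof -
  have "(\<Sum>s<S. \<sigma>d s) \<le> (\<Sum>s<S. \<sigma>d s + (\<rho> (Suc s))\<^sup>2 / 2)" by (intro sum_mono) simp
  then show ?thesis using partial_sums_le_1[of S] by linarith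
qed

text \<open>The limit in \<open>n\<close> of the determinant factor, followed by its limit in
  \<open>K\<close>. The quadratic part is carried by the edge mass instead of the squares of the
  limiting eigenvalues, so \<open>Finf\<close> contains \<open>Q2\<close> and \<open>Q3\<close>
  together.\<close>

definition Fl :: "real \<Rightarrow> nat \<Rightarrow> complex" where
  "Fl t K = exp (((\<Sum>s. psi3 (t * ev (Suc s) K)) - of_real (t\<^sup>2 * (1 - (\<Sum>s<K. \<sigma>d s)))) / 2)"
definition Finf :: "real \<Rightarrow> complex" where
  "Finf t = exp (((\<Sum>s. psi3 (t * \<rho> (Suc s))) - of_real (t\<^sup>2 * (1 - (\<Sum>s. \<sigma>d s)))) / 2)"

lemma psi3_zero [simp]: "psi3 0 = 0" by (simp add: psi3_def psi_def)

text \<open>The logarithm is a \<open>psi3\<close> sum, which converges by domination, minus half a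
  sum of squares, which has no summable majorant but equals an edge count. Zero padding turns the
  finite sum into a series over a fixed index set.\<close>

lemma F_limit_n:
  "(\<lambda>n. exp ((\<Sum>s<n - K. psi (\<i> * of_real (t * eigval_nK n K (G n) (Suc s) / sqrt (me n)))) / 2)) \<longlonglongrightarrow> Fl t K"
proof -
  define b where "b n s = eigval_nK n K (G n) (Suc s) / sqrt (me n)" for n s
  have l1: "(\<lambda>n. \<Sum>s. psi3 (t * b n s)) \<longlonglongrightarrow> (\<Sum>s. psi3 (t * ev (Suc s) K))"
  proof (rule psi3_series_tendsto(2))
    show "(\<lambda>n. b n s) \<longlonglongrightarrow> ev (Suc s) K" for s unfolding b_def by (rule spectral_n) simp
    show "eventually (\<lambda>n. \<forall>s. real (Suc s) * (b n s)\<^sup>2 \<le> 2) sequentially"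
      using eventually_graph[of 0] unfolding b_def by eventually_elim (use eigval_scaled_bound in blast)
  qed
  have "(\<lambda>n. exp (((\<Sum>s. psi3 (t * b n s)) - of_real (t\<^sup>2 / 2 * ((\<Sum>v\<in>{K+1..n}. \<Sum>w\<in>{K+1..n}. adj (G n) v w) / me n))) / 2))
    \<longlonglongrightarrow> exp (((\<Sum>s. psi3 (t * ev (Suc s) K)) - of_real (t\<^sup>2 / 2 * (2 * (1 - (\<Sum>s<K. \<sigma>d s))))) / 2)"
    by (intro tendsto_intros l1 tail_edges_lim) simp
  moreover have "t\<^sup>2 / 2 * (2 * (1 - (\<Sum>s<K. \<sigma>d s))) = t\<^sup>2 * (1 - (\<Sum>s<K. \<sigma>d s))" by simp
  ultimately have lim: "(\<lambda>n. exp (((\<Sum>s. psi3 (t * b n s)) - of_real (t\<^sup>2 / 2 * ((\<Sum>v\<in>{K+1..n}. \<Sum>w\<in>{K+1..n}. adj (G n) v w) / me n))) / 2))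
    \<longlonglongrightarrow> Fl t K" unfolding Fl_def by (simp only:)
  show ?thesis
  proof (rule Lim_transform_eventually[OF lim])
    show "eventually (\<lambda>n. exp (((\<Sum>s. psi3 (t * b n s)) - of_real (t\<^sup>2 / 2 * ((\<Sum>v\<in>{K+1..n}. \<Sum>w\<in>{K+1..n}. adj (G n) v w) / me n))) / 2)
      = exp ((\<Sum>s<n - K. psi (\<i> * of_real (t * eigval_nK n K (G n) (Suc s) / sqrt (me n)))) / 2)) sequentially"
      using eventually_graph[of 0]
    proof eventually_elim
      case (elim n)
      then interpret ordered_graph n "G n" by simp
      have "psi3 (t * b n s) = 0" if "s \<notin> {..<n - K}" for s
        using that by (simp add: b_def eigval_eq(2))
      then have "(\<Sum>s. psi3 (t * b n s)) = (\<Sum>s<n - K. psi3 (t * b n s))"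
        by (intro suminf_finite) auto
      moreover have "(\<Sum>s<n - K. (t * b n s)\<^sup>2 / 2) = t\<^sup>2 / 2 * ((\<Sum>v\<in>{K+1..n}. \<Sum>w\<in>{K+1..n}. adj (G n) v w) / me n)"
        unfolding sum_eigval_square[symmetric] b_def
        by (simp add: power_mult_distrib power_divide sum_distrib_left sum_divide_distrib mult.commute)
      moreover have "(\<Sum>s<n - K. psi (\<i> * of_real (t * b n s))) = (\<Sum>s<n - K. psi3 (t * b n s)) - of_real (\<Sum>s<n - K. (t * b n s)\<^sup>2 / 2)"
        unfolding psi_eq_psi3 by (simp add: sum_subtractf)
      ultimately show ?case by (simp add: b_def)
    qed
  qed
qed

lemma summable_psi3_rho: "summable (\<lambda>s. psi3 (t * \<rho> (Suc s)))"
  and F_limit_K: "Fl t \<longlonglongrightarrow> Finf t"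
proof -
  have lim: "(\<lambda>K. ev (Suc s) K) \<longlonglongrightarrow> \<rho> (Suc s)" for s using spectral_K[of "Suc s"] by simp
  have bd: "eventually (\<lambda>K. \<forall>s. real (Suc s) * (ev (Suc s) K)\<^sup>2 \<le> 2) sequentially"
    using lambda_bound by simp
  note p = psi3_series_tendsto[OF lim bd]
  show "summable (\<lambda>s. psi3 (t * \<rho> (Suc s)))" by (rule p(1))
  show "Fl t \<longlonglongrightarrow> Finf t"
    unfolding Fl_def Finf_def
    by (intro tendsto_intros p(2) summable_LIMSEQ[OF summable_sigma]) simp
qed

section \<open>Passage from the product space to the given variables\<close>

lemma X_law: "distr M (Pi\<^sub>M {1..n} (\<lambda>_. borel)) (\<lambda>\<omega>. \<lambda>i\<in>{1..n}. X i \<omega>) = Pi\<^sub>M {1..n} (\<lambda>_. \<mu>)" if "1 \<le> n"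
proof -
  have "indep_vars (\<lambda>_. borel) X {1..n}" by (rule indep_vars_subset[OF X_indep]) auto
  then have "distr M (Pi\<^sub>M {1..n} (\<lambda>_. borel)) (\<lambda>\<omega>. \<lambda>i\<in>{1..n}. X i \<omega>) = Pi\<^sub>M {1..n} (\<lambda>i. distr M borel (X i))"
    using that X_meas by (subst (asm) indep_vars_iff_distr_eq_PiM') auto
  also have "\<dots> = Pi\<^sub>M {1..n} (\<lambda>_. \<mu>)" by (intro PiM_cong refl X_ident) simp
  finally show ?thesis .
qed

text \<open>Points of the product space are undefined outside \<open>{1..n}\<close>, unlike the
  whole sequence of the \<open>X i\<close>; the hypothesis \<open>loc\<close> removes the
  restriction.\<close>

lemma transfer:
  fixes f :: "(nat \<Rightarrow> real) \<Rightarrow> 'c::{banach, second_countable_topology}"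
  assumes n: "1 \<le> n" and f: "f \<in> borel_measurable (Pi\<^sub>M {1..n} (\<lambda>_. borel))"
    and loc: "\<And>x x'. (\<And>i. i \<in> {1..n} \<Longrightarrow> x i = x' i) \<Longrightarrow> f x = f x'"
  shows "(\<integral>x. f x \<partial>Pi\<^sub>M {1..n} (\<lambda>_. \<mu>)) = (\<integral>\<omega>. f (\<lambda>i. X i \<omega>) \<partial>M)"
proof -
  have m: "(\<lambda>\<omega>. \<lambda>i\<in>{1..n}. X i \<omega>) \<in> measurable M (Pi\<^sub>M {1..n} (\<lambda>_. borel))"
    using X_meas by (intro measurable_restrict) auto
  have "(\<integral>x. f x \<partial>Pi\<^sub>M {1..n} (\<lambda>_. \<mu>)) = (\<integral>\<omega>. f (\<lambda>i\<in>{1..n}. X i \<omega>) \<partial>M)"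
    unfolding X_law[OF n, symmetric] using m f by (rule integral_distr)
  also have "\<dots> = (\<integral>\<omega>. f (\<lambda>i. X i \<omega>) \<partial>M)"
    by (intro Bochner_Integration.integral_cong refl loc) simp
  finally show ?thesis .
qed

lemma coordinate_meas: "i \<in> {1..n} \<Longrightarrow> (\<lambda>x. x i) \<in> borel_measurable (Pi\<^sub>M {1..n} (\<lambda>_. borel :: real measure))"
  by (rule measurable_component_singleton)

lemma S_meas: "S_G n E \<in> borel_measurable (Pi\<^sub>M {1..n} (\<lambda>_. borel))"
  unfolding S_G_def
  by (intro borel_measurable_times borel_measurable_sum borel_measurable_const coordinate_meas) auto

lemma S_local: "(\<And>i. i \<in> {1..n} \<Longrightarrow> x i = x' i) \<Longrightarrow> S_G n E x = S_G n E x'"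
  unfolding S_G_def by (intro arg_cong2[where f = "(*)"] refl sum.cong) auto

definition phi :: "real \<Rightarrow> nat \<Rightarrow> complex" where
  "phi t n = char (distr M borel (\<lambda>\<omega>. S_G n (G n) (\<lambda>v. X v \<omega>))) t"

lemma S_X_meas: "(\<lambda>\<omega>. S_G n E (\<lambda>v. X v \<omega>)) \<in> borel_measurable M"
  unfolding S_G_def
  by (intro borel_measurable_times borel_measurable_sum borel_measurable_const X_meas) auto

lemma phi_eq: "1 \<le> n \<Longrightarrow> phi t n = (\<integral>x. iexp (t * S_G n (G n) x) \<partial>Pi\<^sub>M {1..n} (\<lambda>_. \<mu>))"
proof -
  assume n: "1 \<le> n"
  have m: "(\<lambda>x. iexp (t * S_G n (G n) x)) \<in> borel_measurable (Pi\<^sub>M {1..n} (\<lambda>_. borel))"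
    using S_meas[of n "G n"] by measurable
  have "phi t n = (\<integral>\<omega>. iexp (t * S_G n (G n) (\<lambda>v. X v \<omega>)) \<partial>M)"
    unfolding phi_def char_def using S_X_meas by (subst integral_distr) auto
  also have "\<dots> = (\<integral>x. iexp (t * S_G n (G n) x) \<partial>Pi\<^sub>M {1..n} (\<lambda>_. \<mu>))"
    by (rule transfer[symmetric, OF n m]) (metis S_local)
  finally show ?thesis .
qed

definition Q :: "nat \<Rightarrow> (nat \<Rightarrow> real) \<Rightarrow> real" where
  "Q K z = (\<Sum>s\<in>{1..K}. \<Sum>r\<in>{1..K}. \<sigma> s r * z s * z r)"

definition qn :: "nat \<Rightarrow> nat \<Rightarrow> nat \<Rightarrow> (nat \<Rightarrow> real) \<Rightarrow> real" where
  "qn n K0 K z = (\<Sum>s\<in>{1..K0}. \<Sum>r\<in>{1..K0}. z s * z r * ((\<Sum>v\<in>{K+1..n}. adj (G n) s v * adj (G n) v r) / me n))"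

text \<open>Codegrees form a Gram matrix, so the form is a sum of squares over the tail
  vertices.\<close>

lemma qn_nonneg: "ordered_graph n (G n) \<Longrightarrow> 0 \<le> qn n K0 K z"
proof -
  assume "ordered_graph n (G n)"
  then interpret ordered_graph n "G n" .
  have "qn n K0 K z = (\<Sum>s\<in>{1..K0}. \<Sum>r\<in>{1..K0}. \<Sum>v\<in>{K+1..n}. (z s * a s v) * (z r * a r v) / me n)"
    unfolding qn_def by (simp add: sum_divide_distrib sum_distrib_left a_sym mult_ac)
  also have "\<dots> = (\<Sum>s\<in>{1..K0}. \<Sum>v\<in>{K+1..n}. \<Sum>r\<in>{1..K0}. (z s * a s v) * (z r * a r v) / me n)"
    by (intro sum.cong refl sum.swap)
  also have "\<dots> = (\<Sum>v\<in>{K+1..n}. \<Sum>s\<in>{1..K0}. \<Sum>r\<in>{1..K0}. (z s * a s v) * (z r * a r v) / me n)"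
    by (rule sum.swap)
  also have "\<dots> = (\<Sum>v\<in>{K+1..n}. (\<Sum>s\<in>{1..K0}. z s * a s v)\<^sup>2 / me n)"
    by (simp add: power2_eq_square sum_product sum_divide_distrib)
  also have "\<dots> \<ge> 0" by (intro sum_nonneg) simp
  finally show ?thesis .
qed

lemma qn_lim: "(\<lambda>n. qn n K0 K z) \<longlonglongrightarrow> Q K0 z"
proof -
  have "(\<lambda>n. qn n K0 K z) \<longlonglongrightarrow> (\<Sum>s\<in>{1..K0}. \<Sum>r\<in>{1..K0}. z s * z r * \<sigma> s r)"
    unfolding qn_def by (intro tendsto_sum tendsto_mult tendsto_const codegree_tail) auto
  then show ?thesis unfolding Q_def by (simp add: mult_ac)
qed

text \<open>A pointwise limit of Gram forms. It makes the Gaussian factors bounded by one.\<close>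

lemma Q_nonneg: "0 \<le> Q K z"
proof (rule tendsto_lowerbound[OF qn_lim[of K 0 z] _ sequentially_bot])
  show "eventually (\<lambda>n. 0 \<le> qn n K 0 z) sequentially"
    using eventually_graph[of 0] by eventually_elim (simp add: qn_nonneg)
qed

lemma Q_meas:
  assumes "\<And>i. 1 \<le> i \<Longrightarrow> Y i \<in> borel_measurable M"
  shows "(\<lambda>\<omega>. Q K (\<lambda>i. Y i \<omega>)) \<in> borel_measurable M"
  unfolding Q_def using assms
  by (intro borel_measurable_times borel_measurable_sum borel_measurable_const) auto

text \<open>With \<open>K0\<close>, \<open>K\<close> and the truncation fixed, the
  \<open>K\<^sup>2\<close> pairs inside the head vanish against the edge count, and removing
  \<open>K\<close> middle vertices does not change the codegree limits.\<close>

lemma limit_n: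
  assumes t: "t \<noteq> 0" and K: "1 \<le> K0" "K0 \<le> K"
    and xi: "\<xi> \<in> borel_measurable borel" "\<And>x. \<bar>\<xi> x\<bar> \<le> T" "1 \<le> T" "(\<integral>x. \<xi> x \<partial>\<mu>) = 0" "(\<integral>x. (\<xi> x)\<^sup>2 \<partial>\<mu>) = 1"
  shows "limsup_dist_le (phi t) (of_real (\<integral>\<omega>. exp (- t\<^sup>2 / 2 * Q K0 (\<lambda>i. \<xi> (X i \<omega>))) \<partial>M) * Fl t K)
    (\<bar>t\<bar> * sqrt (2 * \<bar>1 - (\<integral>x. x * \<xi> x \<partial>\<mu>)\<^sup>2\<bar> + (\<Sum>s\<in>{K0<..K}. \<sigma> s s))
      + (9 * T ^ 5 * (\<bar>t\<bar> * sqrt (2 / K)) * (2 * t\<^sup>2) + 2 * (2 * t\<^sup>2 * sqrt (K0 / K))))"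
proof (rule limsup_dist_leI)
  have X1: "X 1 \<in> borel_measurable M" using X_meas by simp
  have bis: "bounded_iid_sq \<mu> \<xi> T {1..n}" for n
  proof -
    have "prob_space \<mu>" using X1 by (rule prob_space_distr)
    moreover have "integrable \<mu> (\<lambda>x. x\<^sup>2)" using X1 X_int2 by (subst integrable_distr_eq) auto
    moreover have "(\<integral>x. x \<partial>\<mu>) = 0" using X1 X_mean by (subst integral_distr) auto
    moreover have "(\<integral>x. x\<^sup>2 \<partial>\<mu>) = 1" using X1 X_var by (subst integral_distr) auto
    ultimately show ?thesis
      unfolding bounded_iid_sq_def bounded_iid_def bounded_iid_sq_axioms_def using xi by simp
  qed
  define Bn where "Bn n = \<bar>t\<bar> * sqrt (2 * \<bar>1 - (\<integral>x. x * \<xi> x \<partial>\<mu>)\<^sup>2\<bar> + ((real K)\<^sup>2 / me n + (\<Sum>s\<in>{K0<..K}. ordered_graph.deg n (G n) s / me n)))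
      + (9 * T ^ 5 * (\<bar>t\<bar> * sqrt (2 / K)) * (2 * t\<^sup>2) + 2 * (2 * t\<^sup>2 * sqrt (K0 / K)))" for n
  define cn where "cn n = (\<integral>\<omega>. exp (- t\<^sup>2 / 2 * qn n K0 K (\<lambda>i. \<xi> (X i \<omega>))) \<partial>M)" for n
  define Fn where "Fn n = exp ((\<Sum>s<n - K. psi (\<i> * of_real (t * eigval_nK n K (G n) (Suc s) / sqrt (me n)))) / 2)" for n
  have xm: "(\<lambda>\<omega>. \<xi> (X i \<omega>)) \<in> borel_measurable M" if "1 \<le> i" for i
    using xi(1) X_meas[OF that] by measurable
  have qm: "(\<lambda>\<omega>. qn n K0 K (\<lambda>i. \<xi> (X i \<omega>))) \<in> borel_measurable M" for n
    unfolding qn_def by (intro borel_measurable_times borel_measurable_sum borel_measurable_const xm) auto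
  show "eventually (\<lambda>n. cmod (phi t n - of_real (cn n) * Fn n) \<le> Bn n) sequentially"
    using eventually_graph[of "max 1 K"]
  proof eventually_elim
    case (elim n)
    then interpret ordered_graph n "G n" by simp
    interpret gf: graph_form \<mu> \<xi> T n "G n"
      using bis by (simp add: graph_form_def ordered_graph_axioms)
    have n: "1 \<le> n" "K \<le> n" using elim by auto
    have m: "m = me n" by (simp add: m_def)
    have Qn: "gf.Qn K0 K (\<lambda>i. gf.y i x) = qn n K0 K (\<lambda>i. \<xi> (x i))" for x
      unfolding gf.Qn_def qn_def gf.y_def m ..
    have qmP: "(\<lambda>x. qn n K0 K (\<lambda>i. \<xi> (x i))) \<in> borel_measurable (Pi\<^sub>M {1..n} (\<lambda>_. borel))"
    proof -
      have "(\<lambda>x. \<xi> (x i)) \<in> borel_measurable (Pi\<^sub>M {1..n} (\<lambda>_. borel))" if "i \<in> {1..n}" for i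
        using measurable_compose[OF coordinate_meas[OF that] xi(1)] .
      then show ?thesis
        unfolding qn_def using K n
        by (intro borel_measurable_times borel_measurable_sum borel_measurable_const) auto
    qed
    have "(\<integral>x. exp (- t\<^sup>2 / 2 * gf.Qn K0 K (\<lambda>i. gf.y i x)) \<partial>Pi\<^sub>M {1..n} (\<lambda>_. \<mu>)) = cn n"
      unfolding Qn cn_def
    proof (rule transfer[OF n(1)])
      show "(\<lambda>x. exp (- t\<^sup>2 / 2 * qn n K0 K (\<lambda>i. \<xi> (x i)))) \<in> borel_measurable (Pi\<^sub>M {1..n} (\<lambda>_. borel))"
        using qmP by measurable
      fix x x' :: "nat \<Rightarrow> real" assume "\<And>i. i \<in> {1..n} \<Longrightarrow> x i = x' i"
      then show "exp (- t\<^sup>2 / 2 * qn n K0 K (\<lambda>i. \<xi> (x i))) = exp (- t\<^sup>2 / 2 * qn n K0 K (\<lambda>i. \<xi> (x' i)))"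
        unfolding qn_def using K n by (intro arg_cong[of _ _ "\<lambda>z. exp (- t\<^sup>2 / 2 * z)"] sum.cong refl) auto
    qed
    moreover have "((real K)\<^sup>2 + (\<Sum>s\<in>{K0<..K}. deg s)) / me n = (real K)\<^sup>2 / me n + (\<Sum>s\<in>{K0<..K}. deg s / me n)"
      by (simp add: add_divide_distrib sum_divide_distrib)
    ultimately show ?case
      using gf.char_approximation[OF t K n(2)] unfolding phi_eq[OF n(1)] Fn_def Bn_def m gf.kap_def by simp
  qed
  have "cn \<longlonglongrightarrow> (\<integral>\<omega>. exp (- t\<^sup>2 / 2 * Q K0 (\<lambda>i. \<xi> (X i \<omega>))) \<partial>M)"
  proof -
    \<comment> \<open>Nonnegativity of \<open>qn\<close>, hence domination by one, holds only from
      some index on, so the sequence is shifted first.\<close>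
    obtain n0 where n0: "\<And>n. n0 \<le> n \<Longrightarrow> ordered_graph n (G n)"
      using eventually_graph[of 0] unfolding eventually_sequentially by blast
    have "(\<lambda>n. cn (n + n0)) \<longlonglongrightarrow> (\<integral>\<omega>. exp (- t\<^sup>2 / 2 * Q K0 (\<lambda>i. \<xi> (X i \<omega>))) \<partial>M)"
      unfolding cn_def
    proof (rule integral_dominated_convergence[where w = "\<lambda>_. 1"])
      show "(\<lambda>\<omega>. exp (- t\<^sup>2 / 2 * Q K0 (\<lambda>i. \<xi> (X i \<omega>)))) \<in> borel_measurable M"
        using Q_meas[where Y = "\<lambda>i \<omega>. \<xi> (X i \<omega>)" and K = K0, OF xm] by measurable
      show "(\<lambda>\<omega>. exp (- t\<^sup>2 / 2 * qn (n + n0) K0 K (\<lambda>i. \<xi> (X i \<omega>)))) \<in> borel_measurable M" for n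
        using qm[of "n + n0"] by measurable
      show "AE \<omega> in M. (\<lambda>n. exp (- t\<^sup>2 / 2 * qn (n + n0) K0 K (\<lambda>i. \<xi> (X i \<omega>)))) \<longlonglongrightarrow> exp (- t\<^sup>2 / 2 * Q K0 (\<lambda>i. \<xi> (X i \<omega>)))"
        by (intro AE_I2 tendsto_exp tendsto_mult tendsto_const LIMSEQ_ignore_initial_segment qn_lim)
      show "AE \<omega> in M. norm (exp (- t\<^sup>2 / 2 * qn (n + n0) K0 K (\<lambda>i. \<xi> (X i \<omega>)))) \<le> 1" for n
        using qn_nonneg[OF n0[of "n + n0"]] by (intro AE_I2) simp
    qed simp
    then show ?thesis by (rule LIMSEQ_offset)
  qed
  then show "(\<lambda>n. of_real (cn n) * Fn n) \<longlonglongrightarrow> of_real (\<integral>\<omega>. exp (- t\<^sup>2 / 2 * Q K0 (\<lambda>i. \<xi> (X i \<omega>))) \<partial>M) * Fl t K"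
    unfolding Fn_def by (intro tendsto_mult tendsto_of_real F_limit_n)
  have "Bn \<longlonglongrightarrow> \<bar>t\<bar> * sqrt (2 * \<bar>1 - (\<integral>x. x * \<xi> x \<partial>\<mu>)\<^sup>2\<bar> + (0 + (\<Sum>s\<in>{K0<..K}. \<sigma> s s)))
      + (9 * T ^ 5 * (\<bar>t\<bar> * sqrt (2 / K)) * (2 * t\<^sup>2) + 2 * (2 * t\<^sup>2 * sqrt (K0 / K)))"
    unfolding Bn_def
    by (intro tendsto_add tendsto_mult tendsto_const tendsto_real_sqrt tendsto_sum const_div_me deg_lim) auto
  then show "Bn \<longlonglongrightarrow> \<bar>t\<bar> * sqrt (2 * \<bar>1 - (\<integral>x. x * \<xi> x \<partial>\<mu>)\<^sup>2\<bar> + (\<Sum>s\<in>{K0<..K}. \<sigma> s s))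
      + (9 * T ^ 5 * (\<bar>t\<bar> * sqrt (2 / K)) * (2 * t\<^sup>2) + 2 * (2 * t\<^sup>2 * sqrt (K0 / K)))"
    by simp
qed

definition tail :: "nat \<Rightarrow> real" where "tail K = (\<Sum>s. \<sigma>d s) - (\<Sum>s<K. \<sigma>d s)"

lemma sigma_block: "K0 \<le> K \<Longrightarrow> (\<Sum>s\<in>{K0<..K}. \<sigma> s s) = (\<Sum>s<K. \<sigma>d s) - (\<Sum>s<K0. \<sigma>d s)"
proof -
  assume K: "K0 \<le> K"
  have "(\<Sum>s\<in>{1..K}. \<sigma> s s) = (\<Sum>s\<in>{1..K0}. \<sigma> s s) + (\<Sum>s\<in>{K0<..K}. \<sigma> s s)"
    using K by (subst sum.union_disjoint[symmetric]) (auto intro!: sum.cong)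
  then show ?thesis unfolding sum_from_1 by simp
qed

text \<open>\<open>T\<close> and \<open>K0\<close> are fixed, so \<open>T ^ 5 / sqrt K\<close> and
  \<open>sqrt (K0 / K)\<close> both vanish. The first factor involves only \<open>K0\<close> and is
  untouched, while the deleted edges leave the whole tail of the \<open>\<sigma>\<close>
  series.\<close>

lemma limit_K:
  assumes t: "t \<noteq> 0" and K: "1 \<le> K0"
    and xi: "\<xi> \<in> borel_measurable borel" "\<And>x. \<bar>\<xi> x\<bar> \<le> T" "1 \<le> T" "(\<integral>x. \<xi> x \<partial>\<mu>) = 0" "(\<integral>x. (\<xi> x)\<^sup>2 \<partial>\<mu>) = 1"
  shows "limsup_dist_le (phi t) (of_real (\<integral>\<omega>. exp (- t\<^sup>2 / 2 * Q K0 (\<lambda>i. \<xi> (X i \<omega>))) \<partial>M) * Finf t)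
    (\<bar>t\<bar> * sqrt (2 * \<bar>1 - (\<integral>x. x * \<xi> x \<partial>\<mu>)\<^sup>2\<bar> + tail K0))"
proof (rule limsup_dist_le_limit)
  let ?b = "\<lambda>K. \<bar>t\<bar> * sqrt (2 * \<bar>1 - (\<integral>x. x * \<xi> x \<partial>\<mu>)\<^sup>2\<bar> + ((\<Sum>s<K. \<sigma>d s) - (\<Sum>s<K0. \<sigma>d s)))
      + (9 * T ^ 5 * (\<bar>t\<bar> * sqrt (2 / real K)) * (2 * t\<^sup>2) + 2 * (2 * t\<^sup>2 * sqrt (real K0 / real K)))"
  show "eventually (\<lambda>K. limsup_dist_le (phi t) (of_real (\<integral>\<omega>. exp (- t\<^sup>2 / 2 * Q K0 (\<lambda>i. \<xi> (X i \<omega>))) \<partial>M) * Fl t K) (?b K)) sequentially"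
    using eventually_ge_at_top[of K0]
  proof eventually_elim
    case (elim k)
    show ?case using limit_n[OF t K elim xi] unfolding sigma_block[OF elim] .
  qed
  show "(\<lambda>K. of_real (\<integral>\<omega>. exp (- t\<^sup>2 / 2 * Q K0 (\<lambda>i. \<xi> (X i \<omega>))) \<partial>M) * Fl t K)
      \<longlonglongrightarrow> of_real (\<integral>\<omega>. exp (- t\<^sup>2 / 2 * Q K0 (\<lambda>i. \<xi> (X i \<omega>))) \<partial>M) * Finf t"
    by (intro tendsto_mult tendsto_const F_limit_K)
  have c0: "(\<lambda>K. c / real K) \<longlonglongrightarrow> 0" for c by (rule lim_const_over_n)
  have "?b \<longlonglongrightarrow> \<bar>t\<bar> * sqrt (2 * \<bar>1 - (\<integral>x. x * \<xi> x \<partial>\<mu>)\<^sup>2\<bar> + ((\<Sum>s. \<sigma>d s) - (\<Sum>s<K0. \<sigma>d s)))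
      + (9 * T ^ 5 * (\<bar>t\<bar> * sqrt 0) * (2 * t\<^sup>2) + 2 * (2 * t\<^sup>2 * sqrt 0))"
    by (intro tendsto_add tendsto_diff tendsto_mult tendsto_const tendsto_real_sqrt c0 summable_LIMSEQ[OF summable_sigma])
  then show "?b \<longlonglongrightarrow> \<bar>t\<bar> * sqrt (2 * \<bar>1 - (\<integral>x. x * \<xi> x \<partial>\<mu>)\<^sup>2\<bar> + tail K0)" by (simp add: tail_def)
qed

text \<open>The bound of \<open>limit_K\<close> no longer contains \<open>T\<close>, so the
  truncation can be removed: the correlation tends to one, and the Gaussian factor converges by
  domination because the form is nonnegative.\<close>

lemma limit_truncation:
  assumes t: "t \<noteq> 0" and K: "1 \<le> K0"
  shows "limsup_dist_le (phi t) (of_real (\<integral>\<omega>. exp (- t\<^sup>2 / 2 * Q K0 (\<lambda>i. X i \<omega>)) \<partial>M) * Finf t)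
    (\<bar>t\<bar> * sqrt (tail K0))"
proof -
  have X1: "X 1 \<in> borel_measurable M" using X_meas by simp
  have 1: "prob_space \<mu>" using X1 by (rule prob_space_distr)
  have 2: "integrable \<mu> (\<lambda>x. x\<^sup>2)" using X1 X_int2 by (subst integrable_distr_eq) auto
  have 3: "(\<integral>x. x \<partial>\<mu>) = 0" using X1 X_mean by (subst integral_distr) auto
  have 4: "(\<integral>x. x\<^sup>2 \<partial>\<mu>) = 1" using X1 X_var by (subst integral_distr) auto
  show ?thesis
  proof (rule standardized_truncation_exists[OF 1 _ 2 3 4])
    show "sets \<mu> = sets borel" by simp
    fix \<xi> :: "nat \<Rightarrow> real \<Rightarrow> real" and T :: "nat \<Rightarrow> real"
    assume xi: "\<And>k. \<xi> k \<in> borel_measurable borel" "\<And>k x. \<bar>\<xi> k x\<bar> \<le> T k" "\<And>k. 1 \<le> T k"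
      "\<And>k. (\<integral>x. \<xi> k x \<partial>\<mu>) = 0" "\<And>k. (\<integral>x. (\<xi> k x)\<^sup>2 \<partial>\<mu>) = 1"
      and xl: "\<And>x. (\<lambda>k. \<xi> k x) \<longlonglongrightarrow> x" and kl: "(\<lambda>k. \<integral>x. x * \<xi> k x \<partial>\<mu>) \<longlonglongrightarrow> 1"
    show ?thesis
  proof (rule limsup_dist_le_limit)
    show "eventually (\<lambda>k. limsup_dist_le (phi t) (of_real (\<integral>\<omega>. exp (- t\<^sup>2 / 2 * Q K0 (\<lambda>i. \<xi> k (X i \<omega>))) \<partial>M) * Finf t)
       (\<bar>t\<bar> * sqrt (2 * \<bar>1 - (\<integral>x. x * \<xi> k x \<partial>\<mu>)\<^sup>2\<bar> + tail K0))) sequentially"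
      by (intro always_eventually allI limit_K[OF t K xi])
    have "(\<lambda>k. \<integral>\<omega>. exp (- t\<^sup>2 / 2 * Q K0 (\<lambda>i. \<xi> k (X i \<omega>))) \<partial>M) \<longlonglongrightarrow> (\<integral>\<omega>. exp (- t\<^sup>2 / 2 * Q K0 (\<lambda>i. X i \<omega>)) \<partial>M)"
    proof (rule integral_dominated_convergence[where w = "\<lambda>_. 1"])
      show "(\<lambda>\<omega>. exp (- t\<^sup>2 / 2 * Q K0 (\<lambda>i. X i \<omega>))) \<in> borel_measurable M"
        using Q_meas[where Y = X and K = K0, OF X_meas] by measurable
      show "(\<lambda>\<omega>. exp (- t\<^sup>2 / 2 * Q K0 (\<lambda>i. \<xi> k (X i \<omega>)))) \<in> borel_measurable M" for k
      proof -
        have "(\<lambda>\<omega>. \<xi> k (X i \<omega>)) \<in> borel_measurable M" if "1 \<le> i" for i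
          using xi(1)[of k] X_meas[OF that] by measurable
        from Q_meas[where Y = "\<lambda>i \<omega>. \<xi> k (X i \<omega>)" and K = K0, OF this] show ?thesis by measurable
      qed
      show "AE \<omega> in M. (\<lambda>k. exp (- t\<^sup>2 / 2 * Q K0 (\<lambda>i. \<xi> k (X i \<omega>)))) \<longlonglongrightarrow> exp (- t\<^sup>2 / 2 * Q K0 (\<lambda>i. X i \<omega>))"
        unfolding Q_def by (intro AE_I2 tendsto_exp tendsto_mult tendsto_const tendsto_sum xl)
      show "AE \<omega> in M. norm (exp (- t\<^sup>2 / 2 * Q K0 (\<lambda>i. \<xi> k (X i \<omega>)))) \<le> 1" for k
        using Q_nonneg by (intro AE_I2) simp
    qed simp
    then show "(\<lambda>k. of_real (\<integral>\<omega>. exp (- t\<^sup>2 / 2 * Q K0 (\<lambda>i. \<xi> k (X i \<omega>))) \<partial>M) * Finf t)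
      \<longlonglongrightarrow> of_real (\<integral>\<omega>. exp (- t\<^sup>2 / 2 * Q K0 (\<lambda>i. X i \<omega>)) \<partial>M) * Finf t"
      by (intro tendsto_mult tendsto_of_real tendsto_const)
    have "(\<lambda>k. \<bar>t\<bar> * sqrt (2 * \<bar>1 - (\<integral>x. x * \<xi> k x \<partial>\<mu>)\<^sup>2\<bar> + tail K0)) \<longlonglongrightarrow> \<bar>t\<bar> * sqrt (2 * \<bar>1 - 1\<^sup>2\<bar> + tail K0)"
      by (intro tendsto_mult tendsto_add tendsto_diff tendsto_const tendsto_real_sqrt tendsto_rabs tendsto_power kl)
    then show "(\<lambda>k. \<bar>t\<bar> * sqrt (2 * \<bar>1 - (\<integral>x. x * \<xi> k x \<partial>\<mu>)\<^sup>2\<bar> + tail K0)) \<longlonglongrightarrow> \<bar>t\<bar> * sqrt (tail K0)"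
      by simp
  qed
  qed
qed

lemma tail_lim: "tail \<longlonglongrightarrow> 0"
  unfolding tail_def using tendsto_diff[OF tendsto_const[of "suminf \<sigma>d"] summable_LIMSEQ[OF summable_sigma]] by simp

text \<open>Only the tail of a convergent series is left in the bound, so the last cut-off can go;
  the limit \<open>a\<close> of the first factor is supplied by the \<open>L\<^sup>1\<close>
  construction.\<close>

lemma limit_char:
  assumes t: "t \<noteq> 0"
    and A: "(\<lambda>K. \<integral>\<omega>. exp (- t\<^sup>2 / 2 * Q K (\<lambda>i. X i \<omega>)) \<partial>M) \<longlonglongrightarrow> a"
  shows "phi t \<longlonglongrightarrow> of_real a * Finf t"
proof (rule limsup_dist_le_zero, rule limsup_dist_le_limit)
  show "eventually (\<lambda>K. limsup_dist_le (phi t) (of_real (\<integral>\<omega>. exp (- t\<^sup>2 / 2 * Q K (\<lambda>i. X i \<omega>)) \<partial>M) * Finf t) (\<bar>t\<bar> * sqrt (tail K))) sequentially"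
    using eventually_ge_at_top[of 1] by eventually_elim (rule limit_truncation[OF t])
  show "(\<lambda>K. of_real (\<integral>\<omega>. exp (- t\<^sup>2 / 2 * Q K (\<lambda>i. X i \<omega>)) \<partial>M) * Finf t) \<longlonglongrightarrow> of_real a * Finf t"
    by (intro tendsto_mult tendsto_of_real tendsto_const A)
  show "(\<lambda>K. \<bar>t\<bar> * sqrt (tail K)) \<longlonglongrightarrow> 0"
    using tendsto_mult[OF tendsto_const tendsto_real_sqrt[OF tail_lim], of "\<bar>t\<bar>"] by simp
qed

end

section \<open>The random variance of the first component\<close>

context codegree_spectral_limit
begin

lemma X_moments:
  assumes "1 \<le> i"
  shows "integrable M (X i)" "integral\<^sup>L M (X i) = 0"
    "integrable M (\<lambda>\<omega>. (X i \<omega>)\<^sup>2)" "(\<integral>\<omega>. (X i \<omega>)\<^sup>2 \<partial>M) = 1"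
proof -
  have X1: "X 1 \<in> borel_measurable M" using X_meas by simp
  have i: "integrable M (\<lambda>\<omega>. f (X i \<omega>)) \<longleftrightarrow> integrable M (\<lambda>\<omega>. f (X 1 \<omega>))"
    if f: "f \<in> borel_measurable borel" for f :: "real \<Rightarrow> real"
  proof -
    have "integrable M (\<lambda>\<omega>. f (X i \<omega>)) \<longleftrightarrow> integrable (distr M borel (X i)) f"
      by (rule integrable_distr_eq[OF X_meas[OF assms] f, symmetric])
    also have "\<dots> \<longleftrightarrow> integrable M (\<lambda>\<omega>. f (X 1 \<omega>))"
      unfolding X_ident[OF assms] by (rule integrable_distr_eq[OF X1 f])
    finally show ?thesis .
  qed
  have e: "(\<integral>\<omega>. f (X i \<omega>) \<partial>M) = (\<integral>\<omega>. f (X 1 \<omega>) \<partial>M)"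
    if f: "f \<in> borel_measurable borel" for f :: "real \<Rightarrow> real"
  proof -
    have "(\<integral>\<omega>. f (X i \<omega>) \<partial>M) = (\<integral>x. f x \<partial>distr M borel (X i))"
      by (rule integral_distr[OF X_meas[OF assms] f, symmetric])
    also have "\<dots> = (\<integral>\<omega>. f (X 1 \<omega>) \<partial>M)"
      unfolding X_ident[OF assms] by (rule integral_distr[OF X1 f])
    finally show ?thesis .
  qed
  show "integrable M (X i)" "integral\<^sup>L M (X i) = 0"
    using i[of "\<lambda>x. x"] e[of "\<lambda>x. x"] X_int X_mean by auto
  show "integrable M (\<lambda>\<omega>. (X i \<omega>)\<^sup>2)" "(\<integral>\<omega>. (X i \<omega>)\<^sup>2 \<partial>M) = 1"
    using i[of "\<lambda>x. x\<^sup>2"] e[of "\<lambda>x. x\<^sup>2"] X_int2 X_var by auto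
qed

lemma X_product:
  assumes s: "1 \<le> s" and r: "1 \<le> r"
  shows "integrable M (\<lambda>\<omega>. X s \<omega> * X r \<omega>)" "(\<integral>\<omega>. X s \<omega> * X r \<omega> \<partial>M) = (if s = r then 1 else 0)"
proof -
  have "integrable M (\<lambda>\<omega>. X s \<omega> * X r \<omega>) \<and> (\<integral>\<omega>. X s \<omega> * X r \<omega> \<partial>M) = (if s = r then 1 else 0)"
  proof (cases "s = r")
    case True
    then show ?thesis using X_moments[OF r] by (simp add: power2_eq_square)
  next
    case False
    have "indep_vars (\<lambda>_. borel) X (insert s {r})"
      by (rule indep_vars_subset[OF X_indep]) (use s r in auto)
    from indep_vars_sum[OF _ _ this] have "indep_var borel (X s) borel (X r)" using False by simp
    then show ?thesis
      using indep_var_integrable[of "X s" "X r"] indep_var_lebesgue_integral[of "X s" "X r"]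
        X_moments[OF s] X_moments[OF r] False by simp
  qed
  then show "integrable M (\<lambda>\<omega>. X s \<omega> * X r \<omega>)" "(\<integral>\<omega>. X s \<omega> * X r \<omega> \<partial>M) = (if s = r then 1 else 0)"
    by auto
qed

text \<open>The polar form of \<open>Q\<close>.\<close>

definition bl :: "nat \<Rightarrow> (nat \<Rightarrow> real) \<Rightarrow> (nat \<Rightarrow> real) \<Rightarrow> real" where
  "bl K u v = (\<Sum>s\<in>{1..K}. \<Sum>r\<in>{1..K}. \<sigma> s r * u s * v r)"

lemma Q_bl: "Q K z = bl K z z" by (simp add: Q_def bl_def)

lemma bl_sym: "bl K u v = bl K v u"
proof -
  have "bl K u v = (\<Sum>s\<in>{1..K}. \<Sum>r\<in>{1..K}. \<sigma> r s * v r * u s)"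
    unfolding bl_def
  proof (intro sum.cong refl)
    fix s r assume "s \<in> {1..K}" "r \<in> {1..K}"
    then have "\<sigma> s r = \<sigma> r s" by (intro sigma_sym) auto
    then show "\<sigma> s r * u s * v r = \<sigma> r s * v r * u s" by simp
  qed
  also have "\<dots> = bl K v u" unfolding bl_def by (rule sum.swap)
  finally show ?thesis .
qed

lemma bl_left: "bl K (\<lambda>s. a * u s + b * w s) v = a * bl K u v + b * bl K w v"
  unfolding bl_def by (simp add: sum_distrib_left sum.distrib[symmetric] algebra_simps)

lemma bl_right: "bl K v (\<lambda>s. a * u s + b * w s) = a * bl K v u + b * bl K v w"
  unfolding bl_sym[of K v] by (rule bl_left)

lemma Q_combination: "Q K (\<lambda>s. a * u s + b * w s) = a\<^sup>2 * Q K u + 2 * a * b * bl K u w + b\<^sup>2 * Q K w"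
  unfolding Q_bl bl_left bl_right bl_sym[of K w u] by (simp add: power2_eq_square algebra_simps)

text \<open>\<open>Q K y - Q K x\<close> is the polar form at \<open>y + x\<close> and
  \<open>y - x\<close>; then Cauchy--Schwarz for the semidefinite form in additive shape, with a
  weight \<open>h\<close> to be chosen later.\<close>

lemma Q_diff_bound:
  assumes "0 < h"
  shows "\<bar>Q K y - Q K x\<bar> \<le> (h * Q K (\<lambda>s. y s + x s) + Q K (\<lambda>s. y s - x s) / h) / 2"
proof -
  define v where "v s = y s + x s" for s
  define u where "u s = y s - x s" for s
  \<comment> \<open>The factor 4 comes from \<open>2 y = v + u\<close> and
    \<open>2 x = v - u\<close>; the instances with second coefficient 2 or 0 serve only to evaluate
    the form at a doubled vector.\<close>
  have "4 * Q K y = Q K v + 2 * bl K v u + Q K u"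
    using Q_combination[of K 1 v 1 u] Q_combination[of K 2 y 0 y] by (simp add: v_def u_def)
  moreover have "4 * Q K x = Q K v - 2 * bl K v u + Q K u"
    using Q_combination[of K 1 v "-1" u] Q_combination[of K 2 x 0 x] by (simp add: v_def u_def)
  ultimately have d: "Q K y - Q K x = bl K v u" by simp
  have "0 \<le> h\<^sup>2 * Q K v + 2 * h * bl K v u + Q K u" "0 \<le> h\<^sup>2 * Q K v - 2 * h * bl K v u + Q K u"
    using Q_combination[of K h v 1 u] Q_combination[of K h v "-1" u]
      Q_nonneg[of K "\<lambda>s. h * v s + 1 * u s"] Q_nonneg[of K "\<lambda>s. h * v s + -1 * u s"] by simp_all
  then have "2 * h * \<bar>bl K v u\<bar> \<le> h\<^sup>2 * Q K v + Q K u" by (simp add: abs_if)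
  then have "\<bar>bl K v u\<bar> \<le> (h\<^sup>2 * Q K v + Q K u) / (2 * h)" using assms by (simp add: field_simps)
  also have "\<dots> = (h * Q K v + Q K u / h) / 2" using assms by (simp add: field_simps power2_eq_square)
  finally show ?thesis unfolding d v_def[abs_def] u_def[abs_def] .
qed

lemma Q_expectation:
  shows "integrable M (\<lambda>\<omega>. Q K (\<lambda>s. w s * X s \<omega>))"
    "(\<integral>\<omega>. Q K (\<lambda>s. w s * X s \<omega>) \<partial>M) = (\<Sum>s\<in>{1..K}. (w s)\<^sup>2 * \<sigma> s s)"
proof -
  have eq: "Q K (\<lambda>s. w s * X s \<omega>) = (\<Sum>s\<in>{1..K}. \<Sum>r\<in>{1..K}. \<sigma> s r * w s * w r * (X s \<omega> * X r \<omega>))" for \<omega>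
    unfolding Q_def by (intro sum.cong refl) simp
  have i: "integrable M (\<lambda>\<omega>. \<sigma> s r * w s * w r * (X s \<omega> * X r \<omega>))" if "s \<in> {1..K}" "r \<in> {1..K}" for s r
    using that by (intro integrable_mult_right X_product) auto
  show "integrable M (\<lambda>\<omega>. Q K (\<lambda>s. w s * X s \<omega>))"
    unfolding eq by (intro Bochner_Integration.integrable_sum i)
  have "(\<integral>\<omega>. Q K (\<lambda>s. w s * X s \<omega>) \<partial>M) = (\<Sum>s\<in>{1..K}. \<Sum>r\<in>{1..K}. \<integral>\<omega>. \<sigma> s r * w s * w r * (X s \<omega> * X r \<omega>) \<partial>M)"
    unfolding eq using i by (subst Bochner_Integration.integral_sum) (auto simp: Bochner_Integration.integral_sum)
  also have "\<dots> = (\<Sum>s\<in>{1..K}. \<Sum>r\<in>{1..K}. if s = r then (w s)\<^sup>2 * \<sigma> s s else 0)"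
    using X_product(2) by (intro sum.cong refl) (auto simp: power2_eq_square)
  finally show "(\<integral>\<omega>. Q K (\<lambda>s. w s * X s \<omega>) \<partial>M) = (\<Sum>s\<in>{1..K}. (w s)\<^sup>2 * \<sigma> s s)" by simp
qed

definition QX :: "nat \<Rightarrow> 'a \<Rightarrow> real" where "QX K \<omega> = Q K (\<lambda>i. X i \<omega>)"

lemma QX_integrable: "integrable M (QX K)"
  using Q_expectation(1)[of K "\<lambda>_. 1"] by (simp add: QX_def[abs_def])

lemma QX_nonneg: "0 \<le> QX K \<omega>" by (simp add: QX_def Q_nonneg)

lemma Q_restrict: "K \<le> N \<Longrightarrow> Q N (\<lambda>s. (if s \<le> K then 1 else 0) * z s) = Q K z"
proof -
  assume "K \<le> N"
  then have "Q N (\<lambda>s. (if s \<le> K then 1 else 0) * z s)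
      = (\<Sum>s\<in>{1..K}. \<Sum>r\<in>{1..N}. \<sigma> s r * ((if s \<le> K then 1 else 0) * z s) * ((if r \<le> K then 1 else 0) * z r))"
    unfolding Q_def by (intro sum.mono_neutral_right) auto
  also have "\<dots> = (\<Sum>s\<in>{1..K}. \<Sum>r\<in>{1..K}. \<sigma> s r * ((if s \<le> K then 1 else 0) * z s) * ((if r \<le> K then 1 else 0) * z r))"
    using \<open>K \<le> N\<close> by (intro sum.cong refl sum.mono_neutral_right) auto
  also have "\<dots> = Q K z" unfolding Q_def by (intro sum.cong refl) simp
  finally show ?thesis .
qed

lemma QX_distance:
  assumes K: "K \<le> N" and h: "0 < h"
  shows "(\<integral>\<omega>. \<bar>QX N \<omega> - QX K \<omega>\<bar> \<partial>M) \<le> 2 * h + tail K / (2 * h)"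
proof -
  define c where "c s = (if s \<le> K then 1 else 0 :: real)" for s
  have le: "\<bar>QX N \<omega> - QX K \<omega>\<bar>
      \<le> (h * Q N (\<lambda>s. (1 + c s) * X s \<omega>) + Q N (\<lambda>s. (1 - c s) * X s \<omega>) / h) / 2" for \<omega>
    using Q_diff_bound[OF h, of N "\<lambda>i. X i \<omega>" "\<lambda>s. c s * X s \<omega>"] Q_restrict[OF K, of "\<lambda>i. X i \<omega>"]
    unfolding QX_def c_def[symmetric] by (simp add: algebra_simps)
  have "(\<integral>\<omega>. \<bar>QX N \<omega> - QX K \<omega>\<bar> \<partial>M)
      \<le> (\<integral>\<omega>. (h * Q N (\<lambda>s. (1 + c s) * X s \<omega>) + Q N (\<lambda>s. (1 - c s) * X s \<omega>) / h) / 2 \<partial>M)"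
    using QX_integrable Q_expectation(1) le by (intro integral_mono) auto
  also have "\<dots> = (h * (\<Sum>s\<in>{1..N}. (1 + c s)\<^sup>2 * \<sigma> s s) + (\<Sum>s\<in>{1..N}. (1 - c s)\<^sup>2 * \<sigma> s s) / h) / 2"
    using Q_expectation(1) by (simp add: Q_expectation(2))
  also have "\<dots> \<le> (h * 4 + tail K / h) / 2"
  proof (intro divide_right_mono add_mono mult_left_mono)
    have "(\<Sum>s\<in>{1..N}. (1 + c s)\<^sup>2 * \<sigma> s s) \<le> (\<Sum>s\<in>{1..N}. 4 * \<sigma> s s)"
      using sigma_nonneg by (intro sum_mono mult_right_mono) (auto simp: c_def)
    also have "\<dots> \<le> 4"
      using sigma_sum_le_1[of N] unfolding sum_distrib_left[symmetric] sum_from_1 by simp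
    finally show "(\<Sum>s\<in>{1..N}. (1 + c s)\<^sup>2 * \<sigma> s s) \<le> 4" .
    have "(\<Sum>s\<in>{1..N}. (1 - c s)\<^sup>2 * \<sigma> s s) = (\<Sum>s\<in>{K<..N}. \<sigma> s s)"
      by (rule sum.mono_neutral_cong_right) (auto simp: c_def)
    also have "\<dots> \<le> tail K"
      unfolding sigma_block[OF K] tail_def
      using sum_le_suminf[OF summable_sigma, of "{..<N}"] sigma_nonneg by simp
    finally show "(\<Sum>s\<in>{1..N}. (1 - c s)\<^sup>2 * \<sigma> s s) \<le> tail K" .
  qed (use h in auto)
  finally show ?thesis using h by (simp add: field_simps)
qed

lemma QX_L1_limit:
  obtains A where "integrable M A" "(\<lambda>K. \<integral>\<omega>. \<bar>QX K \<omega> - A \<omega>\<bar> \<partial>M) \<longlonglongrightarrow> 0" "AE \<omega> in M. 0 \<le> A \<omega>"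
proof -
  have cauchy: "\<exists>N. \<forall>i\<ge>N. \<forall>j\<ge>N. (\<integral>\<omega>. \<bar>QX i \<omega> - QX j \<omega>\<bar> \<partial>M) < e" if e: "0 < e" for e :: real
  proof -
    \<comment> \<open>With \<open>h = e / 8\<close> both terms of \<open>QX_distance\<close> are
      then at most \<open>e / 4\<close>.\<close>
    have "eventually (\<lambda>K. tail K < e\<^sup>2 / 16) sequentially"
      using e by (intro order_tendstoD(2)[OF tail_lim]) simp
    then obtain N where N: "\<And>K. N \<le> K \<Longrightarrow> tail K < e\<^sup>2 / 16" unfolding eventually_sequentially by blast
    have *: "(\<integral>\<omega>. \<bar>QX j \<omega> - QX i \<omega>\<bar> \<partial>M) < e" if "N \<le> i" "i \<le> j" for i j
    proof -
      have h: "0 < e / 8" using e by simp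
      have "(\<integral>\<omega>. \<bar>QX j \<omega> - QX i \<omega>\<bar> \<partial>M) \<le> 2 * (e / 8) + tail i / (2 * (e / 8))"
        by (rule QX_distance[OF that(2) h])
      also have "tail i / (2 * (e / 8)) \<le> (e\<^sup>2 / 16) / (2 * (e / 8))"
        using N[OF that(1)] e by (intro divide_right_mono) auto
      also have "2 * (e / 8) + (e\<^sup>2 / 16) / (2 * (e / 8)) < e"
        using e by (simp add: field_simps power2_eq_square)
      finally show ?thesis by simp
    qed
    show ?thesis
    proof (intro exI[of _ N] allI impI)
      fix i j assume "N \<le> i" "N \<le> j"
      then show "(\<integral>\<omega>. \<bar>QX i \<omega> - QX j \<omega>\<bar> \<partial>M) < e"
        using *[of i j] *[of j i] by (cases "i \<le> j") (auto simp: abs_minus_commute)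
    qed
  qed
  show thesis
  proof (rule L1_complete[OF QX_integrable cauchy])
    fix A r
    assume A: "integrable M A" "(\<lambda>K. \<integral>\<omega>. \<bar>QX K \<omega> - A \<omega>\<bar> \<partial>M) \<longlonglongrightarrow> 0"
      and lim: "AE \<omega> in M. (\<lambda>i. QX (r i) \<omega>) \<longlonglongrightarrow> A \<omega>"
    have "AE \<omega> in M. 0 \<le> A \<omega>"
      using lim
    proof eventually_elim
      case (elim \<omega>)
      then show ?case by (rule LIMSEQ_le_const) (auto intro: QX_nonneg)
    qed
    with A show thesis by (rule that)
  qed
qed

text \<open>The map from \<open>u\<close> to \<open>exp (- u)\<close> is 1-Lipschitz on the
  nonnegative half-line, so \<open>L\<^sup>1\<close> convergence passes directly to the
  expectations.\<close>

lemma exp_QX_limit: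
  assumes A: "integrable M A" "(\<lambda>K. \<integral>\<omega>. \<bar>QX K \<omega> - A \<omega>\<bar> \<partial>M) \<longlonglongrightarrow> 0" "AE \<omega> in M. 0 \<le> A \<omega>"
  shows "(\<lambda>K. \<integral>\<omega>. exp (- t\<^sup>2 / 2 * QX K \<omega>) \<partial>M) \<longlonglongrightarrow> (\<integral>\<omega>. exp (- A \<omega> * t\<^sup>2 / 2) \<partial>M)"
proof -
  have Lip: "\<bar>exp (- u) - exp (- v)\<bar> \<le> \<bar>u - v\<bar>" if "0 \<le> u" "0 \<le> v" for u v :: real
  proof -
    have *: "\<bar>exp (- u) - exp (- v)\<bar> \<le> \<bar>u - v\<bar>" if "0 \<le> u" "u \<le> v" for u v :: real
    proof -
      have "exp (- u) - exp (- v) = exp (- u) * (1 - exp (- (v - u)))"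
        by (simp add: algebra_simps exp_add[symmetric])
      also have "\<dots> \<le> 1 * (1 - exp (- (v - u)))" using that by (intro mult_right_mono) auto
      also have "\<dots> \<le> v - u" unfolding mult_1 using exp_ge_add_one_self[of "- (v - u)"] by linarith
      finally show ?thesis using that by simp
    qed
    show ?thesis using *[of u v] *[of v u] that by (cases "u \<le> v") (auto simp: abs_minus_commute)
  qed
  have Am: "A \<in> borel_measurable M" and Qm: "QX K \<in> borel_measurable M" for K
    using A(1) QX_integrable by auto
  have i1: "integrable M (\<lambda>\<omega>. exp (- t\<^sup>2 / 2 * QX K \<omega>))" for K
    using QX_nonneg Qm[of K] by (intro integrable_const_bound[of _ 1]) auto
  have i2: "integrable M (\<lambda>\<omega>. exp (- A \<omega> * t\<^sup>2 / 2))"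
    using A(3) Am by (intro integrable_const_bound[of _ 1]) auto
  have "(\<lambda>K. (\<integral>\<omega>. exp (- t\<^sup>2 / 2 * QX K \<omega>) \<partial>M) - (\<integral>\<omega>. exp (- A \<omega> * t\<^sup>2 / 2) \<partial>M)) \<longlonglongrightarrow> 0"
  proof (rule Lim_null_comparison)
    show "(\<lambda>K. t\<^sup>2 / 2 * (\<integral>\<omega>. \<bar>QX K \<omega> - A \<omega>\<bar> \<partial>M)) \<longlonglongrightarrow> 0"
      using tendsto_mult[OF tendsto_const A(2), of "t\<^sup>2 / 2"] by simp
    show "eventually (\<lambda>K. norm ((\<integral>\<omega>. exp (- t\<^sup>2 / 2 * QX K \<omega>) \<partial>M) - (\<integral>\<omega>. exp (- A \<omega> * t\<^sup>2 / 2) \<partial>M))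
        \<le> t\<^sup>2 / 2 * (\<integral>\<omega>. \<bar>QX K \<omega> - A \<omega>\<bar> \<partial>M)) sequentially"
    proof (rule always_eventually, rule allI)
      fix K
      have "norm ((\<integral>\<omega>. exp (- t\<^sup>2 / 2 * QX K \<omega>) \<partial>M) - (\<integral>\<omega>. exp (- A \<omega> * t\<^sup>2 / 2) \<partial>M))
          = norm (\<integral>\<omega>. exp (- t\<^sup>2 / 2 * QX K \<omega>) - exp (- A \<omega> * t\<^sup>2 / 2) \<partial>M)"
        using i1[of K] i2 by simp
      also have "\<dots> \<le> (\<integral>\<omega>. norm (exp (- t\<^sup>2 / 2 * QX K \<omega>) - exp (- A \<omega> * t\<^sup>2 / 2)) \<partial>M)"
        by (rule integral_norm_bound)
      also have "\<dots> \<le> (\<integral>\<omega>. t\<^sup>2 / 2 * \<bar>QX K \<omega> - A \<omega>\<bar> \<partial>M)"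
      proof (rule integral_mono_AE)
        show "integrable M (\<lambda>\<omega>. norm (exp (- t\<^sup>2 / 2 * QX K \<omega>) - exp (- A \<omega> * t\<^sup>2 / 2)))"
          using i1[of K] i2 by (intro integrable_norm Bochner_Integration.integrable_diff)
        show "integrable M (\<lambda>\<omega>. t\<^sup>2 / 2 * \<bar>QX K \<omega> - A \<omega>\<bar>)"
          using A(1) QX_integrable[of K] by (intro integrable_mult_right integrable_abs Bochner_Integration.integrable_diff)
        show "AE \<omega> in M. norm (exp (- t\<^sup>2 / 2 * QX K \<omega>) - exp (- A \<omega> * t\<^sup>2 / 2)) \<le> t\<^sup>2 / 2 * \<bar>QX K \<omega> - A \<omega>\<bar>"
          using A(3)
        proof eventually_elim
          case (elim \<omega>)
          have "\<bar>t\<^sup>2 / 2 * QX K \<omega> - A \<omega> * t\<^sup>2 / 2\<bar> = t\<^sup>2 / 2 * \<bar>QX K \<omega> - A \<omega>\<bar>"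
            by (simp add: abs_mult[symmetric] right_diff_distrib mult.commute abs_mult_pos')
          then show ?case
            using Lip[of "t\<^sup>2 / 2 * QX K \<omega>" "A \<omega> * t\<^sup>2 / 2"] elim QX_nonneg[of K \<omega>] by simp
        qed
      qed
      finally show "norm ((\<integral>\<omega>. exp (- t\<^sup>2 / 2 * QX K \<omega>) \<partial>M) - (\<integral>\<omega>. exp (- A \<omega> * t\<^sup>2 / 2) \<partial>M))
        \<le> t\<^sup>2 / 2 * (\<integral>\<omega>. \<bar>QX K \<omega> - A \<omega>\<bar> \<partial>M)" by simp
    qed
  qed
  then show ?thesis by (rule LIM_zero_cancel)
qed

text \<open>Levy's continuity theorem. In the product of the characteristic functions of
  \<open>Q2\<close> and \<open>Q3\<close> the terms with the squares of \<open>\<rho>\<close>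
  cancel, which leaves exactly \<open>Finf\<close>.\<close>

lemma limit_law:
  fixes N :: "'b measure" and Z :: "nat \<Rightarrow> 'b \<Rightarrow> real"
  assumes A: "integrable M A" "(\<lambda>K. \<integral>\<omega>. \<bar>QX K \<omega> - A \<omega>\<bar> \<partial>M) \<longlonglongrightarrow> 0" "AE \<omega> in M. 0 \<le> A \<omega>"
    and N: "prob_space N"
    and Qm: "Q1 \<in> borel_measurable N" "Q2 \<in> borel_measurable N" "Q3 \<in> borel_measurable N"
    and indep: "prob_space.indep_vars N (\<lambda>_. borel) (\<lambda>i::nat. if i = 0 then Q1 else if i = 1 then Q2 else Q3) {0, 1, 2}"
    and Q1: "\<And>t. char (distr N borel Q1) t = of_real (\<integral>\<omega>. exp (- A \<omega> * t\<^sup>2 / 2) \<partial>M)"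
    and Q2: "\<And>t. char (distr N borel Q2) t = of_real (exp (- (1 - (\<Sum>s. \<sigma>d s + (\<rho> (Suc s))\<^sup>2 / 2)) * t\<^sup>2 / 2))"
    and Z: "prob_space.indep_vars N (\<lambda>_. borel) Z {1..}" "\<And>s. Z s \<in> borel_measurable N"
      "\<And>s. 1 \<le> s \<Longrightarrow> distr N borel (Z s) = std_normal_distribution"
      "AE \<omega> in N. (\<lambda>K. (\<Sum>s\<in>{1..K}. \<rho> s * ((Z s \<omega>)\<^sup>2 - 1)) / 2) \<longlonglongrightarrow> Q3 \<omega>"
  shows "weak_conv_m (\<lambda>n. distr M borel (\<lambda>\<omega>. S_G n (G n) (\<lambda>v. X v \<omega>))) (distr N borel (\<lambda>\<omega>. Q1 \<omega> + Q2 \<omega> + Q3 \<omega>))"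
proof (rule levy_continuity)
  interpret N: prob_space N by fact
  show rM: "real_distribution (distr M borel (\<lambda>\<omega>. S_G n (G n) (\<lambda>v. X v \<omega>)))" for n
    by (rule real_distribution_distr[OF S_X_meas])
  show rN: "real_distribution (distr N borel (\<lambda>\<omega>. Q1 \<omega> + Q2 \<omega> + Q3 \<omega>))"
    using Qm by (intro N.real_distribution_distr) auto
  fix t
  show "(\<lambda>n. char (distr M borel (\<lambda>\<omega>. S_G n (G n) (\<lambda>v. X v \<omega>))) t) \<longlonglongrightarrow> char (distr N borel (\<lambda>\<omega>. Q1 \<omega> + Q2 \<omega> + Q3 \<omega>)) t"
  \<comment> \<open>The approximation was proved for \<open>t \<noteq> 0\<close>, where its scales
    \<open>h\<close> and \<open>d\<close> are positive; at zero every characteristic function is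
    one.\<close>
  proof (cases "t = 0")
    case True
    then show ?thesis using real_distribution.char_zero[OF rM] real_distribution.char_zero[OF rN] by simp
  next
    case False
    have "(\<lambda>\<omega>. \<Sum>i\<in>{0, 1, 2 :: nat}. (if i = 0 then Q1 else if i = 1 then Q2 else Q3) \<omega>) = (\<lambda>\<omega>. Q1 \<omega> + Q2 \<omega> + Q3 \<omega>)"
      by (simp add: add.assoc)
    with N.char_distr_sum[OF indep, of t]
    have split: "char (distr N borel (\<lambda>\<omega>. Q1 \<omega> + Q2 \<omega> + Q3 \<omega>)) t
        = char (distr N borel Q1) t * (char (distr N borel Q2) t * char (distr N borel Q3) t)"
      by simp
    have Q3: "char (distr N borel Q3) t
        = exp (((\<Sum>s. psi3 (t * \<rho> (Suc s))) - of_real (t\<^sup>2 / 2 * (\<Sum>s. (\<rho> (Suc s))\<^sup>2))) / 2)"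
      by (rule char_weighted_chi_square[OF N Z(2) Qm(3) Z(1,3,4) summable_rho summable_psi3_rho])
    have S: "(\<Sum>s. \<sigma>d s + (\<rho> (Suc s))\<^sup>2 / 2) = (\<Sum>s. \<sigma>d s) + (\<Sum>s. (\<rho> (Suc s))\<^sup>2) / 2"
      using suminf_add[OF summable_sigma summable_divide[OF summable_rho, of 2]] suminf_divide[OF summable_rho, of 2] by simp
    have "char (distr N borel Q2) t * char (distr N borel Q3) t = Finf t"
      unfolding Q2 Q3 Finf_def S exp_of_real[symmetric] exp_add[symmetric]
      by (intro arg_cong[of _ _ exp]) (simp add: field_simps)
    moreover have "phi t \<longlonglongrightarrow> of_real (\<integral>\<omega>. exp (- A \<omega> * t\<^sup>2 / 2) \<partial>M) * Finf t"
      using limit_char[OF False exp_QX_limit[OF A, of t, unfolded QX_def]] .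
    ultimately show ?thesis unfolding split Q1 phi_def[symmetric] by simp
  qed
qed

end

text \<open>The bound by one on the series makes the variance of \<open>Q2\<close> nonnegative. The
  chi-square variables are the squares of a Gaussian sequence \<open>Z\<close>, and
  \<open>Q3\<close> is the almost sure limit of the weighted partial sums.\<close>

theorem theorem1p1:
  fixes M :: "'a measure" and X :: "nat \<Rightarrow> 'a \<Rightarrow> real"
    and G :: "nat \<Rightarrow> nat \<Rightarrow> nat \<Rightarrow> bool"
    and \<sigma> :: "nat \<Rightarrow> nat \<Rightarrow> real" and \<rho> :: "nat \<Rightarrow> real"
  assumes M: "prob_space M"
    and X_meas: "\<And>i. 1 \<le> i \<Longrightarrow> X i \<in> borel_measurable M"
    and X_indep: "prob_space.indep_vars M (\<lambda>_. borel) X {1..}"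
    and X_ident: "\<And>i. 1 \<le> i \<Longrightarrow> distr M borel (X i) = distr M borel (X 1)"
    and X_int: "integrable M (X 1)" and X_mean: "integral\<^sup>L M (X 1) = 0"
    and X_int2: "integrable M (\<lambda>\<omega>. (X 1 \<omega>)\<^sup>2)" and X_var: "integral\<^sup>L M (\<lambda>\<omega>. (X 1 \<omega>)\<^sup>2) = 1"
    and G_class: "\<And>n. 1 \<le> n \<Longrightarrow> in_graph_class n (G n)"
    and E_infty: "filterlim (\<lambda>n. real (num_edges n (G n))) at_top sequentially"
    and codegree: "\<And>s t. 1 \<le> s \<Longrightarrow> 1 \<le> t \<Longrightarrow>
        (\<lambda>n. (\<Sum>v\<in>{1..n}. adj (G n) s v * adj (G n) v t) / real (num_edges n (G n)))
          \<longlonglongrightarrow> \<sigma> s t"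
    and spectral: "\<And>s. 1 \<le> s \<Longrightarrow> \<exists>L :: nat \<Rightarrow> real.
        (\<forall>K. (\<lambda>n. eigval_nK n K (G n) s / sqrt (real (num_edges n (G n)))) \<longlonglongrightarrow> L K)
        \<and> L \<longlonglongrightarrow> \<rho> s"
  shows "summable (\<lambda>s. \<sigma> (Suc s) (Suc s) + (\<rho> (Suc s))\<^sup>2 / 2)
    \<and> (\<Sum>s. \<sigma> (Suc s) (Suc s) + (\<rho> (Suc s))\<^sup>2 / 2) \<le> 1
    \<and> (\<exists>A. A \<in> borel_measurable M \<and> integrable M A
       \<and> (\<lambda>K. \<integral>\<omega>. \<bar>(\<Sum>s\<in>{1..K}. \<Sum>t\<in>{1..K}. \<sigma> s t * X s \<omega> * X t \<omega>) - A \<omega>\<bar> \<partial>M)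
            \<longlonglongrightarrow> 0
       \<and> (\<forall>(N :: 'b measure) Q1 Q2 Q3 (Z :: nat \<Rightarrow> 'b \<Rightarrow> real).
            prob_space N
            \<and> Q1 \<in> borel_measurable N \<and> Q2 \<in> borel_measurable N \<and> Q3 \<in> borel_measurable N
            \<and> prob_space.indep_vars N (\<lambda>_. borel)
                 (\<lambda>i::nat. if i = 0 then Q1 else if i = 1 then Q2 else Q3) {0, 1, 2}
            \<and> (\<forall>t. char (distr N borel Q1) t
                    = complex_of_real (\<integral>\<omega>. exp (- A \<omega> * t\<^sup>2 / 2) \<partial>M))
            \<and> (\<forall>t. char (distr N borel Q2) t
                    = complex_of_real (exp (- (1 - (\<Sum>s. \<sigma> (Suc s) (Suc s) + (\<rho> (Suc s))\<^sup>2 / 2))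
                                          * t\<^sup>2 / 2)))
            \<and> (\<forall>s. Z s \<in> borel_measurable N)
            \<and> prob_space.indep_vars N (\<lambda>_. borel) Z {1..}
            \<and> (\<forall>s. 1 \<le> s \<longrightarrow> distr N borel (Z s) = density lborel std_normal_density)
            \<and> (AE \<omega> in N. (\<lambda>K. (\<Sum>s\<in>{1..K}. \<rho> s * ((Z s \<omega>)\<^sup>2 - 1)) / 2) \<longlonglongrightarrow> Q3 \<omega>)
            \<longrightarrow> weak_conv_m (\<lambda>n. distr M borel (\<lambda>\<omega>. S_G n (G n) (\<lambda>v. X v \<omega>)))
                            (distr N borel (\<lambda>\<omega>. Q1 \<omega> + Q2 \<omega> + Q3 \<omega>))))"
proof -
  \<comment> \<open>The condition on \<open>s\<close> is moved under the existential quantifier so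
    that one choice yields the inner limits for all \<open>s\<close>.\<close>
  have "\<forall>s. \<exists>L. 1 \<le> s \<longrightarrow> (\<forall>K. (\<lambda>n. eigval_nK n K (G n) s / sqrt (real (num_edges n (G n)))) \<longlonglongrightarrow> L K)
        \<and> L \<longlonglongrightarrow> \<rho> s"
    using spectral by blast
  from choice[OF this] obtain ev where ev:
    "\<And>s. 1 \<le> s \<Longrightarrow> (\<forall>K. (\<lambda>n. eigval_nK n K (G n) s / sqrt (real (num_edges n (G n)))) \<longlonglongrightarrow> ev s K) \<and> ev s \<longlonglongrightarrow> \<rho> s"
    by blast
  interpret prob_space M by fact
  have ev1: "(\<lambda>n. eigval_nK n K (G n) s / sqrt (real (num_edges n (G n)))) \<longlonglongrightarrow> ev s K" if "1 \<le> s" for s K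
    using ev[OF that] by blast
  have ev2: "ev s \<longlonglongrightarrow> \<rho> s" if "1 \<le> s" for s using ev[OF that] by blast
  interpret codegree_spectral_limit M X G \<sigma> \<rho> ev
    by (unfold_locales; fact X_meas X_indep X_ident X_int X_mean X_int2 X_var G_class E_infty codegree ev1 ev2)
  obtain A where A: "integrable M A" "(\<lambda>K. \<integral>\<omega>. \<bar>QX K \<omega> - A \<omega>\<bar> \<partial>M) \<longlonglongrightarrow> 0" "AE \<omega> in M. 0 \<le> A \<omega>"
    by (rule QX_L1_limit)
  show ?thesis
  proof (intro conjI exI[of _ A] allI impI)
    show "A \<in> borel_measurable M" using A(1) by simp
    show "(\<lambda>K. \<integral>\<omega>. \<bar>(\<Sum>s\<in>{1..K}. \<Sum>t\<in>{1..K}. \<sigma> s t * X s \<omega> * X t \<omega>) - A \<omega>\<bar> \<partial>M) \<longlonglongrightarrow> 0"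
      using A(2) unfolding QX_def Q_def .
  qed (rule summable_total, rule total_le_1, rule A(1), elim conjE, rule limit_law[OF A], (assumption | blast)+)
qed

end
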